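(* Let $p\in\mathbb{R}$ with $p>1$, let $n\in\mathbb{N}$, and let $G$ be a group of type $FP_n$ which has infinitely many finite conjugacy classes. Then $\overline{H^{(p)}_i(G)}=0$ and $\overline{H_{(p)}^i(G)}=0$ for all $i\le n$.
   Context: $\mathbb{Z}[G]$ is the integral group ring and $\mathbb{Z}$ is the trivial $\mathbb{Z}[G]$-module. A group $G$ is of type $FP_n$ if there is an exact sequence $F_n\to\dots\to F_0\to\mathbb{Z}\to 0$ of $\mathbb{Z}[G]$-modules with $F_0,\dots,F_n$ projective and finitely generated. For real $p\ge 1$, $l^p(G)$ is the Banach space of formal sums $f=\sum_{g\in G}f_g g$ with $f_g\in\mathbb{C}$, only countably many $f_g\ne 0$, and $\sum_{g}|f_g|^p=(|f|_p)^p<\infty$; it is a $\mathbb{Z}[G]$-module via translation by $G$. For a projective resolution $\cdots\to F_2\xrightarrow{\partial_2}F_1\xrightarrow{\partial_1}F_0\xrightarrow{\varepsilon}\mathbb{Z}\to 0$ over $\mathbb{Z}[G]$, consider the chain complex $F_i\otimes_{\mathbb{Z}[G]}l^p(G)$, $i\ge0$, with boundary maps $\partial_i\otimes 1$ (left modules being turned into right modules via $xg=g^{-1}x$ when forming tensor products), and the cochain complex $\operatorname{Hom}_{\mathbb{Z}[G]}(F_i,l^p(G))$, $i\ge 0$, with $\widetilde\partial_i(\varphi)=\varphi\circ\partial_i$ (maps with index $0$ are zero). The reduced $l^p$-homology and $l^p$-cohomology are $\overline{H^{(p)}_i(G)}=\ker(\partial_i\otimes1)/\overline{\operatorname{im}(\partial_{i+1}\otimes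 1)}$ and $\overline{H_{(p)}^i(G)}=\ker(\widetilde\partial_{i+1})/\overline{\operatorname{im}(\widetilde\partial_i)}$. For $G$ of type $FP_n$ the resolution is taken with $F_0,\dots,F_n$ finitely generated; then for $i\le n$ the spaces $F_i\otimes_{\mathbb{Z}[G]}l^p(G)$ and $\operatorname{Hom}_{\mathbb{Z}[G]}(F_i,l^p(G))$ carry natural Banach space topologies (both are $l^p(G)^{m_i}$ if $F_i$ is free of rank $m_i$), in which the closures are taken. *)

theory Defs
  imports
    "HOL-Analysis.Analysis"
    "HOL-Algebra.Module"
    "HOL-Algebra.Group_Action"
    "HOL-Algebra.Elementary_Groups"
    "HOL-Algebra.Free_Abelian_Groups"
begin

section \<open>Modules over a (not necessarily commutative) ring\<close>

text \<open>
  The library locale \<open>module\<close> requires a commutative ring. Left modules use the same record type;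
  the fields \<open>mult\<close> and \<open>one\<close> of a module record play no role.
\<close>

locale left_module = R?: ring R + M?: abelian_group M
  for R :: "('a, 's) ring_scheme" (structure) and M :: "('a, 'b, 'c) module_scheme" (structure) +
  assumes smult_closed [simp, intro]:
      "\<lbrakk>a \<in> carrier R; x \<in> carrier M\<rbrakk> \<Longrightarrow> a \<odot>\<^bsub>M\<^esub> x \<in> carrier M"
    and smult_l_distr:
      "\<lbrakk>a \<in> carrier R; b \<in> carrier R; x \<in> carrier M\<rbrakk> \<Longrightarrow>
      (a \<oplus>\<^bsub>R\<^esub> b) \<odot>\<^bsub>M\<^esub> x = a \<odot>\<^bsub>M\<^esub> x \<oplus>\<^bsub>M\<^esub> b \<odot>\<^bsub>M\<^esub> x"
    and smult_r_distr:
      "\<lbrakk>a \<in> carrier R; x \<in> carrier M; y \<in> carrier M\<rbrakk> \<Longrightarrow>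
      a \<odot>\<^bsub>M\<^esub> (x \<oplus>\<^bsub>M\<^esub> y) = a \<odot>\<^bsub>M\<^esub> x \<oplus>\<^bsub>M\<^esub> a \<odot>\<^bsub>M\<^esub> y"
    and smult_assoc1:
      "\<lbrakk>a \<in> carrier R; b \<in> carrier R; x \<in> carrier M\<rbrakk> \<Longrightarrow>
      (a \<otimes>\<^bsub>R\<^esub> b) \<odot>\<^bsub>M\<^esub> x = a \<odot>\<^bsub>M\<^esub> (b \<odot>\<^bsub>M\<^esub> x)"
    and smult_one [simp]:
      "x \<in> carrier M \<Longrightarrow> \<one>\<^bsub>R\<^esub> \<odot>\<^bsub>M\<^esub> x = x"

definition mod_hom ::
    "('r, 's) ring_scheme \<Rightarrow> ('r, 'm, 'x) module_scheme \<Rightarrow> ('r, 'n, 'y) module_scheme \<Rightarrow> ('m \<Rightarrow> 'n) set"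
  where "mod_hom R M N =
    {h \<in> carrier M \<rightarrow> carrier N.
       (\<forall>x\<in>carrier M. \<forall>y\<in>carrier M. h (x \<oplus>\<^bsub>M\<^esub> y) = h x \<oplus>\<^bsub>N\<^esub> h y) \<and>
       (\<forall>r\<in>carrier R. \<forall>x\<in>carrier M. h (r \<odot>\<^bsub>M\<^esub> x) = r \<odot>\<^bsub>N\<^esub> h x)}"

definition fin_generated :: "('r, 's) ring_scheme \<Rightarrow> ('r, 'm, 'x) module_scheme \<Rightarrow> bool"
  where "fin_generated R M \<longleftrightarrow>
    (\<exists>S. finite S \<and> S \<subseteq> carrier M \<and>
       (\<forall>x\<in>carrier M. \<exists>c\<in>S \<rightarrow> carrier R. x = (\<Oplus>\<^bsub>M\<^esub>s\<in>S. c s \<odot>\<^bsub>M\<^esub> s)))"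

definition free_module :: "('r, 's) ring_scheme \<Rightarrow> 'x set \<Rightarrow> ('r, 'x \<Rightarrow> 'r) module"
  where "free_module R X =
    \<lparr>carrier = {f \<in> X \<rightarrow>\<^sub>E carrier R. finite {x \<in> X. f x \<noteq> \<zero>\<^bsub>R\<^esub>}},
     monoid.mult = undefined, one = undefined,
     ring.zero = (\<lambda>x\<in>X. \<zero>\<^bsub>R\<^esub>),
     ring.add = (\<lambda>f g. \<lambda>x\<in>X. f x \<oplus>\<^bsub>R\<^esub> g x),
     module.smult = (\<lambda>r f. \<lambda>x\<in>X. r \<otimes>\<^bsub>R\<^esub> f x)\<rparr>"

text \<open>
  Projective means: direct summand of a free module. It is no restriction that the basis is taken
  from the type of the module, since a direct summand of any free module is one of the free module on
  its own elements.
\<close>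

definition projective_module :: "('r, 's) ring_scheme \<Rightarrow> ('r, 'm, 'x) module_scheme \<Rightarrow> bool"
  where "projective_module R P \<longleftrightarrow>
    left_module R P \<and>
    (\<exists>(X :: 'm set) \<iota> \<pi>.
       \<iota> \<in> mod_hom R P (free_module R X) \<and> \<pi> \<in> mod_hom R (free_module R X) P \<and>
       (\<forall>x\<in>carrier P. \<pi> (\<iota> x) = x))"

text \<open>
  \<open>F\<^sub>n \<rightarrow> \<dots> \<rightarrow> F\<^sub>0 \<rightarrow> A \<rightarrow> 0\<close>, exact at \<open>F\<^bsub>n-1\<^esub>, \<dots>, F\<^sub>0, A\<close>. The map \<open>d i\<close> goes from \<open>F i\<close> to
  \<open>F (i - 1)\<close>; the value \<open>d 0\<close> is never used.
\<close>

definition partial_projective_resolution ::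
    "('r, 's) ring_scheme \<Rightarrow> ('r, 'a, 'x) module_scheme \<Rightarrow> nat \<Rightarrow>
      (nat \<Rightarrow> ('r, 'm, 'y) module_scheme) \<Rightarrow> (nat \<Rightarrow> 'm \<Rightarrow> 'm) \<Rightarrow> ('m \<Rightarrow> 'a) \<Rightarrow> bool"
  where "partial_projective_resolution R A n F d \<epsilon> \<longleftrightarrow>
    (\<forall>i\<le>n. projective_module R (F i)) \<and>
    (\<forall>i<n. d (Suc i) \<in> mod_hom R (F (Suc i)) (F i)) \<and>
    \<epsilon> \<in> mod_hom R (F 0) A \<and>
    \<epsilon> ` carrier (F 0) = carrier A \<and>
    (0 < n \<longrightarrow> d 1 ` carrier (F 1) = {x \<in> carrier (F 0). \<epsilon> x = \<zero>\<^bsub>A\<^esub>}) \<and>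
    (\<forall>i. Suc i < n \<longrightarrow>
       d (Suc (Suc i)) ` carrier (F (Suc (Suc i))) =
         {x \<in> carrier (F (Suc i)). d (Suc i) x = \<zero>\<^bsub>F i\<^esub>})"

definition projective_resolution ::
    "('r, 's) ring_scheme \<Rightarrow> ('r, 'a, 'x) module_scheme \<Rightarrow>
      (nat \<Rightarrow> ('r, 'm, 'y) module_scheme) \<Rightarrow> (nat \<Rightarrow> 'm \<Rightarrow> 'm) \<Rightarrow> ('m \<Rightarrow> 'a) \<Rightarrow> bool"
  where "projective_resolution R A F d \<epsilon> \<longleftrightarrow> (\<forall>n. partial_projective_resolution R A n F d \<epsilon>)"


section \<open>The integral group ring\<close>

definition group_ring :: "('g, 'b) monoid_scheme \<Rightarrow> ('g \<Rightarrow>\<^sub>0 int) ring"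
  where "group_ring G =
    \<lparr>carrier = {a. Poly_Mapping.keys a \<subseteq> carrier G},
     monoid.mult = (\<lambda>a b. frag_extend (\<lambda>g. frag_extend (\<lambda>h. frag_of (g \<otimes>\<^bsub>G\<^esub> h)) b) a),
     one = frag_of \<one>\<^bsub>G\<^esub>,
     ring.zero = 0,
     ring.add = (+)\<rparr>"

definition trivial_module :: "('g \<Rightarrow>\<^sub>0 int, int) module"
  where "trivial_module =
    \<lparr>carrier = UNIV, monoid.mult = undefined, one = undefined, ring.zero = 0, ring.add = (+),
     module.smult = (\<lambda>a n. (\<Sum>g\<in>Poly_Mapping.keys a. Poly_Mapping.lookup a g) * n)\<rparr>"

text \<open>The involution \<open>g \<mapsto> g\<^sup>-\<^sup>1\<close>; a left module becomes a right module by \<open>x a = a\<^sup>* x\<close>.\<close>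

definition group_ring_star :: "('g, 'b) monoid_scheme \<Rightarrow> ('g \<Rightarrow>\<^sub>0 int) \<Rightarrow> ('g \<Rightarrow>\<^sub>0 int)"
  where "group_ring_star G = frag_extend (\<lambda>g. frag_of (inv\<^bsub>G\<^esub> g))"

text \<open>
  Every finitely generated projective \<open>\<int>[G]\<close>-module is isomorphic to a submodule of
  \<^term>\<open>free_module (group_ring G) {..<k::nat}\<close> for some \<open>k\<close>, so it is no restriction to look
  for \<open>F\<^sub>0, \<dots>, F\<^sub>n\<close> in the type \<^typ>\<open>nat \<Rightarrow> ('g \<Rightarrow>\<^sub>0 int)\<close>.
\<close>

definition type_FP :: "nat \<Rightarrow> ('g, 'b) monoid_scheme \<Rightarrow> bool"
  where "type_FP n G \<longleftrightarrow>
    (\<exists>(F :: nat \<Rightarrow> ('g \<Rightarrow>\<^sub>0 int, nat \<Rightarrow> ('g \<Rightarrow>\<^sub>0 int)) module) d \<epsilon>.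
       partial_projective_resolution (group_ring G) trivial_module n F d \<epsilon> \<and>
       (\<forall>i\<le>n. fin_generated (group_ring G) (F i)))"

definition conjugacy_classes :: "('g, 'b) monoid_scheme \<Rightarrow> 'g set set"
  where "conjugacy_classes G =
    orbits G (carrier G) (\<lambda>g. \<lambda>h\<in>carrier G. g \<otimes>\<^bsub>G\<^esub> h \<otimes>\<^bsub>G\<^esub> inv\<^bsub>G\<^esub> g)"


section \<open>Tensor products over the group ring\<close>

definition tensor_relations ::
    "('g, 'b) monoid_scheme \<Rightarrow> ('g \<Rightarrow>\<^sub>0 int, 'm, 'x) module_scheme \<Rightarrow>
      ('g \<Rightarrow>\<^sub>0 int, 'n, 'y) module_scheme \<Rightarrow> ('m \<times> 'n \<Rightarrow>\<^sub>0 int) set"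
  where "tensor_relations G M N =
    {frag_of (x \<oplus>\<^bsub>M\<^esub> x', y) - frag_of (x, y) - frag_of (x', y) | x x' y.
       x \<in> carrier M \<and> x' \<in> carrier M \<and> y \<in> carrier N} \<union>
    {frag_of (x, y \<oplus>\<^bsub>N\<^esub> y') - frag_of (x, y) - frag_of (x, y') | x y y'.
       x \<in> carrier M \<and> y \<in> carrier N \<and> y' \<in> carrier N} \<union>
    {frag_of (group_ring_star G a \<odot>\<^bsub>M\<^esub> x, y) - frag_of (x, a \<odot>\<^bsub>N\<^esub> y) | a x y.
       a \<in> carrier (group_ring G) \<and> x \<in> carrier M \<and> y \<in> carrier N}"

definition tensor_subgroup ::
    "('g, 'b) monoid_scheme \<Rightarrow> ('g \<Rightarrow>\<^sub>0 int, 'm, 'x) module_scheme \<Rightarrow>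
      ('g \<Rightarrow>\<^sub>0 int, 'n, 'y) module_scheme \<Rightarrow> ('m \<times> 'n \<Rightarrow>\<^sub>0 int) set"
  where "tensor_subgroup G M N =
    generate (free_Abelian_group (carrier M \<times> carrier N)) (tensor_relations G M N)"

text \<open>The abelian group \<open>M \<otimes>\<^bsub>\<int>[G]\<^esub> N\<close> (written multiplicatively).\<close>

definition tensor_product ::
    "('g, 'b) monoid_scheme \<Rightarrow> ('g \<Rightarrow>\<^sub>0 int, 'm, 'x) module_scheme \<Rightarrow>
      ('g \<Rightarrow>\<^sub>0 int, 'n, 'y) module_scheme \<Rightarrow> ('m \<times> 'n \<Rightarrow>\<^sub>0 int) set monoid"
  where "tensor_product G M N =
    free_Abelian_group (carrier M \<times> carrier N) Mod tensor_subgroup G M N"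

definition elem_tensor ::
    "('g, 'b) monoid_scheme \<Rightarrow> ('g \<Rightarrow>\<^sub>0 int, 'm, 'x) module_scheme \<Rightarrow>
      ('g \<Rightarrow>\<^sub>0 int, 'n, 'y) module_scheme \<Rightarrow> 'm \<Rightarrow> 'n \<Rightarrow> ('m \<times> 'n \<Rightarrow>\<^sub>0 int) set"
  where "elem_tensor G M N x y =
    tensor_subgroup G M N #>\<^bsub>free_Abelian_group (carrier M \<times> carrier N)\<^esub> frag_of (x, y)"

text \<open>The map \<open>h \<otimes> 1 : M \<otimes> N \<rightarrow> M' \<otimes> N\<close> induced by a module homomorphism \<open>h : M \<rightarrow> M'\<close>.\<close>

definition tensor_map ::
    "('g, 'b) monoid_scheme \<Rightarrow> ('g \<Rightarrow>\<^sub>0 int, 'm, 'x) module_scheme \<Rightarrow>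
      ('g \<Rightarrow>\<^sub>0 int, 'k, 'z) module_scheme \<Rightarrow> ('g \<Rightarrow>\<^sub>0 int, 'n, 'y) module_scheme \<Rightarrow>
      ('m \<Rightarrow> 'k) \<Rightarrow> ('m \<times> 'n \<Rightarrow>\<^sub>0 int) set \<Rightarrow> ('k \<times> 'n \<Rightarrow>\<^sub>0 int) set"
  where "tensor_map G M M' N h C =
    the_elem ((\<lambda>c. tensor_subgroup G M' N #>\<^bsub>free_Abelian_group (carrier M' \<times> carrier N)\<^esub>
                     frag_extend (\<lambda>(x, y). frag_of (h x, y)) c) ` C)"


section \<open>The spaces \<open>l\<^sup>p(G)\<close>\<close>

text \<open>
  Formal sums are functions on the type vanishing outside \<open>G\<close>; summability implies that only countably
  many coefficients are nonzero. The action is the linear extension of \<open>(g f)\<^sub>x = f\<^bsub>g\<^sup>-\<^sup>1x\<^esub>\<close>, which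
  sends the formal sum of the \<open>f\<^sub>x x\<close> to the formal sum of the \<open>f\<^sub>x g x\<close>.
\<close>

definition lp_module :: "('g, 'b) monoid_scheme \<Rightarrow> real \<Rightarrow> ('g \<Rightarrow>\<^sub>0 int, 'g \<Rightarrow> complex) module"
  where "lp_module G p =
    \<lparr>carrier = {f. (\<forall>x. x \<notin> carrier G \<longrightarrow> f x = 0) \<and>
                   (\<lambda>x. cmod (f x) powr p) summable_on carrier G},
     monoid.mult = undefined, one = undefined,
     ring.zero = (\<lambda>x. 0),
     ring.add = (\<lambda>f g x. f x + g x),
     module.smult = (\<lambda>a f x. if x \<in> carrier G
       then \<Sum>g\<in>Poly_Mapping.keys a. of_int (Poly_Mapping.lookup a g) * f (inv\<^bsub>G\<^esub> g \<otimes>\<^bsub>G\<^esub> x)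
       else 0)\<rparr>"

definition lp_norm :: "('g, 'b) monoid_scheme \<Rightarrow> real \<Rightarrow> ('g \<Rightarrow> complex) \<Rightarrow> real"
  where "lp_norm G p f = (\<Sum>\<^sub>\<infinity>x\<in>carrier G. cmod (f x) powr p) powr (1 / p)"

definition lp_topology :: "('g, 'b) monoid_scheme \<Rightarrow> real \<Rightarrow> ('g \<Rightarrow> complex) topology"
  where "lp_topology G p =
    Metric_space.mtopology (carrier (lp_module G p)) (\<lambda>f g. lp_norm G p (\<lambda>x. f x - g x))"


section \<open>Reduced \<open>l\<^sup>p\<close>-homology\<close>

abbreviation lp_tensor ::
    "('g, 'b) monoid_scheme \<Rightarrow> real \<Rightarrow> ('g \<Rightarrow>\<^sub>0 int, 'm, 'x) module_scheme \<Rightarrow>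
      ('m \<times> ('g \<Rightarrow> complex) \<Rightarrow>\<^sub>0 int) set monoid"
  where "lp_tensor G p M \<equiv> tensor_product G M (lp_module G p)"

text \<open>
  The finest topology on \<open>M \<otimes> l\<^sup>p(G)\<close> for which all maps
  \<open>l\<^sup>p(G)\<^sup>m \<rightarrow> M \<otimes> l\<^sup>p(G), (f\<^sub>j) \<mapsto> \<Sum>\<^sub>j x\<^sub>j \<otimes> f\<^sub>j\<close>, with \<open>x\<^sub>j \<in> M\<close>, are continuous. If \<open>M\<close> is generated by
  \<open>x\<^sub>1, \<dots>, x\<^sub>m\<close>, all these maps factor continuously through the one given by \<open>x\<^sub>1, \<dots>, x\<^sub>m\<close>,
  so this is the quotient topology of \<open>l\<^sup>p(G)\<^sup>m\<close>. In particular it is the topology of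
  \<open>l\<^sup>p(G)\<^sup>m\<close> if \<open>M\<close> is free of rank \<open>m\<close>.
\<close>

definition lp_tensor_open ::
    "('g, 'b) monoid_scheme \<Rightarrow> real \<Rightarrow> ('g \<Rightarrow>\<^sub>0 int, 'm, 'x) module_scheme \<Rightarrow>
      ('m \<times> ('g \<Rightarrow> complex) \<Rightarrow>\<^sub>0 int) set set \<Rightarrow> bool"
  where "lp_tensor_open G p M U \<longleftrightarrow>
    U \<subseteq> carrier (lp_tensor G p M) \<and>
    (\<forall>(m::nat) x. x \<in> {..<m} \<rightarrow> carrier M \<longrightarrow>
       openin (product_topology (\<lambda>_. lp_topology G p) {..<m})
         {f \<in> {..<m} \<rightarrow>\<^sub>E carrier (lp_module G p).
            (\<Otimes>\<^bsub>lp_tensor G p M\<^esub>j\<in>{..<m}. elem_tensor G M (lp_module G p) (x j) (f j)) \<in> U})"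

definition lp_tensor_topology ::
    "('g, 'b) monoid_scheme \<Rightarrow> real \<Rightarrow> ('g \<Rightarrow>\<^sub>0 int, 'm, 'x) module_scheme \<Rightarrow>
      ('m \<times> ('g \<Rightarrow> complex) \<Rightarrow>\<^sub>0 int) set topology"
  where "lp_tensor_topology G p M = topology (lp_tensor_open G p M)"

definition lp_boundary ::
    "('g, 'b) monoid_scheme \<Rightarrow> real \<Rightarrow> (nat \<Rightarrow> ('g \<Rightarrow>\<^sub>0 int, 'm, 'x) module_scheme) \<Rightarrow>
      (nat \<Rightarrow> 'm \<Rightarrow> 'm) \<Rightarrow> nat \<Rightarrow>
      ('m \<times> ('g \<Rightarrow> complex) \<Rightarrow>\<^sub>0 int) set \<Rightarrow> ('m \<times> ('g \<Rightarrow> complex) \<Rightarrow>\<^sub>0 int) set"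
  where "lp_boundary G p F d i = tensor_map G (F i) (F (i - 1)) (lp_module G p) (d i)"

definition lp_cycles ::
    "('g, 'b) monoid_scheme \<Rightarrow> real \<Rightarrow> (nat \<Rightarrow> ('g \<Rightarrow>\<^sub>0 int, 'm, 'x) module_scheme) \<Rightarrow>
      (nat \<Rightarrow> 'm \<Rightarrow> 'm) \<Rightarrow> nat \<Rightarrow> ('m \<times> ('g \<Rightarrow> complex) \<Rightarrow>\<^sub>0 int) set set"
  where "lp_cycles G p F d i =
    (if i = 0 then carrier (lp_tensor G p (F 0))
     else kernel (lp_tensor G p (F i)) (lp_tensor G p (F (i - 1))) (lp_boundary G p F d i))"

definition lp_boundaries ::
    "('g, 'b) monoid_scheme \<Rightarrow> real \<Rightarrow> (nat \<Rightarrow> ('g \<Rightarrow>\<^sub>0 int, 'm, 'x) module_scheme) \<Rightarrow>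
      (nat \<Rightarrow> 'm \<Rightarrow> 'm) \<Rightarrow> nat \<Rightarrow> ('m \<times> ('g \<Rightarrow> complex) \<Rightarrow>\<^sub>0 int) set set"
  where "lp_boundaries G p F d i =
    lp_boundary G p F d (Suc i) ` carrier (lp_tensor G p (F (Suc i)))"

definition reduced_lp_homology ::
    "('g, 'b) monoid_scheme \<Rightarrow> real \<Rightarrow> (nat \<Rightarrow> ('g \<Rightarrow>\<^sub>0 int, 'm, 'x) module_scheme) \<Rightarrow>
      (nat \<Rightarrow> 'm \<Rightarrow> 'm) \<Rightarrow> nat \<Rightarrow> ('m \<times> ('g \<Rightarrow> complex) \<Rightarrow>\<^sub>0 int) set set monoid"
  where "reduced_lp_homology G p F d i =
    (lp_tensor G p (F i))\<lparr>carrier := lp_cycles G p F d i\<rparr>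
      Mod (lp_tensor_topology G p (F i) closure_of lp_boundaries G p F d i)"


section \<open>Reduced \<open>l\<^sup>p\<close>-cohomology\<close>

text \<open>The abelian group \<open>Hom\<^bsub>\<int>[G]\<^esub>(M, l\<^sup>p(G))\<close> (written multiplicatively).\<close>

definition lp_hom ::
    "('g, 'b) monoid_scheme \<Rightarrow> real \<Rightarrow> ('g \<Rightarrow>\<^sub>0 int, 'm, 'x) module_scheme \<Rightarrow>
      ('m \<Rightarrow> 'g \<Rightarrow> complex) monoid"
  where "lp_hom G p M =
    \<lparr>carrier = mod_hom (group_ring G) M (lp_module G p) \<inter> extensional (carrier M),
     monoid.mult = (\<lambda>\<phi> \<psi>. \<lambda>x\<in>carrier M. \<phi> x \<oplus>\<^bsub>lp_module G p\<^esub> \<psi> x),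
     one = (\<lambda>x\<in>carrier M. \<zero>\<^bsub>lp_module G p\<^esub>)\<rparr>"

text \<open>
  The topology of pointwise convergence in the norm. If \<open>M\<close> is generated by
  \<open>x\<^sub>1, \<dots>, x\<^sub>m\<close>, it is induced by the embedding \<open>\<phi> \<mapsto> (\<phi>(x\<^sub>j))\<^sub>j\<close> into \<open>l\<^sup>p(G)\<^sup>m\<close>, which is bijective if
  the \<open>x\<^sub>j\<close> form a basis.
\<close>

definition lp_hom_topology ::
    "('g, 'b) monoid_scheme \<Rightarrow> real \<Rightarrow> ('g \<Rightarrow>\<^sub>0 int, 'm, 'x) module_scheme \<Rightarrow>
      ('m \<Rightarrow> 'g \<Rightarrow> complex) topology"
  where "lp_hom_topology G p M =
    subtopology (product_topology (\<lambda>_. lp_topology G p) (carrier M)) (carrier (lp_hom G p M))"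

text \<open>For \<open>i > 0\<close>, the map \<open>\<phi> \<mapsto> \<phi> \<circ> \<partial>\<^sub>i\<close> from \<open>Hom(F\<^bsub>i-1\<^esub>, l\<^sup>p(G))\<close> to \<open>Hom(F\<^sub>i, l\<^sup>p(G))\<close>.\<close>

definition lp_coboundary ::
    "(nat \<Rightarrow> ('g \<Rightarrow>\<^sub>0 int, 'm, 'x) module_scheme) \<Rightarrow> (nat \<Rightarrow> 'm \<Rightarrow> 'm) \<Rightarrow> nat \<Rightarrow>
      ('m \<Rightarrow> 'g \<Rightarrow> complex) \<Rightarrow> ('m \<Rightarrow> 'g \<Rightarrow> complex)"
  where "lp_coboundary F d i \<phi> = compose (carrier (F i)) \<phi> (d i)"

definition lp_cocycles ::
    "('g, 'b) monoid_scheme \<Rightarrow> real \<Rightarrow> (nat \<Rightarrow> ('g \<Rightarrow>\<^sub>0 int, 'm, 'x) module_scheme) \<Rightarrow>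
      (nat \<Rightarrow> 'm \<Rightarrow> 'm) \<Rightarrow> nat \<Rightarrow> ('m \<Rightarrow> 'g \<Rightarrow> complex) set"
  where "lp_cocycles G p F d i =
    kernel (lp_hom G p (F i)) (lp_hom G p (F (Suc i))) (lp_coboundary F d (Suc i))"

definition lp_coboundaries ::
    "('g, 'b) monoid_scheme \<Rightarrow> real \<Rightarrow> (nat \<Rightarrow> ('g \<Rightarrow>\<^sub>0 int, 'm, 'x) module_scheme) \<Rightarrow>
      (nat \<Rightarrow> 'm \<Rightarrow> 'm) \<Rightarrow> nat \<Rightarrow> ('m \<Rightarrow> 'g \<Rightarrow> complex) set"
  where "lp_coboundaries G p F d i =
    (if i = 0 then {\<one>\<^bsub>lp_hom G p (F 0)\<^esub>}
     else lp_coboundary F d i ` carrier (lp_hom G p (F (i - 1))))"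

definition reduced_lp_cohomology ::
    "('g, 'b) monoid_scheme \<Rightarrow> real \<Rightarrow> (nat \<Rightarrow> ('g \<Rightarrow>\<^sub>0 int, 'm, 'x) module_scheme) \<Rightarrow>
      (nat \<Rightarrow> 'm \<Rightarrow> 'm) \<Rightarrow> nat \<Rightarrow> ('m \<Rightarrow> 'g \<Rightarrow> complex) set monoid"
  where "reduced_lp_cohomology G p F d i =
    (lp_hom G p (F i))\<lparr>carrier := lp_cocycles G p F d i\<rparr>
      Mod (lp_hom_topology G p (F i) closure_of lp_coboundaries G p F d i)"


section \<open>Well-definedness\<close>

text \<open>
  The group ring is a ring, \<open>\<int>\<close> and \<open>l\<^sup>p(G)\<close> are left modules over it, the \<open>l\<^sup>p\<close>-norm defines a
  metric, and the open sets of \<open>M \<otimes> l\<^sup>p(G)\<close> form a topology.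
\<close>

lemma frag_extend_add_fun:
  "frag_extend (\<lambda>x. f x + g x) a = frag_extend f a + frag_extend g a"
  by (simp add: frag_extend_def frag_cmul_distrib2 sum.distrib)

lemma ring_group_ring:
  assumes "Group.group G"
  shows "ring (group_ring G)"
proof -
  interpret G: Group.group G by fact
  have closed: "Poly_Mapping.keys (frag_extend (\<lambda>g. frag_extend (\<lambda>h. frag_of (g \<otimes>\<^bsub>G\<^esub> h)) b) a) \<subseteq> carrier G"
    if "Poly_Mapping.keys a \<subseteq> carrier G" "Poly_Mapping.keys b \<subseteq> carrier G" for a b
  proof -
    have "Poly_Mapping.keys (frag_extend (\<lambda>h. frag_of (g \<otimes>\<^bsub>G\<^esub> h)) b) \<subseteq> carrier G" if "g \<in> carrier G" for g
      by (rule order_trans[OF keys_frag_extend]) (use \<open>Poly_Mapping.keys b \<subseteq> carrier G\<close> that in \<open>auto simp: keys_frag_of\<close>)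
    then show ?thesis
      by (intro order_trans[OF keys_frag_extend]) (use \<open>Poly_Mapping.keys a \<subseteq> carrier G\<close> in blast)
  qed
  have assoc: "frag_extend (\<lambda>g. frag_extend (\<lambda>h. frag_of (g \<otimes>\<^bsub>G\<^esub> h)) c) (frag_extend (\<lambda>g. frag_extend (\<lambda>h. frag_of (g \<otimes>\<^bsub>G\<^esub> h)) b) a)
     = frag_extend (\<lambda>g. frag_extend (\<lambda>h. frag_of (g \<otimes>\<^bsub>G\<^esub> h)) (frag_extend (\<lambda>g. frag_extend (\<lambda>h. frag_of (g \<otimes>\<^bsub>G\<^esub> h)) c) b)) a"
    if a: "Poly_Mapping.keys a \<subseteq> carrier G" and b: "Poly_Mapping.keys b \<subseteq> carrier G" and c: "Poly_Mapping.keys c \<subseteq> carrier G" for a b c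
    using a
  proof (induction a rule: frag_induction)
    case (one x)
    show ?case using b
    proof (induction b rule: frag_induction)
      case (one y)
      show ?case using c
        by (induction c rule: frag_induction) (use one \<open>x \<in> carrier G\<close> in \<open>auto simp: frag_extend_diff G.m_assoc\<close>)
    qed (auto simp: frag_extend_diff)
  qed (auto simp: frag_extend_diff)
  show ?thesis
  proof (rule ringI)
    show "abelian_group (group_ring G)"
    proof (rule abelian_groupI)
      fix x assume "x \<in> carrier (group_ring G)"
      then show "\<exists>y\<in>carrier (group_ring G). y \<oplus>\<^bsub>group_ring G\<^esub> x = \<zero>\<^bsub>group_ring G\<^esub>"
        by (intro bexI[of _ "- x"]) (auto simp: group_ring_def)
    qed (auto simp: group_ring_def dest: subsetD[OF keys_add])
    show "Group.monoid (group_ring G)"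
    proof (rule monoidI)
      fix a assume "a \<in> carrier (group_ring G)"
      then have a: "Poly_Mapping.keys a \<subseteq> carrier G" by (simp add: group_ring_def)
      show "\<one>\<^bsub>group_ring G\<^esub> \<otimes>\<^bsub>group_ring G\<^esub> a = a" "a \<otimes>\<^bsub>group_ring G\<^esub> \<one>\<^bsub>group_ring G\<^esub> = a"
        using a by (auto simp: group_ring_def) (induction a rule: frag_induction; auto simp: frag_extend_diff)+
    qed (use closed assoc in \<open>auto simp: group_ring_def\<close>)
  qed (auto simp: group_ring_def frag_extend_add frag_extend_add_fun)
qed

lemma istopology_lp_tensor_open: "istopology (lp_tensor_open G p M)"
proof -
  have "lp_tensor_open G p M (S \<inter> T)"
    if S: "lp_tensor_open G p M S" and T: "lp_tensor_open G p M T" for S T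
    unfolding lp_tensor_open_def
  proof (intro conjI allI impI)
    show "S \<inter> T \<subseteq> carrier (lp_tensor G p M)" using S by (auto simp: lp_tensor_open_def)
    fix m :: nat and x assume x: "x \<in> {..<m} \<rightarrow> carrier M"
    let ?q = "\<lambda>f. \<Otimes>\<^bsub>lp_tensor G p M\<^esub>j\<in>{..<m}. elem_tensor G M (lp_module G p) (x j) (f j)"
    let ?P = "{..<m} \<rightarrow>\<^sub>E carrier (lp_module G p)"
    have "openin (product_topology (\<lambda>_. lp_topology G p) {..<m}) ({f \<in> ?P. ?q f \<in> S} \<inter> {f \<in> ?P. ?q f \<in> T})"
      using S T x unfolding lp_tensor_open_def by blast
    also have "{f \<in> ?P. ?q f \<in> S} \<inter> {f \<in> ?P. ?q f \<in> T} = {f \<in> ?P. ?q f \<in> S \<inter> T}"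
      by blast
    finally show "openin (product_topology (\<lambda>_. lp_topology G p) {..<m}) {f \<in> ?P. ?q f \<in> S \<inter> T}" .
  qed
  moreover have "lp_tensor_open G p M (\<Union>\<U>)" if \<U>: "\<forall>U\<in>\<U>. lp_tensor_open G p M U" for \<U>
    unfolding lp_tensor_open_def
  proof (intro conjI allI impI)
    show "\<Union>\<U> \<subseteq> carrier (lp_tensor G p M)" using \<U> by (auto simp: lp_tensor_open_def)
    fix m :: nat and x assume x: "x \<in> {..<m} \<rightarrow> carrier M"
    let ?q = "\<lambda>f. \<Otimes>\<^bsub>lp_tensor G p M\<^esub>j\<in>{..<m}. elem_tensor G M (lp_module G p) (x j) (f j)"
    let ?P = "{..<m} \<rightarrow>\<^sub>E carrier (lp_module G p)"
    have "openin (product_topology (\<lambda>_. lp_topology G p) {..<m}) (\<Union>U\<in>\<U>. {f \<in> ?P. ?q f \<in> U})"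
      using \<U> x unfolding lp_tensor_open_def by blast
    also have "(\<Union>U\<in>\<U>. {f \<in> ?P. ?q f \<in> U}) = {f \<in> ?P. ?q f \<in> \<Union>\<U>}"
      by blast
    finally show "openin (product_topology (\<lambda>_. lp_topology G p) {..<m}) {f \<in> ?P. ?q f \<in> \<Union>\<U>}" .
  qed
  ultimately show ?thesis unfolding istopology_def by blast
qed

lemma linear_extension_superset:
  assumes "finite S" "Poly_Mapping.keys a \<subseteq> S"
  shows "(\<Sum>g\<in>Poly_Mapping.keys a. (of_int (Poly_Mapping.lookup a g) :: 'a::ring_1) * f g)
       = (\<Sum>g\<in>S. of_int (Poly_Mapping.lookup a g) * f g)"
  using assms by (intro sum.mono_neutral_left) (auto simp: in_keys_iff)

lemma linear_extension_diff:
  "(\<Sum>g\<in>Poly_Mapping.keys (a - b). (of_int (Poly_Mapping.lookup (a-b) g) :: 'a::ring_1) * f g)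
   = (\<Sum>g\<in>Poly_Mapping.keys a. of_int (Poly_Mapping.lookup a g) * f g)
     - (\<Sum>g\<in>Poly_Mapping.keys b. of_int (Poly_Mapping.lookup b g) * f g)"
proof -
  let ?S = "Poly_Mapping.keys a \<union> Poly_Mapping.keys b"
  have 1: "Poly_Mapping.keys (a-b) \<subseteq> ?S"
    by (simp add: keys_diff)
  have 2: "finite ?S" by simp
  have 3: "Poly_Mapping.keys a \<subseteq> ?S" "Poly_Mapping.keys b \<subseteq> ?S" by auto
  show ?thesis unfolding linear_extension_superset[OF 2 1] linear_extension_superset[OF 2 3(1)] linear_extension_superset[OF 2 3(2)]
    by (simp add: lookup_minus left_diff_distrib sum_subtractf)
qed

lemma linear_extension_add:
  "(\<Sum>g\<in>Poly_Mapping.keys (a + b). (of_int (Poly_Mapping.lookup (a+b) g) :: 'a::ring_1) * f g)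
   = (\<Sum>g\<in>Poly_Mapping.keys a. of_int (Poly_Mapping.lookup a g) * f g)
     + (\<Sum>g\<in>Poly_Mapping.keys b. of_int (Poly_Mapping.lookup b g) * f g)"
proof -
  have "(\<Sum>g\<in>Poly_Mapping.keys (- b). (of_int (Poly_Mapping.lookup (-b) g) :: 'a) * f g) =
    - (\<Sum>g\<in>Poly_Mapping.keys b. of_int (Poly_Mapping.lookup b g) * f g)"
    by (simp add: sum_negf)
  with linear_extension_diff[of a "-b" f] show ?thesis by simp
qed

lemma left_module_trivial:
  assumes "Group.group G"
  shows "left_module (group_ring G) trivial_module"
proof -
  interpret G: Group.group G by fact
  note l = linear_extension_diff[where f="\<lambda>_. 1::int", simplified] linear_extension_add[where f="\<lambda>_. 1::int", simplified]
  interpret R: ring "group_ring G" by (rule ring_group_ring) fact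
  interpret M: abelian_group "trivial_module :: ('a \<Rightarrow>\<^sub>0 int, int) module"
    by (rule abelian_groupI) (auto simp: trivial_module_def intro: exI[of _ "- _"])
  show ?thesis
  proof
    fix a b :: "'a \<Rightarrow>\<^sub>0 int" and x :: int
    assume a: "a \<in> carrier (group_ring G)" and b: "b \<in> carrier (group_ring G)"
    have b': "Poly_Mapping.keys b \<subseteq> carrier G" and a': "Poly_Mapping.keys a \<subseteq> carrier G"
      using a b by (auto simp: group_ring_def)
    show "(a \<otimes>\<^bsub>group_ring G\<^esub> b) \<odot>\<^bsub>trivial_module\<^esub> x = a \<odot>\<^bsub>trivial_module\<^esub> (b \<odot>\<^bsub>trivial_module\<^esub> x)"
      using a'
    proof (induction a rule: frag_induction)
      case (one g)
      show ?case using b'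
        by (induction b rule: frag_induction)
          (auto simp: group_ring_def trivial_module_def keys_frag_of frag_extend_diff l algebra_simps)
    qed (auto simp: group_ring_def trivial_module_def frag_extend_diff l algebra_simps)
  qed (auto simp: trivial_module_def group_ring_def algebra_simps keys_frag_of l)
qed

lemma powr_minkowski_aux_zero:
  fixes s t b p :: real
  assumes p: "1 \<le> p" and s: "0 < s" and t: "0 < t" and b: "0 \<le> b"
  shows "b powr p \<le> (s + t) powr p * (t / (s+t) * (b powr p / t powr p))"
proof -
  have "1 \<le> ((s+t)/t) powr (p - 1)"
    using assms by (intro ge_one_powr_ge_zero) (auto simp: field_simps)
  also have "\<dots> = (s+t) powr p * (t / (s+t)) / t powr p"
    using assms by (simp add: powr_divide powr_diff field_simps)
  finally have "1 * b powr p \<le> ((s+t) powr p * (t / (s+t)) / t powr p) * b powr p"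
    by (intro mult_right_mono) auto
  then show ?thesis by simp
qed

lemma powr_minkowski_aux:
  fixes s t a b p :: real
  assumes p: "1 \<le> p" and s: "0 < s" and t: "0 < t" and a: "0 \<le> a" and b: "0 \<le> b"
  shows "(a + b) powr p \<le> (s + t) powr p * (s / (s+t) * (a powr p / s powr p) + t / (s+t) * (b powr p / t powr p))"
proof -
  consider "a = 0" | "b = 0" | "a > 0" "b > 0" using a b by linarith
  then show ?thesis
  proof cases
    case 1 then show ?thesis using powr_minkowski_aux_zero[OF p s t b] p by simp
  next
    case 2 then show ?thesis using powr_minkowski_aux_zero[OF p t s a] p by (simp add: add.commute)
  next
    case 3
    have "(s/(s+t)) + (t/(s+t)) = 1" using s t by (simp add: add_divide_distrib[symmetric])
    then have eq: "1 - t/(s+t) = s/(s+t)" by linarith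
    have "((1 - t/(s+t)) *\<^sub>R (a/s) + (t/(s+t)) *\<^sub>R (b/t)) powr p
        \<le> (1 - t/(s+t)) * (a/s) powr p + (t/(s+t)) * (b/t) powr p"
      using s t 3 by (intro convex_onD[OF powr_convex[OF p]]) auto
    then have "((a+b)/(s+t)) powr p \<le> s/(s+t) * (a/s) powr p + (t/(s+t)) * (b/t) powr p"
      unfolding eq using s t by (simp add: add_divide_distrib)
    then have "(s+t) powr p * ((a+b)/(s+t)) powr p \<le> (s+t) powr p * (s/(s+t) * (a/s) powr p + (t/(s+t)) * (b/t) powr p)"
      by (intro mult_left_mono) auto
    moreover have "(s+t) powr p * ((a+b)/(s+t)) powr p = (a+b) powr p"
      using s t 3 by (simp add: powr_divide)
    ultimately show ?thesis using s t 3 by (simp add: powr_divide)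
  qed
qed

lemma summable_add_powr:
  fixes f g :: "'a \<Rightarrow> complex"
  assumes p: "1 \<le> p" and f: "(\<lambda>x. cmod (f x) powr p) summable_on A" and g: "(\<lambda>x. cmod (g x) powr p) summable_on A"
  shows "(\<lambda>x. cmod (f x + g x) powr p) summable_on A"
proof (rule summable_on_comparison_test)
  show "(\<lambda>x. 2 powr p * (1 / 2 * cmod (f x) powr p + 1 / 2 * cmod (g x) powr p)) summable_on A"
    by (intro summable_on_cmult_right summable_on_add f g)
  fix x assume "x \<in> A"
  have "cmod (f x + g x) powr p \<le> (cmod (f x) + cmod (g x)) powr p"
    using p by (intro powr_mono2) (auto intro: norm_triangle_ineq)
  also have "\<dots> \<le> 2 powr p * (1 / 2 * cmod (f x) powr p + 1 / 2 * cmod (g x) powr p)"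
    using powr_minkowski_aux[OF p, of 1 1 "cmod (f x)" "cmod (g x)"] by simp
  finally show "cmod (f x + g x) powr p \<le> 2 powr p * (1 / 2 * cmod (f x) powr p + 1 / 2 * cmod (g x) powr p)" .
qed auto

lemma lp_norm_nonneg: "0 \<le> lp_norm G p f" by (simp add: lp_norm_def)

lemma lp_norm_powr: assumes "1 \<le> p" shows "lp_norm G p f powr p = (\<Sum>\<^sub>\<infinity>x\<in>carrier G. cmod (f x) powr p)"
  using assms by (simp add: lp_norm_def powr_powr infsum_nonneg)

lemma lp_norm_eq_0:
  assumes p: "1 \<le> p" and f: "f \<in> carrier (lp_module G p)"
  shows "lp_norm G p f = 0 \<longleftrightarrow> f = (\<lambda>x. 0)"
proof
  assume "lp_norm G p f = 0"
  then have 0: "(\<Sum>\<^sub>\<infinity>x\<in>carrier G. cmod (f x) powr p) = 0" by (simp add: lp_norm_def)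
  have "f x = 0" for x
  proof (cases "x \<in> carrier G")
    case True
    have "cmod (f x) powr p = 0"
      by (rule nonneg_infsum_le_0D[where A="carrier G" and f="\<lambda>x. cmod (f x) powr p"])
       (use 0 f True in \<open>auto simp: lp_module_def\<close>)
    then show ?thesis by simp
  qed (use f in \<open>auto simp: lp_module_def\<close>)
  then show "f = (\<lambda>x. 0)" by blast
qed (use p in \<open>simp add: lp_norm_def\<close>)

lemma lp_norm_triangle:
  assumes p: "1 \<le> p" and f: "f \<in> carrier (lp_module G p)" and g: "g \<in> carrier (lp_module G p)"
  shows "lp_norm G p (\<lambda>x. f x + g x) \<le> lp_norm G p f + lp_norm G p g"
proof -
  let ?s = "lp_norm G p f" and ?t = "lp_norm G p g"
  consider "?s = 0" | "?t = 0" | "?s > 0" "?t > 0"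
    using lp_norm_nonneg[of G p f] lp_norm_nonneg[of G p g] by linarith
  then show ?thesis
  proof cases
    case 1 then show ?thesis using lp_norm_eq_0[OF p f] by simp
  next
    case 2 then show ?thesis using lp_norm_eq_0[OF p g] by simp
  next
    case 3
    let ?A = "carrier G"
    have sf: "(\<lambda>x. cmod (f x) powr p) summable_on ?A" and sg: "(\<lambda>x. cmod (g x) powr p) summable_on ?A"
      using f g by (auto simp: lp_module_def)
    let ?h = "\<lambda>x. (?s + ?t) powr p * (?s/(?s+?t) / ?s powr p * cmod (f x) powr p + ?t/(?s+?t)/ ?t powr p * cmod (g x) powr p)"
    have "(\<Sum>\<^sub>\<infinity>x\<in>?A. cmod (f x + g x) powr p) \<le> (\<Sum>\<^sub>\<infinity>x\<in>?A. ?h x)"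
    proof (rule infsum_mono)
      show "?h summable_on ?A" by (intro summable_on_cmult_right summable_on_add sf sg)
      show "(\<lambda>x. cmod (f x + g x) powr p) summable_on ?A" by (rule summable_add_powr[OF p sf sg])
      fix x
      have "cmod (f x + g x) powr p \<le> (cmod (f x) + cmod (g x)) powr p"
        using p by (intro powr_mono2) (auto intro: norm_triangle_ineq)
      also have "\<dots> \<le> ?h x"
        using powr_minkowski_aux[OF p 3, of "cmod (f x)" "cmod (g x)"] by simp
      finally show "cmod (f x + g x) powr p \<le> ?h x" .
    qed
    also have "\<dots> = (?s+?t) powr p * (?s/(?s+?t) / ?s powr p * ?s powr p + ?t/(?s+?t)/ ?t powr p * ?t powr p)"
      by (subst infsum_cmult_right', subst infsum_add[OF summable_on_cmult_right[OF sf] summable_on_cmult_right[OF sg]])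
        (simp only: infsum_cmult_right' lp_norm_powr[OF p])
    also have "\<dots> = (?s+?t) powr p * (?s/(?s+?t) + ?t/(?s+?t))" using 3 by simp
    also have "?s/(?s+?t) + ?t/(?s+?t) = 1" using 3 by (simp add: add_divide_distrib[symmetric])
    finally have *: "lp_norm G p (\<lambda>x. f x + g x) powr p \<le> (?s+?t) powr p"
      unfolding lp_norm_powr[OF p] by simp
    show ?thesis
    proof (rule ccontr)
      assume "\<not> ?thesis"
      then have "(?s+?t) powr p < lp_norm G p (\<lambda>x. f x + g x) powr p"
        using 3 p by (intro powr_less_mono2) auto
      with * show False by simp
    qed
  qed
qed

lemma lp_scale:
  assumes "f \<in> carrier (lp_module G p)"
  shows "(\<lambda>x. c * f x) \<in> carrier (lp_module G p)"
  using assms by (auto simp: lp_module_def norm_mult powr_mult intro!: summable_on_cmult_right)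

lemma lp_add:
  assumes "1 \<le> p" "f \<in> carrier (lp_module G p)" "g \<in> carrier (lp_module G p)"
  shows "(\<lambda>x. f x + g x) \<in> carrier (lp_module G p)"
  using assms by (auto simp: lp_module_def intro!: summable_add_powr)

lemma Metric_space_lp:
  assumes p: "1 \<le> p"
  shows "Metric_space (carrier (lp_module G p)) (\<lambda>f g. lp_norm G p (\<lambda>x. f x - g x))"
proof
  fix f g h
  show "0 \<le> lp_norm G p (\<lambda>x. f x - g x)" by (rule lp_norm_nonneg)
  show "lp_norm G p (\<lambda>x. f x - g x) = lp_norm G p (\<lambda>x. g x - f x)"
    by (simp add: lp_norm_def norm_minus_commute)
  assume f: "f \<in> carrier (lp_module G p)" and g: "g \<in> carrier (lp_module G p)"
  have fg: "(\<lambda>x. f x - g x) \<in> carrier (lp_module G p)"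
    if "f \<in> carrier (lp_module G p)" "g \<in> carrier (lp_module G p)" for f g
    using lp_add[OF p that(1) lp_scale[OF that(2), of "-1"]] by simp
  show "lp_norm G p (\<lambda>x. f x - g x) = 0 \<longleftrightarrow> f = g"
    using lp_norm_eq_0[OF p fg[OF f g]] by (auto simp: fun_eq_iff)
  assume h: "h \<in> carrier (lp_module G p)"
  show "lp_norm G p (\<lambda>x. f x - h x) \<le> lp_norm G p (\<lambda>x. f x - g x) + lp_norm G p (\<lambda>x. g x - h x)"
    using lp_norm_triangle[OF p fg[OF f g] fg[OF g h]] by simp
qed

lemma lp_translate:
  assumes "Group.group G" "g \<in> carrier G" "f \<in> carrier (lp_module G p)"
  shows "(\<lambda>x. if x \<in> carrier G then f (inv\<^bsub>G\<^esub> g \<otimes>\<^bsub>G\<^esub> x) else 0) \<in> carrier (lp_module G p)"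
proof -
  interpret G: Group.group G by fact
  have bij: "bij_betw (\<lambda>x. inv\<^bsub>G\<^esub> g \<otimes>\<^bsub>G\<^esub> x) (carrier G) (carrier G)"
    using assms(2) by (intro bij_betwI[where g="\<lambda>x. g \<otimes>\<^bsub>G\<^esub> x"]) (auto simp: G.m_assoc[symmetric])
  have "(\<lambda>x. cmod (f (inv\<^bsub>G\<^esub> g \<otimes>\<^bsub>G\<^esub> x)) powr p) summable_on carrier G"
    using summable_on_reindex_bij_betw[OF bij, of "\<lambda>x. cmod (f x) powr p"] assms(3) by (simp add: lp_module_def)
  then show ?thesis by (simp add: lp_module_def cong: summable_on_cong)
qed

lemma lp_smult_closed:
  assumes G: "Group.group G" and p: "1 \<le> p" and a: "Poly_Mapping.keys a \<subseteq> carrier G" and f: "f \<in> carrier (lp_module G p)"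
  shows "a \<odot>\<^bsub>lp_module G p\<^esub> f \<in> carrier (lp_module G p)"
proof -
  have "(\<lambda>x. if x \<in> carrier G then \<Sum>g\<in>S. c g * f (inv\<^bsub>G\<^esub> g \<otimes>\<^bsub>G\<^esub> x) else 0) \<in> carrier (lp_module G p)"
    if "finite S" "S \<subseteq> carrier G" for S and c :: "'a \<Rightarrow> complex"
    using that
  proof (induction S rule: finite_induct)
    case empty
    have "(\<lambda>x. 0) \<in> carrier (lp_module G p)" by (simp add: lp_module_def)
    then show ?case by (simp cong: if_cong)
  next
    case (insert g S)
    have 1: "(\<lambda>x. c g * (if x \<in> carrier G then f (inv\<^bsub>G\<^esub> g \<otimes>\<^bsub>G\<^esub> x) else 0)) \<in> carrier (lp_module G p)"
      using insert.prems by (intro lp_scale lp_translate[OF G _ f]) auto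
    have 2: "(\<lambda>x. if x \<in> carrier G then \<Sum>g\<in>S. c g * f (inv\<^bsub>G\<^esub> g \<otimes>\<^bsub>G\<^esub> x) else 0) \<in> carrier (lp_module G p)"
      using insert by auto
    show ?case
      using lp_add[OF p 1 2] insert.hyps
      by (elim back_subst[of "\<lambda>h. h \<in> carrier (lp_module G p)"]) (auto simp: fun_eq_iff)
  qed
  from this[of "Poly_Mapping.keys a" "\<lambda>g. of_int (Poly_Mapping.lookup a g)"] a
  show ?thesis by (simp add: lp_module_def)
qed

lemma left_module_lp:
  assumes G: "Group.group G" and p: "1 \<le> p"
  shows "left_module (group_ring G) (lp_module G p)"
proof -
  interpret G: Group.group G by fact
  interpret R: ring "group_ring G" by (rule ring_group_ring) fact
  have [simp]: "x \<oplus>\<^bsub>lp_module G p\<^esub> y = (\<lambda>i. x i + y i)" for x y by (simp add: lp_module_def)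
  have [simp]: "\<zero>\<^bsub>lp_module G p\<^esub> = (\<lambda>i. 0)" by (simp add: lp_module_def)
  interpret M: abelian_group "lp_module G p"
  proof (rule abelian_groupI)
    fix x assume "x \<in> carrier (lp_module G p)"
    then show "\<exists>y\<in>carrier (lp_module G p). y \<oplus>\<^bsub>lp_module G p\<^esub> x = \<zero>\<^bsub>lp_module G p\<^esub>"
      using lp_scale[of x G p "-1"] by (intro bexI[of _ "\<lambda>i. - x i"]) auto
  next
    show "\<zero>\<^bsub>lp_module G p\<^esub> \<in> carrier (lp_module G p)" by (simp add: lp_module_def)
  qed (auto intro: lp_add[OF p] simp: add_ac)
  show ?thesis
  proof
    fix a x assume "a \<in> carrier (group_ring G)" "x \<in> carrier (lp_module G p)"
    then show "a \<odot>\<^bsub>lp_module G p\<^esub> x \<in> carrier (lp_module G p)"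
      by (intro lp_smult_closed[OF G p]) (auto simp: group_ring_def)
  next
    fix a b x assume "a \<in> carrier (group_ring G)" "b \<in> carrier (group_ring G)" "x \<in> carrier (lp_module G p)"
    then have a: "Poly_Mapping.keys a \<subseteq> carrier G" and b: "Poly_Mapping.keys b \<subseteq> carrier G"
      by (auto simp: group_ring_def)
    show "(a \<oplus>\<^bsub>group_ring G\<^esub> b) \<odot>\<^bsub>lp_module G p\<^esub> x = a \<odot>\<^bsub>lp_module G p\<^esub> x \<oplus>\<^bsub>lp_module G p\<^esub> b \<odot>\<^bsub>lp_module G p\<^esub> x"
      by (auto simp: lp_module_def group_ring_def linear_extension_add)
    have diff: "(a - b) \<odot>\<^bsub>lp_module G p\<^esub> x = (\<lambda>i. (a \<odot>\<^bsub>lp_module G p\<^esub> x) i - (b \<odot>\<^bsub>lp_module G p\<^esub> x) i)" for a b x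
      by (auto simp: lp_module_def linear_extension_diff)
    have diff2: "a \<odot>\<^bsub>lp_module G p\<^esub> (\<lambda>i. x i - y i) = (\<lambda>i. (a \<odot>\<^bsub>lp_module G p\<^esub> x) i - (a \<odot>\<^bsub>lp_module G p\<^esub> y) i)" for a x y
      by (auto simp: lp_module_def right_diff_distrib sum_subtractf)
    have z: "0 \<odot>\<^bsub>lp_module G p\<^esub> x = (\<lambda>i. 0)" "a \<odot>\<^bsub>lp_module G p\<^esub> (\<lambda>i. 0) = (\<lambda>i. 0)" for x a
      by (auto simp: lp_module_def)
    have m: "(a - b) \<otimes>\<^bsub>group_ring G\<^esub> c = (a \<otimes>\<^bsub>group_ring G\<^esub> c) - (b \<otimes>\<^bsub>group_ring G\<^esub> c)" 
       "0 \<otimes>\<^bsub>group_ring G\<^esub> c = 0" "frag_of g \<otimes>\<^bsub>group_ring G\<^esub> (b - c) = (frag_of g \<otimes>\<^bsub>group_ring G\<^esub> b) - (frag_of g \<otimes>\<^bsub>group_ring G\<^esub> c)"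
       "frag_of g \<otimes>\<^bsub>group_ring G\<^esub> 0 = 0" for a b c g
      by (auto simp: group_ring_def frag_extend_diff)
    show "(a \<otimes>\<^bsub>group_ring G\<^esub> b) \<odot>\<^bsub>lp_module G p\<^esub> x = a \<odot>\<^bsub>lp_module G p\<^esub> (b \<odot>\<^bsub>lp_module G p\<^esub> x)"
      using a
    proof (induction a rule: frag_induction)
      case (one g)
      show ?case using b
      proof (induction b rule: frag_induction)
        case (one h)
        show ?case using one \<open>g \<in> carrier G\<close>
          by (auto simp: lp_module_def group_ring_def keys_frag_of G.inv_mult_group G.m_assoc)
      qed (simp_all add: m z diff diff2)
    qed (simp_all add: m z diff diff2)
  next
    fix a x y
    show "a \<odot>\<^bsub>lp_module G p\<^esub> (x \<oplus>\<^bsub>lp_module G p\<^esub> y) = a \<odot>\<^bsub>lp_module G p\<^esub> x \<oplus>\<^bsub>lp_module G p\<^esub> a \<odot>\<^bsub>lp_module G p\<^esub> y"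
      by (auto simp: lp_module_def algebra_simps sum.distrib)
  next
    fix x assume "x \<in> carrier (lp_module G p)"
    then show "\<one>\<^bsub>group_ring G\<^esub> \<odot>\<^bsub>lp_module G p\<^esub> x = x"
      by (auto simp: lp_module_def group_ring_def keys_frag_of)
  qed
qed

end

theory Submission
  imports Defs
begin

text \<open>
  For a finite conjugacy class \<open>C\<close> the class sum \<open>z\<^sub>C\<close> is central in \<open>\<int>[G]\<close> and \<open>z\<^sub>C - |C|\<close> has
  augmentation 0, so \<open>z\<^sub>C - |C|\<close> acts null-homotopically on any projective resolution. Hence a
  (co)cycle differs from its image under \<open>z\<^sub>C / |C|\<close> by a (co)boundary. For pairwise distinct finite
  classes \<open>C\<^sub>0, C\<^sub>1, \<dots>\<close> with class sums \<open>z\<^sub>0, z\<^sub>1, \<dots>\<close> the averages \<open>1/N \<Sum>\<^bsub>k<N\<^esub> z\<^sub>k / |C\<^sub>k|\<close>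
  are contractions of \<open>l\<^sup>p(G)\<close> that send a point mass to a function with values at most \<open>1/N\<close> and
  \<open>l\<^sup>1\<close>-norm 1, so of \<open>l\<^sup>p\<close>-norm at most \<open>N\<^bsup>(1-p)/p\<^esup>\<close>. Since \<open>p > 1\<close>, they tend to 0 strongly,
  and every (co)cycle is a limit of (co)boundaries. Conversely the (co)cycles are closed, being cut
  out by continuous functionals; for homology these functionals come from a dual basis of the
  projective module.
\<close>

section \<open>Null-homotopies on projective resolutions\<close>

text \<open>The integral elements z_C - |C| are used because the resolution lives over Z[G]:
  null-homotopies are available for central elements of that ring, and the denominators go onto the
  complex coefficients afterwards. Homotopies of different classes are chosen independently and no
  estimate of them enters: for a (co)cycle, the difference from its N-th average is a finite
  combination of defect terms and so an exact (co)boundary, and only the average has to be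
  estimated. Distinct classes are disjoint, which keeps the coefficients of the average below 1/N.
  In homology the obstacle is that the tensor product is a bare quotient of a free abelian group,
  without norm or complex scalars, with a topology given by test families. Membership in the
  subgroup of relations is therefore detected by the functionals x \<otimes> f -> (\<xi>(x)^* f)(g).
  For projective modules they separate points, and they are continuous and complex linear in f. This
  yields closedness of the cycles and also their stability under complex rescaling of coefficients.
  The convention x a = a^* x replaces a class by its inverses there.\<close>

lemma mod_hom_closed: "h \<in> mod_hom R M N \<Longrightarrow> x \<in> carrier M \<Longrightarrow> h x \<in> carrier N"
  and mod_hom_add: "h \<in> mod_hom R M N \<Longrightarrow> x \<in> carrier M \<Longrightarrow> y \<in> carrier M \<Longrightarrow>
    h (x \<oplus>\<^bsub>M\<^esub> y) = h x \<oplus>\<^bsub>N\<^esub> h y"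
  and mod_hom_smult: "h \<in> mod_hom R M N \<Longrightarrow> r \<in> carrier R \<Longrightarrow> x \<in> carrier M \<Longrightarrow>
    h (r \<odot>\<^bsub>M\<^esub> x) = r \<odot>\<^bsub>N\<^esub> h x"
  by (auto simp: mod_hom_def)

lemma mod_homI:
  assumes "\<And>x. x \<in> carrier M \<Longrightarrow> h x \<in> carrier N"
    and "\<And>x y. x \<in> carrier M \<Longrightarrow> y \<in> carrier M \<Longrightarrow> h (x \<oplus>\<^bsub>M\<^esub> y) = h x \<oplus>\<^bsub>N\<^esub> h y"
    and "\<And>r x. r \<in> carrier R \<Longrightarrow> x \<in> carrier M \<Longrightarrow> h (r \<odot>\<^bsub>M\<^esub> x) = r \<odot>\<^bsub>N\<^esub> h x"
  shows "h \<in> mod_hom R M N"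
  using assms by (auto simp: mod_hom_def)

lemma mod_hom_compose:
  assumes "h \<in> mod_hom R M N" "k \<in> mod_hom R N K"
  shows "(\<lambda>x. k (h x)) \<in> mod_hom R M K"
  using assms by (intro mod_homI) (simp_all add: mod_hom_closed mod_hom_add mod_hom_smult)

lemma mod_hom_zero:
  assumes "abelian_group M" "abelian_group N" "h \<in> mod_hom R M N"
  shows "h \<zero>\<^bsub>M\<^esub> = \<zero>\<^bsub>N\<^esub>"
proof -
  interpret M: abelian_group M by fact
  interpret N: abelian_group N by fact
  have "h \<zero>\<^bsub>M\<^esub> \<oplus>\<^bsub>N\<^esub> h \<zero>\<^bsub>M\<^esub> = h \<zero>\<^bsub>M\<^esub> \<oplus>\<^bsub>N\<^esub> \<zero>\<^bsub>N\<^esub>"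
    using mod_hom_add[OF assms(3), of "\<zero>\<^bsub>M\<^esub>" "\<zero>\<^bsub>M\<^esub>"] mod_hom_closed[OF assms(3), of "\<zero>\<^bsub>M\<^esub>"] by simp
  then show ?thesis
    using mod_hom_closed[OF assms(3), of "\<zero>\<^bsub>M\<^esub>"] by (simp del: N.r_zero)
qed

lemma mod_hom_minus:
  assumes "abelian_group M" "abelian_group N" "h \<in> mod_hom R M N" "x \<in> carrier M" "y \<in> carrier M"
  shows "h (x \<ominus>\<^bsub>M\<^esub> y) = h x \<ominus>\<^bsub>N\<^esub> h y"
proof -
  interpret M: abelian_group M by fact
  interpret N: abelian_group N by fact
  have "h (x \<ominus>\<^bsub>M\<^esub> y) \<oplus>\<^bsub>N\<^esub> h y = h x"
    using mod_hom_add[OF assms(3), of "x \<ominus>\<^bsub>M\<^esub> y" y] assms(4,5)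
    by (simp add: M.minus_eq M.a_assoc M.l_neg)
  then show ?thesis
    using mod_hom_closed[OF assms(3)] assms(4,5)
    by (metis M.minus_closed N.minus_eq N.add.inv_solve_right)
qed

lemma mod_hom_finsum:
  assumes "abelian_group M" "abelian_group N" "h \<in> mod_hom R M N"
    and "finite Y" "f \<in> Y \<rightarrow> carrier M"
  shows "h (\<Oplus>\<^bsub>M\<^esub>y\<in>Y. f y) = (\<Oplus>\<^bsub>N\<^esub>y\<in>Y. h (f y))"
proof -
  interpret M: abelian_group M by fact
  interpret N: abelian_group N by fact
  show ?thesis
    using assms(4,5)
  proof (induction Y rule: finite_induct)
    case (insert y Y)
    then show ?case
      using mod_hom_closed[OF assms(3)] by (simp add: mod_hom_add[OF assms(3)] Pi_iff M.finsum_closed)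
  qed (simp add: mod_hom_zero[OF assms(1-3)])
qed

context left_module
begin

text \<open>Over a noncommutative ring it is centrality that makes multiplication by
  \<open>r\<close> linear; this turns central elements into chain endomorphisms.\<close>

lemma smult_mod_hom:
  assumes "r \<in> carrier R" "\<And>a. a \<in> carrier R \<Longrightarrow> r \<otimes> a = a \<otimes> r"
  shows "(\<lambda>x. r \<odot>\<^bsub>M\<^esub> x) \<in> mod_hom R M M"
proof (intro mod_homI)
  fix a x assume "a \<in> carrier R" "x \<in> carrier M"
  with assms show "r \<odot>\<^bsub>M\<^esub> (a \<odot>\<^bsub>M\<^esub> x) = a \<odot>\<^bsub>M\<^esub> (r \<odot>\<^bsub>M\<^esub> x)"
    by (metis smult_assoc1)
qed (use assms in \<open>auto simp: smult_r_distr\<close>)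

lemma smult_zero_left: "x \<in> carrier M \<Longrightarrow> \<zero> \<odot>\<^bsub>M\<^esub> x = \<zero>\<^bsub>M\<^esub>"
  using smult_l_distr[of \<zero> \<zero> x] by (simp add: M.add.l_cancel_one')

lemma smult_zero_right: "a \<in> carrier R \<Longrightarrow> a \<odot>\<^bsub>M\<^esub> \<zero>\<^bsub>M\<^esub> = \<zero>\<^bsub>M\<^esub>"
  using smult_r_distr[of a "\<zero>\<^bsub>M\<^esub>" "\<zero>\<^bsub>M\<^esub>"] by (simp add: M.add.l_cancel_one')

lemma smult_a_inv:
  assumes "a \<in> carrier R" "x \<in> carrier M"
  shows "a \<odot>\<^bsub>M\<^esub> (\<ominus>\<^bsub>M\<^esub> x) = \<ominus>\<^bsub>M\<^esub> (a \<odot>\<^bsub>M\<^esub> x)"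
proof (rule M.minus_equality[symmetric])
  show "a \<odot>\<^bsub>M\<^esub> (\<ominus>\<^bsub>M\<^esub> x) \<oplus>\<^bsub>M\<^esub> a \<odot>\<^bsub>M\<^esub> x = \<zero>\<^bsub>M\<^esub>"
    using assms by (simp add: smult_r_distr[symmetric] M.l_neg smult_zero_right)
qed (use assms in auto)

lemma smult_finsum:
  assumes "a \<in> carrier R" "finite Y" "f \<in> Y \<rightarrow> carrier M"
  shows "a \<odot>\<^bsub>M\<^esub> (\<Oplus>\<^bsub>M\<^esub>y\<in>Y. f y) = (\<Oplus>\<^bsub>M\<^esub>y\<in>Y. a \<odot>\<^bsub>M\<^esub> f y)"
  using assms(2,3)
proof (induction Y rule: finite_induct)
  case (insert y Y)
  then show ?case
    using assms(1) by (simp add: smult_r_distr Pi_iff M.finsum_closed)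
qed (simp add: smult_zero_right assms(1))

end

section \<open>Dual bases and lifting for projective modules\<close>

definition regular_module :: "('r, 's) ring_scheme \<Rightarrow> ('r, 'r) module"
  where "regular_module R =
    \<lparr>carrier = carrier R, monoid.mult = undefined, one = undefined,
     ring.zero = \<zero>\<^bsub>R\<^esub>, ring.add = (\<oplus>\<^bsub>R\<^esub>), module.smult = (\<otimes>\<^bsub>R\<^esub>)\<rparr>"

lemma regular_module_simps [simp]:
  "carrier (regular_module R) = carrier R" "\<zero>\<^bsub>regular_module R\<^esub> = \<zero>\<^bsub>R\<^esub>"
  "x \<oplus>\<^bsub>regular_module R\<^esub> y = x \<oplus>\<^bsub>R\<^esub> y" "x \<odot>\<^bsub>regular_module R\<^esub> y = x \<otimes>\<^bsub>R\<^esub> y"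
  by (simp_all add: regular_module_def)

text \<open>The functionals are the coordinates of \<open>\<iota>\<close>, the vectors are the
  images under \<open>\<pi>\<close> of the standard basis. The expansion is allowed over any finite
  \<open>Y\<close> containing the support, so that several elements can share one index set.\<close>

lemma projective_dual_basis:
  fixes P :: "('r, 'm, 'x) module_scheme"
  assumes "ring R" "projective_module R P"
  obtains X :: "'m set" and \<xi> :: "'m \<Rightarrow> 'm \<Rightarrow> 'r" and e :: "'m \<Rightarrow> 'm"
  where "\<And>x. x \<in> X \<Longrightarrow> \<xi> x \<in> mod_hom R P (regular_module R)"
    and "\<And>x. x \<in> X \<Longrightarrow> e x \<in> carrier P"
    and "\<And>y. y \<in> carrier P \<Longrightarrow> finite {x \<in> X. \<xi> x y \<noteq> \<zero>\<^bsub>R\<^esub>}"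
    and "\<And>y Y. y \<in> carrier P \<Longrightarrow> finite Y \<Longrightarrow> Y \<subseteq> X \<Longrightarrow> {x \<in> X. \<xi> x y \<noteq> \<zero>\<^bsub>R\<^esub>} \<subseteq> Y \<Longrightarrow>
           (\<Oplus>\<^bsub>P\<^esub>x\<in>Y. \<xi> x y \<odot>\<^bsub>P\<^esub> e x) = y"
proof -
  interpret R: ring R by fact
  from assms(2) interpret P: left_module R P by (simp add: projective_module_def)
  from assms(2) obtain X :: "'m set" and \<iota> \<pi> where \<iota>: "\<iota> \<in> mod_hom R P (free_module R X)"
    and \<pi>: "\<pi> \<in> mod_hom R (free_module R X) P" and id: "\<And>x. x \<in> carrier P \<Longrightarrow> \<pi> (\<iota> x) = x"
    by (auto simp: projective_module_def)
  let ?F = "free_module R X"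
  define \<delta> where "\<delta> x = (\<lambda>z\<in>X. if z = x then \<one>\<^bsub>R\<^esub> else \<zero>\<^bsub>R\<^esub>)" for x
  have \<delta>: "\<delta> x \<in> carrier ?F" for x
    by (auto simp: free_module_def \<delta>_def intro: finite_subset[of _ "{x}"] split: if_splits)
  have zero: "\<pi> \<zero>\<^bsub>?F\<^esub> = \<zero>\<^bsub>P\<^esub>"
  proof -
    have z: "\<zero>\<^bsub>?F\<^esub> \<in> carrier ?F" "\<zero>\<^bsub>?F\<^esub> \<oplus>\<^bsub>?F\<^esub> \<zero>\<^bsub>?F\<^esub> = \<zero>\<^bsub>?F\<^esub>"
      by (auto simp: free_module_def fun_eq_iff)
    from mod_hom_add[OF \<pi> z(1) z(1)] mod_hom_closed[OF \<pi> z(1)] show ?thesis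
      by (simp add: z(2) P.add.r_cancel_one')
  qed
  \<comment> \<open>Finite sums are formed in \<open>P\<close> instead of the free module: splitting
    off one coordinate writes \<open>a\<close> as \<open>b\<close> plus a multiple of
    \<open>\<delta> y\<close>, and additivity and linearity of \<open>\<pi>\<close> do the
    rest.\<close>
  have expand: "(\<Oplus>\<^bsub>P\<^esub>x\<in>Y. a x \<odot>\<^bsub>P\<^esub> \<pi> (\<delta> x)) = \<pi> a"
    if "finite Y" "Y \<subseteq> X" "a \<in> carrier ?F" "{x \<in> X. a x \<noteq> \<zero>\<^bsub>R\<^esub>} \<subseteq> Y" for Y a
    using that
  proof (induction Y arbitrary: a rule: finite_induct)
    case empty
    then have "a = \<zero>\<^bsub>?F\<^esub>"
      by (intro extensionalityI[of a X]) (auto simp: free_module_def PiE_def)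
    then show ?case by (simp add: zero)
  next
    case (insert y Y)
    define b where "b = (\<lambda>x\<in>X. if x = y then \<zero>\<^bsub>R\<^esub> else a x)"
    have y: "y \<in> X" and aX: "\<And>x. x \<in> X \<Longrightarrow> a x \<in> carrier R" and ay: "a y \<in> carrier R"
      using insert.prems by (auto simp: free_module_def)
    have b: "b \<in> carrier ?F"
      using insert.prems(2) aX
      by (auto simp: b_def free_module_def elim: rev_finite_subset)
    have dec: "a = b \<oplus>\<^bsub>?F\<^esub> (a y \<odot>\<^bsub>?F\<^esub> \<delta> y)"
    proof
      fix x show "a x = (b \<oplus>\<^bsub>?F\<^esub> (a y \<odot>\<^bsub>?F\<^esub> \<delta> y)) x"
        using aX[of x] ay insert.prems(2) y by (cases "x \<in> X") (auto simp: b_def free_module_def \<delta>_def)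
    qed
    have ad: "a y \<odot>\<^bsub>?F\<^esub> \<delta> y \<in> carrier ?F"
      using ay by (auto simp: free_module_def \<delta>_def intro: finite_subset[of _ "{y}"] split: if_splits)
    have "\<pi> a = \<pi> b \<oplus>\<^bsub>P\<^esub> a y \<odot>\<^bsub>P\<^esub> \<pi> (\<delta> y)"
      by (subst dec, subst mod_hom_add[OF \<pi> b ad], subst mod_hom_smult[OF \<pi> ay \<delta>]) simp
    also have "\<pi> b = (\<Oplus>\<^bsub>P\<^esub>x\<in>Y. b x \<odot>\<^bsub>P\<^esub> \<pi> (\<delta> x))"
    proof (intro insert.IH[symmetric])
      show "b \<in> carrier ?F" by (fact b)
    qed (use insert.prems(1,3) in \<open>auto simp: b_def split: if_splits\<close>)
    also have "\<dots> = (\<Oplus>\<^bsub>P\<^esub>x\<in>Y. a x \<odot>\<^bsub>P\<^esub> \<pi> (\<delta> x))"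
      using insert.prems insert.hyps aX mod_hom_closed[OF \<pi> \<delta>]
      by (intro P.finsum_cong') (auto simp: b_def subset_iff)
    finally show ?case
      using insert.prems insert.hyps aX mod_hom_closed[OF \<pi> \<delta>]
      by (subst P.finsum_insert) (auto simp: subset_iff P.a_comm)
  qed
  show ?thesis
  proof (rule that[of X "\<lambda>x y. \<iota> y x" "\<lambda>x. \<pi> (\<delta> x)"])
    fix x assume x: "x \<in> X"
    show "(\<lambda>y. \<iota> y x) \<in> mod_hom R P (regular_module R)"
    proof (rule mod_homI)
      fix y assume "y \<in> carrier P"
      then show "\<iota> y x \<in> carrier (regular_module R)"
        using mod_hom_closed[OF \<iota>] x by (fastforce simp: free_module_def)
    qed (use x in \<open>simp_all add: mod_hom_add[OF \<iota>] mod_hom_smult[OF \<iota>], simp_all add: free_module_def\<close>)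
    show "\<pi> (\<delta> x) \<in> carrier P" using mod_hom_closed[OF \<pi> \<delta>] .
  next
    fix y assume y: "y \<in> carrier P"
    show "finite {x \<in> X. \<iota> y x \<noteq> \<zero>\<^bsub>R\<^esub>}"
      using mod_hom_closed[OF \<iota> y] by (simp add: free_module_def)
    fix Y assume "finite Y" "Y \<subseteq> X" "{x \<in> X. \<iota> y x \<noteq> \<zero>\<^bsub>R\<^esub>} \<subseteq> Y"
    then show "(\<Oplus>\<^bsub>P\<^esub>x\<in>Y. \<iota> y x \<odot>\<^bsub>P\<^esub> \<pi> (\<delta> x)) = y"
      using expand[OF _ _ mod_hom_closed[OF \<iota> y]] id[OF y] by simp
  qed
qed

text \<open>The inclusion of images takes the place of surjectivity of \<open>g\<close>, which is
  the form in which exactness supplies it. For a dual basis, choose \<open>m x\<close> over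
  \<open>f (e x)\<close> and send \<open>y\<close> to the sum of the \<open>\<xi> x y\<close> times
  \<open>m x\<close>.\<close>

lemma projective_lift:
  fixes P :: "('r, 'm, 'x) module_scheme"
  assumes R: "ring R" and P: "projective_module R P" and M: "left_module R M" and N: "left_module R N"
    and f: "f \<in> mod_hom R P N" and g: "g \<in> mod_hom R M N"
    and sub: "f ` carrier P \<subseteq> g ` carrier M"
  obtains s where "s \<in> mod_hom R P M" "\<And>y. y \<in> carrier P \<Longrightarrow> g (s y) = f y"
proof -
  interpret R: ring R by fact
  interpret P: left_module R P using P by (simp add: projective_module_def)
  interpret M: left_module R M by fact
  interpret N: left_module R N by fact
  obtain X :: "'m set" and \<xi> e
    where \<xi>: "\<And>x. x \<in> X \<Longrightarrow> \<xi> x \<in> mod_hom R P (regular_module R)"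
    and e: "\<And>x. x \<in> X \<Longrightarrow> e x \<in> carrier P"
    and fin: "\<And>y. y \<in> carrier P \<Longrightarrow> finite {x \<in> X. \<xi> x y \<noteq> \<zero>\<^bsub>R\<^esub>}"
    and expand: "\<And>y Y. y \<in> carrier P \<Longrightarrow> finite Y \<Longrightarrow> Y \<subseteq> X \<Longrightarrow> {x \<in> X. \<xi> x y \<noteq> \<zero>\<^bsub>R\<^esub>} \<subseteq> Y \<Longrightarrow>
           (\<Oplus>\<^bsub>P\<^esub>x\<in>Y. \<xi> x y \<odot>\<^bsub>P\<^esub> e x) = y"
    by (rule projective_dual_basis[OF R P], rule that)
  have "\<exists>m. m \<in> carrier M \<and> g m = f (e x)" if "x \<in> X" for x
  proof -
    have "f (e x) \<in> g ` carrier M" using sub e[OF that] by blast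
    then show ?thesis by (metis imageE)
  qed
  then obtain m where m: "\<And>x. x \<in> X \<Longrightarrow> m x \<in> carrier M" "\<And>x. x \<in> X \<Longrightarrow> g (m x) = f (e x)"
    by metis
  have \<xi>c: "\<xi> x y \<in> carrier R" if "x \<in> X" "y \<in> carrier P" for x y
    using mod_hom_closed[OF \<xi>] that by simp
  let ?S = "\<lambda>y. {x \<in> X. \<xi> x y \<noteq> \<zero>\<^bsub>R\<^esub>}"
  define s where "s y = (\<Oplus>\<^bsub>M\<^esub>x\<in>?S y. \<xi> x y \<odot>\<^bsub>M\<^esub> m x)" for y
  \<comment> \<open>The support depends on \<open>y\<close>, so values of \<open>s\<close> at
    different arguments become comparable only after padding with zero terms to a common finite
    set.\<close>
  have s_eq: "s y = (\<Oplus>\<^bsub>M\<^esub>x\<in>Y. \<xi> x y \<odot>\<^bsub>M\<^esub> m x)"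
    if "y \<in> carrier P" "finite Y" "Y \<subseteq> X" "?S y \<subseteq> Y" for y Y
    unfolding s_def using that \<xi>c m(1)
    by (intro M.add.finprod_mono_neutral_cong_left) (auto simp: subset_iff M.smult_zero_left)
  show ?thesis
  proof (rule that[of s])
    show "s \<in> mod_hom R P M"
    proof (rule mod_homI)
      fix y assume "y \<in> carrier P"
      then show "s y \<in> carrier M"
        unfolding s_def by (intro M.finsum_closed) (auto simp: \<xi>c m)
    next
      fix y z assume yz: "y \<in> carrier P" "z \<in> carrier P"
      let ?Y = "?S y \<union> ?S z \<union> ?S (y \<oplus>\<^bsub>P\<^esub> z)"
      have Y: "finite ?Y" using fin yz by simp
      have "s (y \<oplus>\<^bsub>P\<^esub> z) = (\<Oplus>\<^bsub>M\<^esub>x\<in>?Y. \<xi> x (y \<oplus>\<^bsub>P\<^esub> z) \<odot>\<^bsub>M\<^esub> m x)"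
        using yz Y by (intro s_eq) auto
      also have "\<dots> = (\<Oplus>\<^bsub>M\<^esub>x\<in>?Y. \<xi> x y \<odot>\<^bsub>M\<^esub> m x \<oplus>\<^bsub>M\<^esub> \<xi> x z \<odot>\<^bsub>M\<^esub> m x)"
        using yz \<xi>c m(1)
        by (intro M.finsum_cong') (auto simp: mod_hom_add[OF \<xi>] M.smult_l_distr)
      also have "\<dots> = (\<Oplus>\<^bsub>M\<^esub>x\<in>?Y. \<xi> x y \<odot>\<^bsub>M\<^esub> m x) \<oplus>\<^bsub>M\<^esub> (\<Oplus>\<^bsub>M\<^esub>x\<in>?Y. \<xi> x z \<odot>\<^bsub>M\<^esub> m x)"
        using yz \<xi>c m(1) by (intro M.finsum_addf) auto
      also have "(\<Oplus>\<^bsub>M\<^esub>x\<in>?Y. \<xi> x y \<odot>\<^bsub>M\<^esub> m x) = s y"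
        using yz Y by (intro s_eq[symmetric]) auto
      also have "(\<Oplus>\<^bsub>M\<^esub>x\<in>?Y. \<xi> x z \<odot>\<^bsub>M\<^esub> m x) = s z"
        using yz Y by (intro s_eq[symmetric]) auto
      finally show "s (y \<oplus>\<^bsub>P\<^esub> z) = s y \<oplus>\<^bsub>M\<^esub> s z" .
    next
      fix r y assume ry: "r \<in> carrier R" "y \<in> carrier P"
      let ?Y = "?S y \<union> ?S (r \<odot>\<^bsub>P\<^esub> y)"
      have Y: "finite ?Y" using fin ry by simp
      have "s (r \<odot>\<^bsub>P\<^esub> y) = (\<Oplus>\<^bsub>M\<^esub>x\<in>?Y. \<xi> x (r \<odot>\<^bsub>P\<^esub> y) \<odot>\<^bsub>M\<^esub> m x)"
        using ry Y by (intro s_eq) auto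
      also have "\<dots> = (\<Oplus>\<^bsub>M\<^esub>x\<in>?Y. r \<odot>\<^bsub>M\<^esub> (\<xi> x y \<odot>\<^bsub>M\<^esub> m x))"
        using ry \<xi>c m(1)
        by (intro M.finsum_cong') (auto simp: mod_hom_smult[OF \<xi>] M.smult_assoc1)
      also have "\<dots> = r \<odot>\<^bsub>M\<^esub> (\<Oplus>\<^bsub>M\<^esub>x\<in>?Y. \<xi> x y \<odot>\<^bsub>M\<^esub> m x)"
        using ry \<xi>c m(1) Y by (intro M.smult_finsum[symmetric]) auto
      also have "(\<Oplus>\<^bsub>M\<^esub>x\<in>?Y. \<xi> x y \<odot>\<^bsub>M\<^esub> m x) = s y"
        using ry Y by (intro s_eq[symmetric]) auto
      finally show "s (r \<odot>\<^bsub>P\<^esub> y) = r \<odot>\<^bsub>M\<^esub> s y" .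
    qed
    fix y assume y: "y \<in> carrier P"
    have "g (s y) = (\<Oplus>\<^bsub>N\<^esub>x\<in>?S y. g (\<xi> x y \<odot>\<^bsub>M\<^esub> m x))"
      unfolding s_def using y \<xi>c m(1) fin[OF y]
      by (intro mod_hom_finsum[OF _ _ g]) (auto intro: M.abelian_group_axioms N.abelian_group_axioms)
    also have "\<dots> = (\<Oplus>\<^bsub>N\<^esub>x\<in>?S y. f (\<xi> x y \<odot>\<^bsub>P\<^esub> e x))"
      using y \<xi>c m e mod_hom_closed[OF f]
      by (intro N.finsum_cong') (auto simp: mod_hom_smult[OF g] mod_hom_smult[OF f])
    also have "\<dots> = f (\<Oplus>\<^bsub>P\<^esub>x\<in>?S y. \<xi> x y \<odot>\<^bsub>P\<^esub> e x)"
      using y \<xi>c e fin[OF y]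
      by (intro mod_hom_finsum[OF _ _ f, symmetric]) (auto intro: P.abelian_group_axioms N.abelian_group_axioms)
    also have "\<dots> = f y"
      using y fin by (subst expand) auto
    finally show "g (s y) = f y" .
  qed
qed

section \<open>Null-homotopies of chain endomorphisms that vanish under the augmentation\<close>

context
  fixes R :: "('r, 's) ring_scheme" and A :: "('r, 'a, 'x) module_scheme"
    and F :: "nat \<Rightarrow> ('r, 'm, 'y) module_scheme" and d \<epsilon>
  assumes resol: "projective_resolution R A F d \<epsilon>"
begin

lemma resolution_projective: "projective_module R (F i)"
  using resol by (auto simp: projective_resolution_def partial_projective_resolution_def)

lemma resolution_left_module: "left_module R (F i)"
  using resolution_projective by (auto simp: projective_module_def)

lemma resolution_abelian_group: "abelian_group (F i)"
  using resolution_left_module by (auto simp: left_module_def)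

lemma resolution_mod_hom: "d (Suc i) \<in> mod_hom R (F (Suc i)) (F i)"
  using resol by (auto simp: projective_resolution_def partial_projective_resolution_def)

lemma resolution_exact_0: "d (Suc 0) ` carrier (F (Suc 0)) = {x \<in> carrier (F 0). \<epsilon> x = \<zero>\<^bsub>A\<^esub>}"
  using resol by (auto simp: projective_resolution_def partial_projective_resolution_def)

lemma resolution_exact:
  "d (Suc (Suc i)) ` carrier (F (Suc (Suc i))) = {x \<in> carrier (F (Suc i)). d (Suc i) x = \<zero>\<^bsub>F i\<^esub>}"
proof -
  have "partial_projective_resolution R A (Suc (Suc i)) F d \<epsilon>"
    using resol by (simp add: projective_resolution_def)
  then show ?thesis by (simp add: partial_projective_resolution_def)
qed

lemma resolution_d_d: "x \<in> carrier (F (Suc (Suc i))) \<Longrightarrow> d (Suc i) (d (Suc (Suc i)) x) = \<zero>\<^bsub>F i\<^esub>"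
  using resolution_exact[of i] by blast

text \<open>Exactness at \<open>F 0\<close> puts the image of \<open>\<zeta>\<close> inside that of
  the first differential, through which it lifts.\<close>

lemma null_homotopy_0:
  assumes R: "ring R" and \<zeta>: "\<zeta> \<in> mod_hom R (F 0) (F 0)"
    and aug: "\<And>x. x \<in> carrier (F 0) \<Longrightarrow> \<epsilon> (\<zeta> x) = \<zero>\<^bsub>A\<^esub>"
  obtains s where "s \<in> mod_hom R (F 0) (F (Suc 0))" "\<And>x. x \<in> carrier (F 0) \<Longrightarrow> d (Suc 0) (s x) = \<zeta> x"
  by (rule projective_lift[OF R resolution_projective resolution_left_module resolution_left_module
        \<zeta> resolution_mod_hom])
     (use aug mod_hom_closed[OF \<zeta>] resolution_exact_0 in auto)

text \<open>Both halves of the homotopy are returned because each theory uses a different one: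
  cocycles annihilate \<open>d s\<close>, cycles annihilate \<open>t d\<close>.\<close>

lemma null_homotopy_Suc:
  assumes R: "ring R" and \<zeta>: "\<And>i. \<zeta> i \<in> mod_hom R (F i) (F i)"
    and comm: "\<And>i x. x \<in> carrier (F (Suc i)) \<Longrightarrow> d (Suc i) (\<zeta> (Suc i) x) = \<zeta> i (d (Suc i) x)"
    and aug: "\<And>x. x \<in> carrier (F 0) \<Longrightarrow> \<epsilon> (\<zeta> 0 x) = \<zero>\<^bsub>A\<^esub>"
  obtains s t where "s \<in> mod_hom R (F (Suc i)) (F (Suc (Suc i)))" "t \<in> mod_hom R (F i) (F (Suc i))"
    "\<And>x. x \<in> carrier (F (Suc i)) \<Longrightarrow>
      \<zeta> (Suc i) x = d (Suc (Suc i)) (s x) \<oplus>\<^bsub>F (Suc i)\<^esub> t (d (Suc i) x)"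
proof -
  \<comment> \<open>It is enough that \<open>t\<close> is correct on the image of \<open>d\<close>:
    then applying \<open>d\<close> to \<open>\<zeta> - t d\<close> gives
    \<open>\<zeta> d - \<zeta> d = 0\<close>, so this map lands in a kernel, which is the image of
    the next differential, and lifts.\<close>
  have step: "\<exists>s \<in> mod_hom R (F (Suc i)) (F (Suc (Suc i))). \<forall>x\<in>carrier (F (Suc i)).
      d (Suc (Suc i)) (s x) = \<zeta> (Suc i) x \<ominus>\<^bsub>F (Suc i)\<^esub> t (d (Suc i) x)"
    if t: "t \<in> mod_hom R (F i) (F (Suc i))"
      "\<And>y. y \<in> d (Suc i) ` carrier (F (Suc i)) \<Longrightarrow> d (Suc i) (t y) = \<zeta> i y" for i t
  proof -
    interpret F: left_module R "F (Suc i)" by (rule resolution_left_module)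
    interpret F': left_module R "F i" by (rule resolution_left_module)
    let ?f = "\<lambda>x. \<zeta> (Suc i) x \<ominus>\<^bsub>F (Suc i)\<^esub> t (d (Suc i) x)"
    note dc = mod_hom_closed[OF resolution_mod_hom] and zc = mod_hom_closed[OF \<zeta>]
      and tc = mod_hom_closed[OF t(1)]
    have f: "?f \<in> mod_hom R (F (Suc i)) (F (Suc i))"
    proof (rule mod_homI)
      fix x y assume xy: "x \<in> carrier (F (Suc i))" "y \<in> carrier (F (Suc i))"
      show "?f (x \<oplus>\<^bsub>F (Suc i)\<^esub> y) = ?f x \<oplus>\<^bsub>F (Suc i)\<^esub> ?f y"
        using xy by (simp add: mod_hom_add[OF resolution_mod_hom] mod_hom_add[OF \<zeta>] mod_hom_add[OF t(1)]
            dc zc tc F.minus_eq F.minus_add F.a_ac)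
    next
      fix r x assume rx: "r \<in> carrier R" "x \<in> carrier (F (Suc i))"
      show "?f (r \<odot>\<^bsub>F (Suc i)\<^esub> x) = r \<odot>\<^bsub>F (Suc i)\<^esub> ?f x"
        using rx by (simp add: mod_hom_smult[OF resolution_mod_hom] mod_hom_smult[OF \<zeta>] mod_hom_smult[OF t(1)]
            dc zc tc F.minus_eq F.smult_r_distr F.smult_a_inv)
    qed (simp add: dc zc tc)
    have "?f ` carrier (F (Suc i)) \<subseteq> d (Suc (Suc i)) ` carrier (F (Suc (Suc i)))"
    proof (rule image_subsetI)
      fix x assume x: "x \<in> carrier (F (Suc i))"
      have "d (Suc i) (?f x) = \<zeta> i (d (Suc i) x) \<ominus>\<^bsub>F i\<^esub> \<zeta> i (d (Suc i) x)"
        using x by (simp add: dc zc tc comm t(2)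
            mod_hom_minus[OF resolution_abelian_group resolution_abelian_group resolution_mod_hom])
      also have "\<dots> = \<zero>\<^bsub>F i\<^esub>"
        using x by (simp add: dc zc F'.r_neg F'.minus_eq)
      finally show "?f x \<in> d (Suc (Suc i)) ` carrier (F (Suc (Suc i)))"
        unfolding resolution_exact using x by (simp add: dc zc tc)
    qed
    then obtain s where "s \<in> mod_hom R (F (Suc i)) (F (Suc (Suc i)))"
        "\<And>x. x \<in> carrier (F (Suc i)) \<Longrightarrow> d (Suc (Suc i)) (s x) = ?f x"
      using projective_lift[OF R resolution_projective resolution_left_module resolution_left_module
        f resolution_mod_hom] by metis
    then show ?thesis by blast
  qed
  \<comment> \<open>The invariant carried up the resolution concerns boundaries only. On them the
    lower differential vanishes, so the correction term in \<open>step\<close> drops out and the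
    lift \<open>s\<close> satisfies the invariant one degree higher.\<close>
  have "\<exists>t \<in> mod_hom R (F i) (F (Suc i)). \<forall>y \<in> d (Suc i) ` carrier (F (Suc i)). d (Suc i) (t y) = \<zeta> i y"
  proof (induction i)
    case 0
    obtain s where "s \<in> mod_hom R (F 0) (F (Suc 0))"
        "\<And>x. x \<in> carrier (F 0) \<Longrightarrow> d (Suc 0) (s x) = \<zeta> 0 x"
      by (rule null_homotopy_0[OF R \<zeta> aug], assumption, rule that)
    then show ?case
      using mod_hom_closed[OF resolution_mod_hom] by blast
  next
    case (Suc i)
    interpret F: left_module R "F (Suc i)" by (rule resolution_left_module)
    interpret F': left_module R "F i" by (rule resolution_left_module)
    from Suc obtain t where t: "t \<in> mod_hom R (F i) (F (Suc i))"
      "\<And>y. y \<in> d (Suc i) ` carrier (F (Suc i)) \<Longrightarrow> d (Suc i) (t y) = \<zeta> i y" by blast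
    from step[OF t] obtain s where s: "s \<in> mod_hom R (F (Suc i)) (F (Suc (Suc i)))"
      "\<And>x. x\<in>carrier (F (Suc i)) \<Longrightarrow>
        d (Suc (Suc i)) (s x) = \<zeta> (Suc i) x \<ominus>\<^bsub>F (Suc i)\<^esub> t (d (Suc i) x)" by blast
    show ?case
    proof (intro bexI[OF _ s(1)] ballI)
      fix y assume "y \<in> d (Suc (Suc i)) ` carrier (F (Suc (Suc i)))"
      then have y: "y \<in> carrier (F (Suc i))" "d (Suc i) y = \<zero>\<^bsub>F i\<^esub>"
        unfolding resolution_exact by auto
      show "d (Suc (Suc i)) (s y) = \<zeta> (Suc i) y"
        using mod_hom_closed[OF \<zeta> y(1)]
        by (simp add: s(2)[OF y(1)] y(2) F.minus_eq
            mod_hom_zero[OF resolution_abelian_group resolution_abelian_group t(1)])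
    qed
  qed
  then obtain t where t: "t \<in> mod_hom R (F i) (F (Suc i))"
      "\<And>y. y \<in> d (Suc i) ` carrier (F (Suc i)) \<Longrightarrow> d (Suc i) (t y) = \<zeta> i y" by blast
  from step[OF t] obtain s where s: "s \<in> mod_hom R (F (Suc i)) (F (Suc (Suc i)))"
      "\<And>x. x\<in>carrier (F (Suc i)) \<Longrightarrow>
        d (Suc (Suc i)) (s x) = \<zeta> (Suc i) x \<ominus>\<^bsub>F (Suc i)\<^esub> t (d (Suc i) x)" by blast
  interpret F: left_module R "F (Suc i)" by (rule resolution_left_module)
  show ?thesis
  proof (rule that[OF s(1) t(1)])
    fix x assume x: "x \<in> carrier (F (Suc i))"
    have "t (d (Suc i) x) \<in> carrier (F (Suc i))"
      using mod_hom_closed[OF t(1) mod_hom_closed[OF resolution_mod_hom x]] .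
    then show "\<zeta> (Suc i) x = d (Suc (Suc i)) (s x) \<oplus>\<^bsub>F (Suc i)\<^esub> t (d (Suc i) x)"
      using mod_hom_closed[OF \<zeta> x] by (simp add: s(2)[OF x] F.minus_eq F.a_assoc F.l_neg)
  qed
qed

end

section \<open>Central elements of the group ring\<close>

text \<open>Serves twice: for the action of group ring elements on l^p(G), and for evaluating
  complex functionals on the formal sums of pairs that represent tensors.\<close>

definition lin_ext :: "('a \<Rightarrow> complex) \<Rightarrow> ('a \<Rightarrow>\<^sub>0 int) \<Rightarrow> complex"
  where "lin_ext \<phi> c = (\<Sum>k\<in>Poly_Mapping.keys c. of_int (Poly_Mapping.lookup c k) * \<phi> k)"

lemma lin_ext_simps [simp]:
  "lin_ext \<phi> 0 = 0" "lin_ext \<phi> (frag_of k) = \<phi> k"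
  "lin_ext \<phi> (a + b) = lin_ext \<phi> a + lin_ext \<phi> b"
  "lin_ext \<phi> (a - b) = lin_ext \<phi> a - lin_ext \<phi> b"
  by (simp_all add: lin_ext_def linear_extension_add linear_extension_diff)

lemma lin_ext_minus [simp]: "lin_ext \<phi> (- a) = - lin_ext \<phi> a"
  using lin_ext_simps(4)[of \<phi> 0 a] by simp

lemma lin_ext_sum [simp]: "lin_ext \<phi> (\<Sum>i\<in>I. a i) = (\<Sum>i\<in>I. lin_ext \<phi> (a i))"
  by (induction I rule: infinite_finite_induct) auto

lemma lp_smult_apply:
  "(a \<odot>\<^bsub>lp_module G p\<^esub> f) x =
    (if x \<in> carrier G then lin_ext (\<lambda>g. f (inv\<^bsub>G\<^esub> g \<otimes>\<^bsub>G\<^esub> x)) a else 0)"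
  by (simp add: lp_module_def lin_ext_def)

lemma frag_extend_diff_fun:
  "frag_extend (\<lambda>x. f x - g x) a = frag_extend f a - frag_extend g a"
  using frag_extend_add_fun[of "\<lambda>x. f x - g x" g a] by (simp add: algebra_simps)

lemma group_ring_mult_diff:
  "b \<otimes>\<^bsub>group_ring G\<^esub> (c - d) = b \<otimes>\<^bsub>group_ring G\<^esub> c - b \<otimes>\<^bsub>group_ring G\<^esub> d"
  "(c - d) \<otimes>\<^bsub>group_ring G\<^esub> b = c \<otimes>\<^bsub>group_ring G\<^esub> b - d \<otimes>\<^bsub>group_ring G\<^esub> b"
  "b \<otimes>\<^bsub>group_ring G\<^esub> 0 = 0" "0 \<otimes>\<^bsub>group_ring G\<^esub> b = 0"
  by (simp_all add: group_ring_def frag_extend_diff frag_extend_diff_fun frag_extend_eq_0)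

text \<open>The element z_S - |S| of the group ring, with |S| written as a sum of copies of the
  unit; for infinite \<open>S\<close> both sums are 0 by convention.\<close>

definition conj_defect :: "('g, 'b) monoid_scheme \<Rightarrow> 'g set \<Rightarrow> ('g \<Rightarrow>\<^sub>0 int)"
  where "conj_defect G S = (\<Sum>g\<in>S. frag_of g) - (\<Sum>g\<in>S. frag_of \<one>\<^bsub>G\<^esub>)"

context Group.group
begin

lemma keys_sum_frag_of: "Poly_Mapping.keys (\<Sum>g\<in>S. frag_of (f g)) \<subseteq> f ` S"
  by (rule order_trans[OF Poly_Mapping.keys_sum]) auto

lemma conj_defect_closed: "S \<subseteq> carrier G \<Longrightarrow> conj_defect G S \<in> carrier (group_ring G)"
proof -
  assume S: "S \<subseteq> carrier G"
  have "Poly_Mapping.keys (conj_defect G S) \<subseteq> S \<union> {\<one>}"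
    unfolding conj_defect_def
    using keys_diff keys_sum_frag_of[of "\<lambda>g. g" S] keys_sum_frag_of[of "\<lambda>g. \<one>" S] by fastforce
  with S show ?thesis by (auto simp: group_ring_def)
qed

text \<open>By additivity it suffices to commute with a group element \<open>g\<close>; there
  \<open>g h = (g h g^-1) g\<close>, and conjugation by \<open>g\<close> permutes
  \<open>S\<close>.\<close>

lemma conj_defect_central:
  assumes S: "S \<subseteq> carrier G" "\<And>g h. g \<in> carrier G \<Longrightarrow> h \<in> S \<Longrightarrow> g \<otimes> h \<otimes> inv g \<in> S"
    and a: "a \<in> carrier (group_ring G)"
  shows "conj_defect G S \<otimes>\<^bsub>group_ring G\<^esub> a = a \<otimes>\<^bsub>group_ring G\<^esub> conj_defect G S"
proof -
  note diff = group_ring_mult_diff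
  have mult: "frag_of g \<otimes>\<^bsub>group_ring G\<^esub> (\<Sum>h\<in>S. frag_of (f h)) = (\<Sum>h\<in>S. frag_of (g \<otimes> f h))"
    "(\<Sum>h\<in>S. frag_of (f h)) \<otimes>\<^bsub>group_ring G\<^esub> frag_of g = (\<Sum>h\<in>S. frag_of (f h \<otimes> g))" for f g
    by (induction S rule: infinite_finite_induct) (simp_all add: group_ring_def frag_extend_add)
  have "Poly_Mapping.keys a \<subseteq> carrier G" using a by (simp add: group_ring_def)
  then show ?thesis
  proof (induction a rule: frag_induction)
    case (one g)
    have cancel: "g \<otimes> (inv g \<otimes> h) = h" "inv g \<otimes> (g \<otimes> h) = h" if "h \<in> carrier G" for h
      using one that by (simp_all add: m_assoc[symmetric])
    have "(\<Sum>h\<in>S. frag_of (g \<otimes> h)) = (\<Sum>h\<in>S. frag_of (h \<otimes> g))"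
      by (rule sum.reindex_bij_witness[of _ "\<lambda>h. inv g \<otimes> h \<otimes> g" "\<lambda>h. g \<otimes> h \<otimes> inv g"])
        (use S one S(2)[of "inv g"] in \<open>auto simp: cancel m_assoc subset_iff\<close>)
    then show ?case
      using one by (simp add: conj_defect_def diff mult mult(1)[of _ "\<lambda>_. \<one>"] mult(2)[of "\<lambda>_. \<one>"])
  qed (simp_all add: diff)
qed

text \<open>Both sums in the defect have augmentation \<open>card S\<close>; this makes the defect
  vanish after the augmentation of a resolution.\<close>

lemma conj_defect_trivial: "conj_defect G S \<odot>\<^bsub>trivial_module\<^esub> n = 0"
proof -
  define A where "A a = (\<Sum>k\<in>Poly_Mapping.keys a. Poly_Mapping.lookup a k)" for a :: "'a \<Rightarrow>\<^sub>0 int"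
  have A: "A (a + b) = A a + A b" "A (a - b) = A a - A b" "A (frag_of k) = 1" "A 0 = 0" for a b k
    using linear_extension_add[of a b "\<lambda>_. 1::int"] linear_extension_diff[of a b "\<lambda>_. 1::int"]
    by (simp_all add: A_def)
  have "A (\<Sum>g\<in>S. frag_of (f g)) = int (card S)" for f :: "'a \<Rightarrow> 'a"
    by (induction S rule: infinite_finite_induct) (simp_all add: A)
  from this[of "\<lambda>g. g"] this[of "\<lambda>g. \<one>"] have "A (conj_defect G S) = 0"
    by (simp only: conj_defect_def A)
  then show ?thesis by (simp add: trivial_module_def A_def)
qed

lemma group_ring_star_closed: "a \<in> carrier (group_ring G) \<Longrightarrow> group_ring_star G a \<in> carrier (group_ring G)"
  unfolding group_ring_def group_ring_star_def
  using keys_frag_extend[of "\<lambda>g. frag_of (inv g)" a] by auto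

lemma group_ring_star_star: "a \<in> carrier (group_ring G) \<Longrightarrow> group_ring_star G (group_ring_star G a) = a"
proof -
  assume "a \<in> carrier (group_ring G)"
  then have "Poly_Mapping.keys a \<subseteq> carrier G" by (simp add: group_ring_def)
  then show ?thesis
    by (induction a rule: frag_induction) (auto simp: group_ring_star_def frag_extend_diff)
qed

lemma group_ring_star_add: "group_ring_star G (a + b) = group_ring_star G a + group_ring_star G b"
  by (simp add: group_ring_star_def frag_extend_add)

text \<open>Both sides are biadditive, so the claim reduces to the inverse of a product of two group
  elements. The reversed order is what makes \<open>lp_functional\<close> balanced.\<close>

lemma group_ring_star_mult:
  assumes "a \<in> carrier (group_ring G)" "b \<in> carrier (group_ring G)"
  shows "group_ring_star G (a \<otimes>\<^bsub>group_ring G\<^esub> b) =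
    group_ring_star G b \<otimes>\<^bsub>group_ring G\<^esub> group_ring_star G a"
proof -
  have a: "Poly_Mapping.keys a \<subseteq> carrier G" and b: "Poly_Mapping.keys b \<subseteq> carrier G"
    using assms by (simp_all add: group_ring_def)
  note diff = group_ring_mult_diff
  have sdiff: "group_ring_star G (c - d) = group_ring_star G c - group_ring_star G d"
    "group_ring_star G 0 = 0" for c d
    by (simp_all add: group_ring_star_def frag_extend_diff)
  show ?thesis using a
  proof (induction a rule: frag_induction)
    case (one g)
    show ?case using b
      by (induction b rule: frag_induction)
        (use one in \<open>simp_all add: diff sdiff\<close>, use one in \<open>simp add: group_ring_def group_ring_star_def inv_mult_group\<close>)
  qed (simp_all add: diff sdiff)
qed

text \<open>Inversion is injective, so the class sum goes to the sum over the inverses with the same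
  cardinality. In homology the defect crosses the tensor sign in this form.\<close>

lemma group_ring_star_conj_defect:
  assumes "S \<subseteq> carrier G"
  shows "group_ring_star G (conj_defect G S) = conj_defect G ((\<lambda>g. inv g) ` S)"
proof (cases "finite S")
  case True
  have "inj_on (\<lambda>g. inv g) S" using assms by (meson inj_on_subset inv_inj)
  then show ?thesis
    by (simp add: conj_defect_def group_ring_star_def frag_extend_diff frag_extend_sum True sum.reindex o_def
        card_image del: sum_constant)
next
  case False
  have "inj_on (\<lambda>g. inv g) S" using assms by (meson inj_on_subset inv_inj)
  with False have "infinite ((\<lambda>g. inv g) ` S)" by (simp add: finite_image_iff)
  with False show ?thesis by (simp add: conj_defect_def group_ring_star_def)
qed

lemma lp_smult_conj_defect:
  assumes "S \<subseteq> carrier G" "x \<in> carrier G"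
  shows "(conj_defect G S \<odot>\<^bsub>lp_module G p\<^esub> f) x = (\<Sum>g\<in>S. f (inv g \<otimes> x)) - of_nat (card S) * f x"
  using assms by (simp add: lp_smult_apply conj_defect_def)

section \<open>Conjugacy classes as invariant, pairwise disjoint sets\<close>

lemma conjugacy_classesE:
  assumes "C \<in> conjugacy_classes G"
  obtains h where "h \<in> carrier G" "C = {g \<otimes> h \<otimes> inv g | g. g \<in> carrier G}"
  using assms by (auto simp: conjugacy_classes_def orbits_def orbit_def)

lemma conjugacy_class_subset: "C \<in> conjugacy_classes G \<Longrightarrow> C \<subseteq> carrier G"
  by (auto elim!: conjugacy_classesE)

lemma conjugacy_class_nonempty: "C \<in> conjugacy_classes G \<Longrightarrow> C \<noteq> {}"
  by (auto elim!: conjugacy_classesE)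

lemma conjugacy_class_invariant:
  assumes "C \<in> conjugacy_classes G" "g \<in> carrier G" "h \<in> C"
  shows "g \<otimes> h \<otimes> inv g \<in> C"
proof -
  from assms obtain k x where k: "k \<in> carrier G" "C = {g \<otimes> k \<otimes> inv g | g. g \<in> carrier G}"
    and x: "x \<in> carrier G" "h = x \<otimes> k \<otimes> inv x"
    by (auto elim!: conjugacy_classesE)
  have "g \<otimes> h \<otimes> inv g = (g \<otimes> x) \<otimes> k \<otimes> inv (g \<otimes> x)"
    using assms(2) k x by (simp add: m_assoc inv_mult_group)
  with k x assms(2) show ?thesis by auto
qed

lemma conjugacy_class_eq:
  assumes "C \<in> conjugacy_classes G" "h \<in> C"
  shows "C = {g \<otimes> h \<otimes> inv g | g. g \<in> carrier G}"
proof -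
  from assms obtain k x where k: "k \<in> carrier G" "C = {g \<otimes> k \<otimes> inv g | g. g \<in> carrier G}"
    and x: "x \<in> carrier G" "h = x \<otimes> k \<otimes> inv x"
    by (auto elim!: conjugacy_classesE)
  have "g \<otimes> k \<otimes> inv g = (g \<otimes> inv x) \<otimes> h \<otimes> inv (g \<otimes> inv x)" if "g \<in> carrier G" for g
    using that k x by (simp add: inv_mult_group m_assoc) (simp add: m_assoc[symmetric])
  then have "C \<subseteq> {g \<otimes> h \<otimes> inv g | g. g \<in> carrier G}"
    unfolding k(2) using x(1) by blast
  moreover have "{g \<otimes> h \<otimes> inv g | g. g \<in> carrier G} \<subseteq> C"
    using conjugacy_class_invariant[OF assms(1) _ assms(2)] by blast
  ultimately show ?thesis by blast
qed

lemma conjugacy_classes_disjoint: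
  "C \<in> conjugacy_classes G \<Longrightarrow> D \<in> conjugacy_classes G \<Longrightarrow> C \<noteq> D \<Longrightarrow> C \<inter> D = {}"
  using conjugacy_class_eq by blast

end

section \<open>Strong convergence of the class averages\<close>

text \<open>Left convolution with the function \<open>c\<close> cut off to \<open>S\<close>. The
  weights are complex, since the averages have denominators and do not come from Z[G].\<close>

definition lp_comb :: "('g, 'b) monoid_scheme \<Rightarrow> ('g \<Rightarrow> complex) \<Rightarrow> 'g set \<Rightarrow> ('g \<Rightarrow> complex) \<Rightarrow> 'g \<Rightarrow> complex"
  where "lp_comb G c S f x = (if x \<in> carrier G then \<Sum>g\<in>S. c g * f (inv\<^bsub>G\<^esub> g \<otimes>\<^bsub>G\<^esub> x) else 0)"

lemma lp_zero: "(\<lambda>x. 0) \<in> carrier (lp_module G p)"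
  by (simp add: lp_module_def)

lemma lp_norm_scale:
  assumes "1 \<le> p"
  shows "lp_norm G p (\<lambda>x. c * f x) = cmod c * lp_norm G p f"
  using assms
  by (simp add: lp_norm_def norm_mult powr_mult infsum_cmult_right' powr_powr infsum_nonneg)

text \<open>One term of the sum is at most the whole sum. This is the source of the continuity of
  point evaluations.\<close>

lemma lp_norm_ge_apply:
  assumes p: "1 \<le> p" and f: "f \<in> carrier (lp_module G p)"
  shows "cmod (f x) \<le> lp_norm G p f"
proof (cases "x \<in> carrier G")
  case True
  have "cmod (f x) powr p = (\<Sum>\<^sub>\<infinity>y\<in>{x}. cmod (f y) powr p)" by simp
  also have "\<dots> \<le> (\<Sum>\<^sub>\<infinity>y\<in>carrier G. cmod (f y) powr p)"
    using f True by (intro infsum_mono_neutral) (auto simp: lp_module_def)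
  finally have "(cmod (f x) powr p) powr (1 / p) \<le> lp_norm G p f"
    unfolding lp_norm_def using p by (intro powr_mono2) auto
  then show ?thesis using p by (simp add: powr_powr)
next
  case False
  then show ?thesis using f lp_norm_nonneg by (simp add: lp_module_def)
qed

lemma lp_norm_translate:
  assumes "Group.group G" "g \<in> carrier G"
  shows "lp_norm G p (\<lambda>x. if x \<in> carrier G then f (inv\<^bsub>G\<^esub> g \<otimes>\<^bsub>G\<^esub> x) else 0) = lp_norm G p f"
proof -
  interpret G: Group.group G by fact
  have bij: "bij_betw (\<lambda>x. inv\<^bsub>G\<^esub> g \<otimes>\<^bsub>G\<^esub> x) (carrier G) (carrier G)"
    using assms(2) by (intro bij_betwI[where g="\<lambda>x. g \<otimes>\<^bsub>G\<^esub> x"]) (auto simp: G.m_assoc[symmetric])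
  show ?thesis
    using infsum_reindex_bij_betw[OF bij, of "\<lambda>x. cmod (f x) powr p"]
    by (simp add: lp_norm_def cong: infsum_cong)
qed

text \<open>Young's inequality for an l^1 and an l^p factor: translations are isometries and the
  triangle inequality adds up the weights.\<close>

lemma lp_comb_bound:
  assumes G: "Group.group G" and p: "1 \<le> p" and f: "f \<in> carrier (lp_module G p)"
    and S: "finite S" "S \<subseteq> carrier G"
  shows "lp_comb G c S f \<in> carrier (lp_module G p)"
    and "lp_norm G p (lp_comb G c S f) \<le> (\<Sum>g\<in>S. cmod (c g)) * lp_norm G p f"
proof -
  have "lp_comb G c S f \<in> carrier (lp_module G p) \<and>
    lp_norm G p (lp_comb G c S f) \<le> (\<Sum>g\<in>S. cmod (c g)) * lp_norm G p f"
    using S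
  proof (induction S rule: finite_induct)
    case empty
    have "lp_comb G c {} f = (\<lambda>x. 0)" by (auto simp: lp_comb_def)
    then show ?case using lp_zero[of G p] lp_norm_eq_0[OF p lp_zero, of G] by simp
  next
    case (insert g S)
    let ?h = "\<lambda>x. c g * (if x \<in> carrier G then f (inv\<^bsub>G\<^esub> g \<otimes>\<^bsub>G\<^esub> x) else 0)"
    have h: "?h \<in> carrier (lp_module G p)"
      using insert.prems by (intro lp_scale lp_translate[OF G _ f]) auto
    have IH: "lp_comb G c S f \<in> carrier (lp_module G p)"
      "lp_norm G p (lp_comb G c S f) \<le> (\<Sum>g\<in>S. cmod (c g)) * lp_norm G p f"
      using insert by auto
    have eq: "lp_comb G c (insert g S) f = (\<lambda>x. ?h x + lp_comb G c S f x)"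
      using insert.hyps by (auto simp: lp_comb_def fun_eq_iff)
    have "lp_norm G p ?h = cmod (c g) * lp_norm G p f"
      using insert.prems by (simp only: lp_norm_scale[OF p] lp_norm_translate[OF G] insert_subset)
    with lp_norm_triangle[OF p h IH(1)] IH(2) insert.hyps show ?case
      unfolding eq using lp_add[OF p h IH(1)] by (simp add: algebra_simps)
  qed
  then show "lp_comb G c S f \<in> carrier (lp_module G p)"
    and "lp_norm G p (lp_comb G c S f) \<le> (\<Sum>g\<in>S. cmod (c g)) * lp_norm G p f" by auto
qed

text \<open>Convolving with the point mass at \<open>h\<close> moves \<open>c\<close> to the right
  translate of \<open>S\<close> by \<open>h\<close> without collisions, so the p-th power of the
  norm is the sum of the \<open>cmod (c g) powr p\<close>.\<close>

lemma lp_comb_delta_bound: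
  assumes G: "Group.group G" and p: "1 < p" and S: "finite S" "S \<subseteq> carrier G" and h: "h \<in> carrier G"
    and c: "\<And>g. g \<in> S \<Longrightarrow> cmod (c g) \<le> b" "(\<Sum>g\<in>S. cmod (c g)) \<le> 1"
  shows "lp_norm G p (lp_comb G c S (\<lambda>x. if x = h then 1 else 0)) \<le> (b powr (p - 1)) powr (1 / p)"
proof -
  interpret G: Group.group G by fact
  let ?f = "lp_comb G c S (\<lambda>x. if x = h then 1 else 0)"
  let ?T = "(\<lambda>g. g \<otimes>\<^bsub>G\<^esub> h) ` S"
  have inj: "inj_on (\<lambda>g. g \<otimes>\<^bsub>G\<^esub> h) S"
    using S h by (intro inj_onI) (metis G.right_cancel subsetD)
  have f: "?f x = (\<Sum>g\<in>S. if x = g \<otimes>\<^bsub>G\<^esub> h then c g else 0)" if "x \<in> carrier G" for x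
  proof -
    have "(inv\<^bsub>G\<^esub> g \<otimes>\<^bsub>G\<^esub> x = h) = (x = g \<otimes>\<^bsub>G\<^esub> h)" if "g \<in> S" for g
      using \<open>x \<in> carrier G\<close> that h S(2) G.inv_solve_left' by (metis subsetD)
    then show ?thesis
      using \<open>x \<in> carrier G\<close> by (auto simp: lp_comb_def if_distrib cong: if_cong intro!: sum.cong)
  qed
  have fg: "?f (g \<otimes>\<^bsub>G\<^esub> h) = c g" if g: "g \<in> S" for g
  proof -
    have "(g \<otimes>\<^bsub>G\<^esub> h = k \<otimes>\<^bsub>G\<^esub> h) = (k = g)" if "k \<in> S" for k
      using that g inj by (auto dest: inj_onD)
    then have "?f (g \<otimes>\<^bsub>G\<^esub> h) = (\<Sum>k\<in>S. if k = g then c k else 0)"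
      using g h S(2) by (subst f) (auto intro!: sum.cong)
    then show ?thesis using S(1) g by simp
  qed
  have "(\<Sum>\<^sub>\<infinity>x\<in>carrier G. cmod (?f x) powr p) = (\<Sum>\<^sub>\<infinity>x\<in>?T. cmod (?f x) powr p)"
  proof (rule infsum_cong_neutral)
    fix x assume x: "x \<in> carrier G - ?T"
    then have "?f x = 0" by (subst f) (auto intro!: sum.neutral)
    then show "cmod (?f x) powr p = 0" by simp
  qed (use S h in auto)
  also have "\<dots> = (\<Sum>g\<in>S. cmod (c g) powr p)"
    using S(1) by (simp add: sum.reindex[OF inj] fg)
  also have "\<dots> \<le> (\<Sum>g\<in>S. b powr (p - 1) * cmod (c g))"
  proof (rule sum_mono)
    fix g assume g: "g \<in> S"
    \<comment> \<open>One factor is kept for the total mass; the remaining exponent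
      \<open>p - 1\<close> is positive, so that power is controlled by \<open>b\<close>.\<close>
    have "cmod (c g) powr p = cmod (c g) powr (p - 1) * cmod (c g)"
      using p by (cases "c g = 0") (simp_all add: powr_diff)
    also have "\<dots> \<le> b powr (p - 1) * cmod (c g)"
      using p c(1)[OF g] by (intro mult_right_mono powr_mono2) auto
    finally show "cmod (c g) powr p \<le> b powr (p - 1) * cmod (c g)" .
  qed
  also have "\<dots> \<le> b powr (p - 1) * 1"
    unfolding sum_distrib_left[symmetric] using c(2) by (intro mult_left_mono) auto
  finally show ?thesis
    unfolding lp_norm_def using p by (intro powr_mono2) (auto intro: infsum_nonneg)
qed

text \<open>Density of the finitely supported functions, in the form of a small remainder.\<close>

lemma lp_tail:
  assumes p: "1 \<le> p" and f: "f \<in> carrier (lp_module G p)" and e: "0 < e"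
  obtains T where "finite T" "T \<subseteq> carrier G" "(\<lambda>x. if x \<in> T then 0 else f x) \<in> carrier (lp_module G p)"
    "lp_norm G p (\<lambda>x. if x \<in> T then 0 else f x) < e"
proof -
  have sum: "(\<lambda>x. cmod (f x) powr p) summable_on carrier G"
    using f by (simp add: lp_module_def)
  let ?s = "\<Sum>\<^sub>\<infinity>x\<in>carrier G. cmod (f x) powr p"
  \<comment> \<open>Halving \<open>e powr p\<close> turns the non-strict approximation into the
    strict bound wanted for the tail.\<close>
  obtain T where T: "finite T" "T \<subseteq> carrier G" "dist (\<Sum>x\<in>T. cmod (f x) powr p) ?s \<le> e powr p / 2"
    using infsum_finite_approximation[OF sum, of "e powr p / 2"] e
    by auto
  let ?h = "\<lambda>x. if x \<in> T then 0 else f x"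
  have "(\<Sum>\<^sub>\<infinity>x\<in>carrier G. cmod (?h x) powr p) = (\<Sum>\<^sub>\<infinity>x\<in>carrier G - T. cmod (f x) powr p)"
    by (rule infsum_cong_neutral) auto
  also have "\<dots> = ?s - (\<Sum>\<^sub>\<infinity>x\<in>T. cmod (f x) powr p)"
    using T by (intro infsum_Diff sum) auto
  also have "\<dots> < e powr p"
  proof -
    have "0 < e powr p" using e by simp
    with T(3) show ?thesis
      unfolding dist_real_def infsum_finite[OF T(1)] by arith
  qed
  finally have "lp_norm G p ?h < (e powr p) powr (1 / p)"
    unfolding lp_norm_def using p by (intro powr_less_mono2) (auto intro: infsum_nonneg)
  then have lt: "lp_norm G p ?h < e" using e p by (simp add: powr_powr)
  have "(\<lambda>x. cmod (?h x) powr p) summable_on carrier G"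
    by (rule summable_on_comparison_test[OF sum]) auto
  then have "?h \<in> carrier (lp_module G p)" using f T(2) by (auto simp: lp_module_def)
  from that[OF T(1,2) this lt] show ?thesis .
qed

lemma lp_comb_add:
  "lp_comb G c S (\<lambda>x. f x + h x) = (\<lambda>x. lp_comb G c S f x + lp_comb G c S h x)"
  by (auto simp: lp_comb_def algebra_simps sum.distrib)

lemma lp_comb_scale:
  "lp_comb G c S (\<lambda>x. a * f x) = (\<lambda>x. a * lp_comb G c S f x)"
  by (auto simp: lp_comb_def sum_distrib_left algebra_simps)

lemma lp_delta: "h \<in> carrier G \<Longrightarrow> (\<lambda>x. if x = h then 1 else 0) \<in> carrier (lp_module G p)"
proof -
  assume h: "h \<in> carrier G"
  have "(\<lambda>x. cmod (if x = h then 1 else 0) powr p) summable_on {h}" by simp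
  then have "(\<lambda>x. cmod (if x = h then 1 else 0) powr p) summable_on carrier G"
    by (rule summable_on_cong_neutral[THEN iffD1, rotated -1]) (use h in auto)
  with h show ?thesis by (auto simp: lp_module_def)
qed

text \<open>A finitely supported function is a combination of point masses, each subject to
  \<open>lp_comb_delta_bound\<close>. The factor in front depends on \<open>f\<close> and
  \<open>T\<close> but not on the weights, so it stays fixed when \<open>b\<close> tends to
  0.\<close>

lemma lp_comb_finite_bound:
  assumes G: "Group.group G" and p: "1 < p" and S: "finite S" "S \<subseteq> carrier G"
    and c: "\<And>g. g \<in> S \<Longrightarrow> cmod (c g) \<le> b" "(\<Sum>g\<in>S. cmod (c g)) \<le> 1"
    and T: "finite T" "T \<subseteq> carrier G"
  shows "(\<lambda>x. if x \<in> T then f x else 0) \<in> carrier (lp_module G p)" (is "?h T \<in> _")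
    and "lp_norm G p (lp_comb G c S (\<lambda>x. if x \<in> T then f x else 0))
      \<le> (\<Sum>h\<in>T. cmod (f h)) * (b powr (p - 1)) powr (1 / p)" (is "?L T \<le> ?R T")
proof -
  have p': "1 \<le> p" using p by simp
  have "?h T \<in> carrier (lp_module G p) \<and> ?L T \<le> ?R T"
    using T
  proof (induction T rule: finite_induct)
    case empty
    have "lp_comb G c S (\<lambda>x. 0) = (\<lambda>x. 0)" by (auto simp: lp_comb_def)
    then show ?case using lp_zero[of G p] lp_norm_eq_0[OF p' lp_zero, of G] by simp
  next
    case (insert h T)
    let ?d = "\<lambda>x. if x = h then 1 else 0"
    have h: "h \<in> carrier G" and IH: "?h T \<in> carrier (lp_module G p)" "?L T \<le> ?R T"
      using insert by auto
    have d: "?d \<in> carrier (lp_module G p)" by (rule lp_delta[OF h])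
    have eq: "?h (insert h T) = (\<lambda>x. f h * ?d x + ?h T x)"
      using insert.hyps by auto
    have "?L (insert h T) \<le> lp_norm G p (lp_comb G c S (\<lambda>x. f h * ?d x)) + ?L T"
      unfolding eq lp_comb_add
      by (intro lp_norm_triangle[OF p'] lp_comb_bound[OF G p'] lp_scale d IH S)
    also have "lp_norm G p (lp_comb G c S (\<lambda>x. f h * ?d x)) =
        cmod (f h) * lp_norm G p (lp_comb G c S ?d)"
      by (simp only: lp_comb_scale lp_norm_scale[OF p'])
    also have "\<dots> \<le> cmod (f h) * (b powr (p - 1)) powr (1 / p)"
      by (intro mult_left_mono lp_comb_delta_bound[OF G p S h c]) auto
    finally have "?L (insert h T) \<le> ?R (insert h T)"
      using IH(2) insert.hyps by (simp add: algebra_simps)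
    moreover have "?h (insert h T) \<in> carrier (lp_module G p)"
      unfolding eq by (intro lp_add[OF p'] lp_scale d IH)
    ultimately show ?case by blast
  qed
  then show "?h T \<in> carrier (lp_module G p)" "?L T \<le> ?R T" by auto
qed

text \<open>The operators are uniformly bounded by 1, so convergence to 0 on the dense set of
  finitely supported functions carries over to every \<open>f\<close>.\<close>

lemma lp_comb_tendsto_0:
  assumes G: "Group.group G" and p: "1 < p" and f: "f \<in> carrier (lp_module G p)"
    and S: "\<And>N::nat. finite (S N)" "\<And>N. S N \<subseteq> carrier G"
    and c: "\<And>N g. g \<in> S N \<Longrightarrow> cmod (c N g) \<le> 1 / real N" "\<And>N. (\<Sum>g\<in>S N. cmod (c N g)) \<le> 1"
  shows "(\<lambda>N. lp_norm G p (lp_comb G (c N) (S N) f)) \<longlonglongrightarrow> 0"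
proof (rule tendstoI)
  fix e :: real assume e: "0 < e"
  have p': "1 \<le> p" using p by simp
  obtain T where T: "finite T" "T \<subseteq> carrier G" "(\<lambda>x. if x \<in> T then 0 else f x) \<in> carrier (lp_module G p)"
    "lp_norm G p (\<lambda>x. if x \<in> T then 0 else f x) < e / 2" (is "lp_norm G p ?r < _")
    using lp_tail[OF p' f, of "e / 2"] e by auto
  let ?h = "\<lambda>x. if x \<in> T then f x else 0"
  let ?K = "\<Sum>h\<in>T. cmod (f h)"
  \<comment> \<open>The tail costs less than \<open>e / 2\<close> for all \<open>N\<close> at once
    because the total mass of the weights is at most 1; only the estimate of the finite head depends
    on \<open>N\<close>.\<close>
  have bound: "lp_norm G p (lp_comb G (c N) (S N) f) < ?K * ((1 / real N) powr (p - 1)) powr (1 / p) + e / 2" for N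
  proof -
    have feq: "f = (\<lambda>x. ?h x + ?r x)" by auto
    note h = lp_comb_finite_bound[OF G p S(1,2)[of N] c(1)[of _ N] c(2)[of N] T(1,2), where f = f]
    have "lp_norm G p (lp_comb G (c N) (S N) f) \<le>
        lp_norm G p (lp_comb G (c N) (S N) ?h) + lp_norm G p (lp_comb G (c N) (S N) ?r)"
      by (subst feq, subst lp_comb_add)
        (intro lp_norm_triangle[OF p'] lp_comb_bound[OF G p'] h(1) T(3) S)
    also have "lp_norm G p (lp_comb G (c N) (S N) ?h) \<le> ?K * ((1 / real N) powr (p - 1)) powr (1 / p)"
      by (rule h(2))
    also have "lp_norm G p (lp_comb G (c N) (S N) ?r) \<le> (\<Sum>g\<in>S N. cmod (c N g)) * lp_norm G p ?r"
      by (rule lp_comb_bound(2)[OF G p' T(3) S])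
    also have "\<dots> \<le> 1 * lp_norm G p ?r"
      by (intro mult_right_mono c lp_norm_nonneg)
    finally show ?thesis using T(4) by simp
  qed
  have "((\<lambda>N. ?K * ((1 / real N) powr (p - 1)) powr (1 / p)) \<longlongrightarrow> ?K * 0) sequentially"
  proof (intro tendsto_mult_left)
    \<comment> \<open>The two powers merge into the exponent \<open>(p - 1) / p\<close>; it is
      positive since \<open>p > 1\<close>, so the limit is 0.\<close>
    have "(\<lambda>N. (1 / real N) powr ((p - 1) * (1 / p))) \<longlonglongrightarrow> 0 powr ((p - 1) * (1 / p))"
      using p by (intro tendsto_powr' lim_1_over_n tendsto_const) auto
    then show "(\<lambda>N. ((1 / real N) powr (p - 1)) powr (1 / p)) \<longlonglongrightarrow> 0"
      by (simp add: powr_powr)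
  qed
  then have "\<forall>\<^sub>F N in sequentially. ?K * ((1 / real N) powr (p - 1)) powr (1 / p) < e / 2"
    using e by (intro order_tendstoD(2)) auto
  then show "\<forall>\<^sub>F N in sequentially. dist (lp_norm G p (lp_comb G (c N) (S N) f)) 0 < e"
  proof eventually_elim
    case (elim N)
    with bound[of N] show ?case by (simp add: lp_norm_nonneg)
  qed
qed

text \<open>For \<open>N = 0\<close> the average is the zero function and not a mean of anything;
  the approximations below therefore start from \<open>Suc N\<close>.\<close>

definition lp_average ::
    "('g, 'b) monoid_scheme \<Rightarrow> (nat \<Rightarrow> 'g set) \<Rightarrow> nat \<Rightarrow> ('g \<Rightarrow> complex) \<Rightarrow> 'g \<Rightarrow> complex"
  where "lp_average G C N f x = (if x \<in> carrier G
    then \<Sum>k<N. 1 / (of_nat N * of_nat (card (C k))) * (\<Sum>g\<in>C k. f (inv\<^bsub>G\<^esub> g \<otimes>\<^bsub>G\<^esub> x)) else 0)"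

lemma lp_average_tendsto_0:
  fixes C :: "nat \<Rightarrow> 'g set"
  assumes G: "Group.group G" and p: "1 < p" and f: "f \<in> carrier (lp_module G p)"
    and C: "\<And>k. finite (C k)" "\<And>k. C k \<subseteq> carrier G" "\<And>k. C k \<noteq> {}" "disjoint_family C"
  shows "(\<lambda>N. lp_norm G p (lp_average G C N f)) \<longlonglongrightarrow> 0"
proof -
  define r where "r N k = 1 / (real N * real (card (C k)))" for N k
  \<comment> \<open>Summing over all \<open>k\<close> with \<open>g\<close> in \<open>C k\<close>
    makes the exchange of sums in \<open>sum_c\<close> purely formal. Disjointness enters only in
    the pointwise bound \<open>c1\<close>, where a single class contributes.\<close>
  define c where "c N g = (\<Sum>k<N. if g \<in> C k then r N k else 0)" for N g
  let ?S = "\<lambda>N. \<Union>k<N. C k"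
  have sum_c: "(\<Sum>g\<in>?S N. of_real (c N g) * \<phi> g) = (\<Sum>k<N. of_real (r N k) * (\<Sum>g\<in>C k. \<phi> g))"
    for N and \<phi> :: "'g \<Rightarrow> complex"
  proof -
    have "(\<Sum>g\<in>?S N. of_real (c N g) * \<phi> g) = (\<Sum>g\<in>?S N. \<Sum>k<N. if g \<in> C k then of_real (r N k) * \<phi> g else 0)"
      by (auto simp: c_def sum_distrib_right intro!: sum.cong)
    also have "\<dots> = (\<Sum>k<N. \<Sum>g\<in>?S N. if g \<in> C k then of_real (r N k) * \<phi> g else 0)"
      by (rule sum.swap)
    also have "\<dots> = (\<Sum>k<N. \<Sum>g\<in>C k. of_real (r N k) * \<phi> g)"
    proof (rule sum.cong[OF refl])
      fix k assume "k \<in> {..<N}"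
      then have "?S N \<inter> C k = C k" by auto
      then show "(\<Sum>g\<in>?S N. if g \<in> C k then of_real (r N k) * \<phi> g else 0) = (\<Sum>g\<in>C k. of_real (r N k) * \<phi> g)"
        using C(1) by (subst sum.inter_restrict[symmetric]) auto
    qed
    finally show ?thesis by (simp add: sum_distrib_left)
  qed
  have c0: "0 \<le> c N g" for N g by (auto simp: c_def r_def intro!: sum_nonneg)
  have norm_c: "(\<Sum>g\<in>?S N. cmod (of_real (c N g))) \<le> 1" for N
  proof -
    \<comment> \<open>The constant function 1 in \<open>sum_c\<close> computes the total mass: each
      of the \<open>N\<close> classes contributes \<open>1 / N\<close>, and the empty average has
      mass 0.\<close>
    have "complex_of_real (\<Sum>g\<in>?S N. c N g) = (\<Sum>k<N. of_real (r N k) * of_nat (card (C k)))"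
      using sum_c[of N "\<lambda>_. 1"] by simp
    also have "\<dots> = (\<Sum>k<N. of_real (1 / real N))"
      using C(1,3) by (intro sum.cong) (auto simp: r_def)
    also have "\<dots> = (if N = 0 then 0 else 1)" by simp
    finally have "(\<Sum>g\<in>?S N. c N g) = (if N = 0 then 0 else 1)"
      by (metis of_real_0 of_real_1 of_real_eq_iff)
    then show ?thesis using c0 by simp
  qed
  have c1: "cmod (of_real (c N g)) \<le> 1 / real N" if "g \<in> ?S N" for N g
  proof -
    from that obtain k where k: "k < N" "g \<in> C k" by auto
    have "c N g = (\<Sum>l<N. if l = k then r N k else 0)"
      unfolding c_def using k C(4) by (intro sum.cong) (auto simp: disjoint_family_on_def)
    also have "\<dots> = r N k" using k(1) by simp
    also have "\<dots> \<le> 1 / real N"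
    proof -
      have "1 \<le> card (C k)" using C(1,3)[of k] by (simp add: Suc_le_eq card_gt_0_iff)
      then show ?thesis using k(1) by (auto simp: r_def intro!: divide_left_mono)
    qed
    finally show ?thesis using c0[of N g] by simp
  qed
  have "(\<lambda>N. lp_norm G p (lp_comb G (\<lambda>g. of_real (c N g)) (?S N) f)) \<longlonglongrightarrow> 0"
    by (rule lp_comb_tendsto_0[OF G p f _ _ c1 norm_c]) (use C in auto)
  moreover have "lp_comb G (\<lambda>g. of_real (c N g)) (?S N) f = lp_average G C N f" for N
    unfolding lp_comb_def[abs_def] lp_average_def[abs_def] sum_c by (simp add: r_def cong: if_cong)
  ultimately show ?thesis by simp
qed

section \<open>Tensor products over the group ring\<close>

text \<open>The quotient map on formal sums. Calculations below take place on representatives modulo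
  the relations, and cosets appear only where the given definitions speak of them.\<close>

definition tensor_class ::
    "('g, 'b) monoid_scheme \<Rightarrow> ('g \<Rightarrow>\<^sub>0 int, 'm, 'x) module_scheme \<Rightarrow>
      ('g \<Rightarrow>\<^sub>0 int, 'n, 'y) module_scheme \<Rightarrow> ('m \<times> 'n \<Rightarrow>\<^sub>0 int) \<Rightarrow> ('m \<times> 'n \<Rightarrow>\<^sub>0 int) set"
  where "tensor_class G M N c =
    tensor_subgroup G M N #>\<^bsub>free_Abelian_group (carrier M \<times> carrier N)\<^esub> c"

lemma elem_tensor_eq: "elem_tensor G M N x y = tensor_class G M N (frag_of (x, y))"
  by (simp add: elem_tensor_def tensor_class_def)

text \<open>The map induced by \<open>h\<close> before passing to the quotient by the tensor
  relations.\<close>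

definition push :: "('m \<Rightarrow> 'k) \<Rightarrow> ('m \<times> 'n \<Rightarrow>\<^sub>0 int) \<Rightarrow> ('k \<times> 'n \<Rightarrow>\<^sub>0 int)"
  where "push h = frag_extend (\<lambda>(x, y). frag_of (h x, y))"

lemma push_simps [simp]:
  "push h 0 = 0" "push h (frag_of (x, y)) = frag_of (h x, y)"
  "push h (a + b) = push h a + push h b" "push h (a - b) = push h a - push h b"
  "push h (- a) = - push h a"
  by (simp_all add: push_def frag_extend_add frag_extend_diff frag_extend_minus)

lemma push_sum [simp]: "push h (\<Sum>i\<in>I. a i) = (\<Sum>i\<in>I. push h (a i))"
  by (induction I rule: infinite_finite_induct) auto

lemma keys_push:
  "Poly_Mapping.keys c \<subseteq> A \<times> B \<Longrightarrow> h \<in> A \<rightarrow> A' \<Longrightarrow> Poly_Mapping.keys (push h c) \<subseteq> A' \<times> B"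
  unfolding push_def by (rule order_trans[OF keys_frag_extend]) auto

lemma lin_ext_push: "lin_ext \<phi> (push h c) = lin_ext (\<lambda>(x, y). \<phi> (h x, y)) c"
  using subset_UNIV by (induction c rule: frag_induction) auto

locale tensor_modules =
  fixes G :: "('g, 'b) monoid_scheme" and M :: "('g \<Rightarrow>\<^sub>0 int, 'm, 'x) module_scheme"
    and N :: "('g \<Rightarrow>\<^sub>0 int, 'n, 'y) module_scheme"
  assumes group_G: "Group.group G"
    and module_M: "left_module (group_ring G) M" and module_N: "left_module (group_ring G) N"
begin

sublocale G: Group.group G by (rule group_G)
sublocale M: left_module "group_ring G" M by (rule module_M)
sublocale N: left_module "group_ring G" N by (rule module_N)

abbreviation "A \<equiv> free_Abelian_group (carrier M \<times> carrier N)"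
abbreviation "T \<equiv> tensor_subgroup G M N"

lemma tensor_relations_subset: "tensor_relations G M N \<subseteq> carrier A"
  unfolding tensor_relations_def
  by (auto dest!: subsetD[OF keys_diff] intro!: M.smult_closed G.group_ring_star_closed)

lemma subgroup_T: "subgroup T A"
  unfolding tensor_subgroup_def
  by (rule group.generate_is_subgroup[OF group_free_Abelian_group tensor_relations_subset])

section \<open>Calculus of formal sums modulo the tensor relations\<close>

lemma T_keys: "c \<in> T \<Longrightarrow> Poly_Mapping.keys c \<subseteq> carrier M \<times> carrier N"
  using subgroup.mem_carrier[OF subgroup_T, of c] by simp

lemma T_zero: "0 \<in> T"
  using subgroup.one_closed[OF subgroup_T] by simp

lemma T_add: "a \<in> T \<Longrightarrow> b \<in> T \<Longrightarrow> a + b \<in> T"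
  using subgroup.m_closed[OF subgroup_T] by simp

lemma T_minus: "a \<in> T \<Longrightarrow> - a \<in> T"
  using subgroup.m_inv_closed[OF subgroup_T] T_keys by fastforce

lemma T_diff: "a \<in> T \<Longrightarrow> b \<in> T \<Longrightarrow> a - b \<in> T"
  using T_add[OF _ T_minus, of a b] by simp

lemma T_trans: "a - b \<in> T \<Longrightarrow> b - c \<in> T \<Longrightarrow> a - c \<in> T"
  using T_add[of "a - b" "b - c"] by simp

lemma T_sym: "a - b \<in> T \<Longrightarrow> b - a \<in> T"
  using T_minus[of "a - b"] by simp

lemma T_sum: "(\<And>i. i \<in> I \<Longrightarrow> a i \<in> T) \<Longrightarrow> (\<Sum>i\<in>I. a i) \<in> T"
  by (induction I rule: infinite_finite_induct) (auto intro: T_zero T_add)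

lemma T_sum_diff: "(\<And>i. i \<in> I \<Longrightarrow> a i - b i \<in> T) \<Longrightarrow> (\<Sum>i\<in>I. a i) - (\<Sum>i\<in>I. b i) \<in> T"
  unfolding sum_subtractf[symmetric] by (rule T_sum)

lemma T_induct [consumes 1, case_names zero rel minus add]:
  assumes "c \<in> T" "P 0" "\<And>c. c \<in> tensor_relations G M N \<Longrightarrow> P c"
    "\<And>c. c \<in> tensor_relations G M N \<Longrightarrow> P (- c)" "\<And>a b. P a \<Longrightarrow> P b \<Longrightarrow> P (a + b)"
  shows "P c"
  using assms(1) unfolding tensor_subgroup_def
proof (induction rule: generate.induct)
  case (inv h)
  then have "h \<in> carrier A" using tensor_relations_subset by blast
  then have "inv\<^bsub>A\<^esub> h = - h" by simp
  then show ?case using assms(4)[OF inv] by simp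
qed (use assms in auto)

lemma T_add_left:
  assumes "x \<in> carrier M" "x' \<in> carrier M" "y \<in> carrier N"
  shows "frag_of (x \<oplus>\<^bsub>M\<^esub> x', y) - (frag_of (x, y) + frag_of (x', y)) \<in> T"
proof -
  have "frag_of (x \<oplus>\<^bsub>M\<^esub> x', y) - frag_of (x, y) - frag_of (x', y) \<in> T"
    unfolding tensor_subgroup_def
    by (rule generate.incl) (use assms in \<open>auto simp: tensor_relations_def\<close>)
  then show ?thesis by (simp add: algebra_simps)
qed

lemma T_add_right:
  assumes "x \<in> carrier M" "y \<in> carrier N" "y' \<in> carrier N"
  shows "frag_of (x, y \<oplus>\<^bsub>N\<^esub> y') - (frag_of (x, y) + frag_of (x, y')) \<in> T"
proof -
  have "frag_of (x, y \<oplus>\<^bsub>N\<^esub> y') - frag_of (x, y) - frag_of (x, y') \<in> T"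
    unfolding tensor_subgroup_def
    by (rule generate.incl) (use assms in \<open>auto simp: tensor_relations_def\<close>)
  then show ?thesis by (simp add: algebra_simps)
qed

lemma T_balanced:
  assumes "a \<in> carrier (group_ring G)" "x \<in> carrier M" "y \<in> carrier N"
  shows "frag_of (group_ring_star G a \<odot>\<^bsub>M\<^esub> x, y) - frag_of (x, a \<odot>\<^bsub>N\<^esub> y) \<in> T"
  unfolding tensor_subgroup_def
  by (rule generate.incl) (use assms in \<open>auto simp: tensor_relations_def\<close>)

lemma T_zero_left: "y \<in> carrier N \<Longrightarrow> frag_of (\<zero>\<^bsub>M\<^esub>, y) \<in> T"
  using T_minus[OF T_add_left[of "\<zero>\<^bsub>M\<^esub>" "\<zero>\<^bsub>M\<^esub>" y]] by simp

lemma T_zero_right: "x \<in> carrier M \<Longrightarrow> frag_of (x, \<zero>\<^bsub>N\<^esub>) \<in> T"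
  using T_minus[OF T_add_right[of x "\<zero>\<^bsub>N\<^esub>" "\<zero>\<^bsub>N\<^esub>"]] by simp

lemma T_minus_left:
  assumes "x \<in> carrier M" "y \<in> carrier N"
  shows "frag_of (\<ominus>\<^bsub>M\<^esub> x, y) + frag_of (x, y) \<in> T"
  using T_diff[OF T_zero_left[OF assms(2)] T_add_left[of "\<ominus>\<^bsub>M\<^esub> x" x y]] assms by (simp add: M.l_neg add.commute)

lemma T_finsum_left:
  assumes "finite K" "\<And>k. k \<in> K \<Longrightarrow> u k \<in> carrier M" "y \<in> carrier N"
  shows "frag_of (\<Oplus>\<^bsub>M\<^esub>k\<in>K. u k, y) - (\<Sum>k\<in>K. frag_of (u k, y)) \<in> T"
  using assms(1,2)
proof (induction K rule: finite_induct)
  case empty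
  then show ?case using T_zero_left[OF assms(3)] by simp
next
  case (insert k K)
  have "frag_of (u k \<oplus>\<^bsub>M\<^esub> (\<Oplus>\<^bsub>M\<^esub>k\<in>K. u k), y)
      - (frag_of (u k, y) + frag_of (\<Oplus>\<^bsub>M\<^esub>k\<in>K. u k, y)) \<in> T"
    using insert assms(3) by (intro T_add_left M.finsum_closed) auto
  moreover have "(frag_of (u k, y) + frag_of (\<Oplus>\<^bsub>M\<^esub>k\<in>K. u k, y)) - (frag_of (u k, y) + (\<Sum>k\<in>K. frag_of (u k, y))) \<in> T"
    using insert by simp
  ultimately have "frag_of (u k \<oplus>\<^bsub>M\<^esub> (\<Oplus>\<^bsub>M\<^esub>k\<in>K. u k), y) - (frag_of (u k, y) + (\<Sum>k\<in>K. frag_of (u k, y))) \<in> T"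
    by (rule T_trans)
  with insert.prems insert.hyps show ?case
    by (subst M.finsum_insert) auto
qed

lemma T_finsum_right:
  assumes "finite K" "\<And>k. k \<in> K \<Longrightarrow> v k \<in> carrier N" "x \<in> carrier M"
  shows "frag_of (x, \<Oplus>\<^bsub>N\<^esub>k\<in>K. v k) - (\<Sum>k\<in>K. frag_of (x, v k)) \<in> T"
  using assms(1,2)
proof (induction K rule: finite_induct)
  case empty
  then show ?case using T_zero_right[OF assms(3)] by simp
next
  case (insert k K)
  have "frag_of (x, v k \<oplus>\<^bsub>N\<^esub> (\<Oplus>\<^bsub>N\<^esub>k\<in>K. v k))
      - (frag_of (x, v k) + frag_of (x, \<Oplus>\<^bsub>N\<^esub>k\<in>K. v k)) \<in> T"
    using insert assms(3) by (intro T_add_right N.finsum_closed) auto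
  moreover have "(frag_of (x, v k) + frag_of (x, \<Oplus>\<^bsub>N\<^esub>k\<in>K. v k)) - (frag_of (x, v k) + (\<Sum>k\<in>K. frag_of (x, v k))) \<in> T"
    using insert by simp
  ultimately have "frag_of (x, v k \<oplus>\<^bsub>N\<^esub> (\<Oplus>\<^bsub>N\<^esub>k\<in>K. v k)) - (frag_of (x, v k) + (\<Sum>k\<in>K. frag_of (x, v k))) \<in> T"
    by (rule T_trans)
  with insert.prems insert.hyps show ?case
    by (subst N.finsum_insert) auto
qed

text \<open>Signs are absorbed into left factors, so every tensor is a sum of pure tensors without
  integer coefficients. This is the shape of the test families in
  \<open>lp_tensor_open\<close>.\<close>

lemma tensor_representation:
  assumes "Poly_Mapping.keys c \<subseteq> carrier M \<times> carrier N"
  shows "\<exists>(m::nat) x f. x \<in> {..<m} \<rightarrow> carrier M \<and> f \<in> {..<m} \<rightarrow> carrier N \<and>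
    c - (\<Sum>j<m. frag_of (x j, f j)) \<in> T"
  using assms
proof (induction c rule: frag_induction)
  case zero
  show ?case by (rule exI[of _ 0]) (simp add: T_zero)
next
  case (one z)
  obtain x y where z: "z = (x, y)" "x \<in> carrier M" "y \<in> carrier N" using one by auto
  have "(\<lambda>_. x) \<in> {..<1::nat} \<rightarrow> carrier M" "(\<lambda>_. y) \<in> {..<1::nat} \<rightarrow> carrier N"
    "frag_of z - (\<Sum>j<1::nat. frag_of (x, y)) \<in> T"
    using z by (simp_all add: T_zero)
  then show ?case by blast
next
  case (diff a b)
  then obtain m n :: nat and x x' f f'
    where a: "x \<in> {..<m} \<rightarrow> carrier M" "f \<in> {..<m} \<rightarrow> carrier N" "a - (\<Sum>j<m. frag_of (x j, f j)) \<in> T"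
    and b: "x' \<in> {..<n} \<rightarrow> carrier M" "f' \<in> {..<n} \<rightarrow> carrier N" "b - (\<Sum>j<n. frag_of (x' j, f' j)) \<in> T"
    by blast
  \<comment> \<open>The second family is negated in its left factor and appended after the first
    \<open>m\<close> terms.\<close>
  define u where "u j = (if j < m then x j else \<ominus>\<^bsub>M\<^esub> x' (j - m))" for j
  define v where "v j = (if j < m then f j else f' (j - m))" for j
  have split: "(\<Sum>j<m + k. frag_of (u j, v j)) =
      (\<Sum>j<m. frag_of (x j, f j)) + (\<Sum>j<k. frag_of (\<ominus>\<^bsub>M\<^esub> x' j, f' j))" for k
    by (induction k) (auto simp: u_def v_def add.assoc)
  have "- (\<Sum>j<n. frag_of (\<ominus>\<^bsub>M\<^esub> x' j, f' j) + frag_of (x' j, f' j)) \<in> T"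
    using b(1,2) by (intro T_minus T_sum T_minus_left) auto
  from T_add[OF T_diff[OF a(3) b(3)] this]
  have "a - b - (\<Sum>j<m + n. frag_of (u j, v j)) \<in> T"
    unfolding split by (simp add: sum.distrib algebra_simps)
  moreover have "u \<in> {..<m + n} \<rightarrow> carrier M" "v \<in> {..<m + n} \<rightarrow> carrier N"
    using a b by (auto simp: u_def v_def Pi_iff)
  ultimately show ?case by blast
qed

section \<open>Passage from formal sums to the quotient group\<close>

lemma tensor_class_eq_iff:
  assumes "Poly_Mapping.keys c \<subseteq> carrier M \<times> carrier N" "Poly_Mapping.keys c' \<subseteq> carrier M \<times> carrier N"
  shows "tensor_class G M N c = tensor_class G M N c' \<longleftrightarrow> c - c' \<in> T"
proof
  assume "tensor_class G M N c = tensor_class G M N c'"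
  moreover have "c \<in> tensor_class G M N c"
    using T_zero by (force simp: tensor_class_def r_coset_def)
  ultimately obtain t where "t \<in> T" "c = t + c'"
    by (auto simp: tensor_class_def r_coset_def)
  then show "c - c' \<in> T" by simp
next
  assume d: "c - c' \<in> T"
  have "\<exists>t'\<in>T. t + c = t' + c'" if "t \<in> T" for t
    using T_add[OF that d] by (intro bexI[of _ "t + (c - c')"]) auto
  moreover have "\<exists>t'\<in>T. t + c' = t' + c" if "t \<in> T" for t
    using T_diff[OF that d] by (intro bexI[of _ "t - (c - c')"]) auto
  ultimately show "tensor_class G M N c = tensor_class G M N c'"
    by (auto simp: tensor_class_def r_coset_def)
qed

lemma mem_tensor_classD: "c' \<in> tensor_class G M N c \<Longrightarrow> c' - c \<in> T"
  by (auto simp: tensor_class_def r_coset_def)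

lemma mem_tensor_class: "c \<in> tensor_class G M N c"
  using T_zero by (force simp: tensor_class_def r_coset_def)

lemma normal_T: "T \<lhd> A"
  using comm_group.normal_iff_subgroup[OF abelian_free_Abelian_group] subgroup_T by blast

lemma comm_group_tensor: "comm_group (tensor_product G M N)"
  unfolding tensor_product_def
  by (rule comm_group.abelian_FactGroup[OF abelian_free_Abelian_group subgroup_T])

lemma carrier_tensor:
  "carrier (tensor_product G M N) = tensor_class G M N ` {c. Poly_Mapping.keys c \<subseteq> carrier M \<times> carrier N}"
  by (auto simp: tensor_product_def FactGroup_def RCOSETS_def tensor_class_def)

lemma tensor_class_closed:
  "Poly_Mapping.keys c \<subseteq> carrier M \<times> carrier N \<Longrightarrow> tensor_class G M N c \<in> carrier (tensor_product G M N)"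
  by (simp add: carrier_tensor)

lemma tensor_class_mult:
  assumes "Poly_Mapping.keys c \<subseteq> carrier M \<times> carrier N" "Poly_Mapping.keys c' \<subseteq> carrier M \<times> carrier N"
  shows "tensor_class G M N c \<otimes>\<^bsub>tensor_product G M N\<^esub> tensor_class G M N c' = tensor_class G M N (c + c')"
  using normal.rcos_sum[OF normal_T, of c c'] assms
  by (simp add: tensor_product_def FactGroup_def tensor_class_def)

lemma tensor_class_zero: "\<one>\<^bsub>tensor_product G M N\<^esub> = tensor_class G M N 0"
  by (auto simp: tensor_product_def FactGroup_def tensor_class_def r_coset_def)

lemma tensor_class_sum:
  assumes "finite J" "\<And>j. j \<in> J \<Longrightarrow> Poly_Mapping.keys (c j) \<subseteq> carrier M \<times> carrier N"
  shows "(\<Otimes>\<^bsub>tensor_product G M N\<^esub>j\<in>J. tensor_class G M N (c j)) = tensor_class G M N (\<Sum>j\<in>J. c j)"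
proof -
  interpret TP: comm_group "tensor_product G M N" by (rule comm_group_tensor)
  from assms show ?thesis
  proof (induction J rule: finite_induct)
    case (insert j J)
    have "Poly_Mapping.keys (\<Sum>j\<in>J. c j) \<subseteq> carrier M \<times> carrier N"
      using insert.prems by (intro order_trans[OF Poly_Mapping.keys_sum]) auto
    with insert show ?case
      by (subst TP.finprod_insert) (auto simp: tensor_class_mult intro!: tensor_class_closed)
  qed (simp add: tensor_class_zero)
qed

text \<open>The universal property for complex values: a balanced biadditive \<open>\<phi>\<close>
  kills each generating relation, hence the subgroup they generate.\<close>

lemma lin_ext_T:
  assumes "c \<in> T"
    and "\<And>x x' y. x \<in> carrier M \<Longrightarrow> x' \<in> carrier M \<Longrightarrow> y \<in> carrier N \<Longrightarrow>
      \<phi> (x \<oplus>\<^bsub>M\<^esub> x', y) = \<phi> (x, y) + \<phi> (x', y)"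
    and "\<And>x y y'. x \<in> carrier M \<Longrightarrow> y \<in> carrier N \<Longrightarrow> y' \<in> carrier N \<Longrightarrow>
      \<phi> (x, y \<oplus>\<^bsub>N\<^esub> y') = \<phi> (x, y) + \<phi> (x, y')"
    and "\<And>a x y. a \<in> carrier (group_ring G) \<Longrightarrow> x \<in> carrier M \<Longrightarrow> y \<in> carrier N \<Longrightarrow>
      \<phi> (group_ring_star G a \<odot>\<^bsub>M\<^esub> x, y) = \<phi> (x, a \<odot>\<^bsub>N\<^esub> y)"
  shows "lin_ext \<phi> c = 0"
proof -
  have "lin_ext \<phi> c = 0" if "c \<in> tensor_relations G M N" for c
    using that assms(2-4) unfolding tensor_relations_def by auto
  with assms(1) show ?thesis by (induction rule: T_induct) auto
qed

end

locale tensor_hom = tensor_modules G M N + M': tensor_modules G M' N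
  for G :: "('g, 'b) monoid_scheme" and M :: "('g \<Rightarrow>\<^sub>0 int, 'm, 'x) module_scheme"
    and M' :: "('g \<Rightarrow>\<^sub>0 int, 'k, 'z) module_scheme" and N :: "('g \<Rightarrow>\<^sub>0 int, 'n, 'y) module_scheme" +
  fixes h :: "'m \<Rightarrow> 'k"
  assumes h: "h \<in> mod_hom (group_ring G) M M'"
begin

lemma push_keys:
  "Poly_Mapping.keys c \<subseteq> carrier M \<times> carrier N \<Longrightarrow> Poly_Mapping.keys (push h c) \<subseteq> carrier M' \<times> carrier N"
  by (erule keys_push) (use mod_hom_closed[OF h] in auto)

lemma push_T:
  assumes "c \<in> tensor_subgroup G M N"
  shows "push h c \<in> tensor_subgroup G M' N"
proof -
  have "push h c \<in> tensor_subgroup G M' N" if "c \<in> tensor_relations G M N" for c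
    using that unfolding tensor_relations_def
  proof (elim UnE CollectE exE conjE)
    fix x x' y
    assume c: "c = frag_of (x \<oplus>\<^bsub>M\<^esub> x', y) - frag_of (x, y) - frag_of (x', y)"
      and "x \<in> carrier M" "x' \<in> carrier M" "y \<in> carrier N"
    then show ?thesis
      unfolding c using M'.T_add_left[of "h x" "h x'" y] mod_hom_closed[OF h]
      by (simp add: mod_hom_add[OF h] algebra_simps)
  next
    fix x y y'
    assume c: "c = frag_of (x, y \<oplus>\<^bsub>N\<^esub> y') - frag_of (x, y) - frag_of (x, y')"
      and "x \<in> carrier M" "y \<in> carrier N" "y' \<in> carrier N"
    then show ?thesis
      unfolding c using M'.T_add_right[of "h x" y y'] mod_hom_closed[OF h]
      by (simp add: algebra_simps)
  next
    fix a x y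
    assume c: "c = frag_of (group_ring_star G a \<odot>\<^bsub>M\<^esub> x, y) - frag_of (x, a \<odot>\<^bsub>N\<^esub> y)"
      and "a \<in> carrier (group_ring G)" "x \<in> carrier M" "y \<in> carrier N"
    then show ?thesis
      unfolding c using M'.T_balanced[of a "h x" y] mod_hom_closed[OF h]
      by (simp add: mod_hom_smult[OF h] G.group_ring_star_closed)
  qed
  with assms show ?thesis
    by (induction rule: T_induct) (auto intro: M'.T_zero M'.T_minus M'.T_add)
qed

text \<open>\<open>tensor_map\<close> takes \<open>the_elem\<close> of the image of a coset. Since
  \<open>push h\<close> preserves relations, this image is a singleton and can be computed on any
  representative.\<close>

lemma tensor_map_class:
  assumes c: "Poly_Mapping.keys c \<subseteq> carrier M \<times> carrier N"
  shows "tensor_map G M M' N h (tensor_class G M N c) = tensor_class G M' N (push h c)"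
proof -
  have "tensor_class G M' N (push h c') = tensor_class G M' N (push h c)"
    if "c' \<in> tensor_class G M N c" for c'
  proof -
    have "c' - c \<in> tensor_subgroup G M N" using mem_tensor_classD[OF that] .
    moreover from this have "Poly_Mapping.keys c' \<subseteq> carrier M \<times> carrier N"
      using T_keys[of "c' - c"] c keys_add[of "c' - c" c] by auto
    ultimately show ?thesis
      using push_T[of "c' - c"] c by (simp add: M'.tensor_class_eq_iff push_keys)
  qed
  then have "(\<lambda>c'. tensor_class G M' N (push h c')) ` tensor_class G M N c =
      (\<lambda>_. tensor_class G M' N (push h c)) ` tensor_class G M N c"
    by (intro image_cong refl)
  also have "\<dots> = {tensor_class G M' N (push h c)}"
    using mem_tensor_class by (rule image_constant)
  finally show ?thesis
    by (simp add: tensor_map_def push_def tensor_class_def)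
qed

lemma tensor_map_hom: "tensor_map G M M' N h \<in> hom (tensor_product G M N) (tensor_product G M' N)"
proof (rule homI)
  fix a assume "a \<in> carrier (tensor_product G M N)"
  then show "tensor_map G M M' N h a \<in> carrier (tensor_product G M' N)"
    by (auto simp: carrier_tensor tensor_map_class intro!: M'.tensor_class_closed push_keys)
next
  fix a b assume "a \<in> carrier (tensor_product G M N)" "b \<in> carrier (tensor_product G M N)"
  then obtain c c' where c: "Poly_Mapping.keys c \<subseteq> carrier M \<times> carrier N" "a = tensor_class G M N c"
    and c': "Poly_Mapping.keys c' \<subseteq> carrier M \<times> carrier N" "b = tensor_class G M N c'"
    by (auto simp: carrier_tensor)
  have "Poly_Mapping.keys (c + c') \<subseteq> carrier M \<times> carrier N"
    using c c' keys_add[of c c'] by auto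
  with c c' show "tensor_map G M M' N h (a \<otimes>\<^bsub>tensor_product G M N\<^esub> b) =
      tensor_map G M M' N h a \<otimes>\<^bsub>tensor_product G M' N\<^esub> tensor_map G M M' N h b"
    by (simp add: tensor_class_mult tensor_map_class M'.tensor_class_mult push_keys)
qed

end

section \<open>Topologies and averages on \<open>l\<^sup>p(G)\<close>\<close>

lemma trivial_group_Mod_carrier:
  assumes "Group.group H"
  shows "trivial_group (H Mod carrier H)"
proof -
  interpret H: Group.group H by fact
  have "carrier H \<lhd> H"
    by (simp add: H.normal_inv_iff H.subgroup_self)
  moreover have "carrier H #>\<^bsub>H\<^esub> a = carrier H" if "a \<in> carrier H" for a
    using that by (simp add: H.coset_join2 H.subgroup_self)
  then have "carrier (H Mod carrier H) = {carrier H}"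
    using H.one_closed by (auto simp: carrier_FactGroup)
  ultimately show ?thesis
    using normal.factorgroup_is_group by (auto simp: trivial_group_def)
qed

text \<open>Reduced homology and cohomology take this form once the closure of the (co)boundaries is
  known to be all (co)cycles.\<close>

lemma trivial_group_subgroup_Mod_self:
  assumes "Group.group H" "subgroup K H"
  shows "trivial_group (H\<lparr>carrier := K\<rparr> Mod K)"
  using trivial_group_Mod_carrier[OF subgroup.subgroup_is_group[OF assms(2,1)]] by simp

lemma lp_module_simps [simp]:
  "\<zero>\<^bsub>lp_module G p\<^esub> = (\<lambda>x. 0)" "f \<oplus>\<^bsub>lp_module G p\<^esub> h = (\<lambda>x. f x + h x)"
  by (simp_all add: lp_module_def)

lemma lp_apply_outside: "f \<in> carrier (lp_module G p) \<Longrightarrow> x \<notin> carrier G \<Longrightarrow> f x = 0"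
  by (simp add: lp_module_def)

lemma lp_lincomb:
  assumes "1 \<le> p" "\<And>j. j \<in> J \<Longrightarrow> v j \<in> carrier (lp_module G p)"
  shows "(\<lambda>x. \<Sum>j\<in>J. c j * v j x) \<in> carrier (lp_module G p)"
  using assms(2)
proof (induction J rule: infinite_finite_induct)
  case (insert j J)
  then show ?case
    using lp_add[OF assms(1) lp_scale[of "v j" G p "c j"], of "\<lambda>x. \<Sum>j\<in>J. c j * v j x"] by simp
qed (simp_all add: lp_zero)

lemma lin_ext_lincomb:
  "lin_ext (\<lambda>k. \<Sum>j\<in>J. c j * \<phi> j k) a = (\<Sum>j\<in>J. c j * lin_ext (\<phi> j) a)"
proof -
  have "lin_ext (\<lambda>k. \<Sum>j\<in>J. c j * \<phi> j k) a =
      (\<Sum>k\<in>Poly_Mapping.keys a. \<Sum>j\<in>J. c j * (of_int (Poly_Mapping.lookup a k) * \<phi> j k))"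
    by (simp add: lin_ext_def sum_distrib_left algebra_simps)
  also have "\<dots> = (\<Sum>j\<in>J. \<Sum>k\<in>Poly_Mapping.keys a. c j * (of_int (Poly_Mapping.lookup a k) * \<phi> j k))"
    by (rule sum.swap)
  finally show ?thesis by (simp add: lin_ext_def sum_distrib_left)
qed

lemma lp_smult_lincomb:
  "(a \<odot>\<^bsub>lp_module G p\<^esub> (\<lambda>x. \<Sum>j\<in>J. c j * v j x)) = (\<lambda>x. \<Sum>j\<in>J. c j * (a \<odot>\<^bsub>lp_module G p\<^esub> v j) x)"
  by (simp add: fun_eq_iff lp_smult_apply lin_ext_lincomb)

lemma lp_smult_scale:
  "(a \<odot>\<^bsub>lp_module G p\<^esub> (\<lambda>x. c * f x)) = (\<lambda>x. c * (a \<odot>\<^bsub>lp_module G p\<^esub> f) x)"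
  using lp_smult_lincomb[where J="{()}" and c="\<lambda>_. c" and v="\<lambda>_. f"] by simp

lemma lp_finsum:
  assumes "Group.group G" "1 \<le> p" "finite J" "\<And>j. j \<in> J \<Longrightarrow> v j \<in> carrier (lp_module G p)"
  shows "(\<Oplus>\<^bsub>lp_module G p\<^esub>j\<in>J. v j) = (\<lambda>x. \<Sum>j\<in>J. v j x)"
proof -
  interpret L: left_module "group_ring G" "lp_module G p" by (rule left_module_lp[OF assms(1,2)])
  show ?thesis
    using assms(3,4)
  proof (induction J rule: finite_induct)
    case (insert j J)
    then show ?case by (subst L.M.finsum_insert) auto
  qed (simp add: L.M.finsum_empty)
qed

lemma lp_average_closed:
  assumes "Group.group G" "1 \<le> p" "f \<in> carrier (lp_module G p)"
    "\<And>k. finite (C k)" "\<And>k. C k \<subseteq> carrier G"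
  shows "lp_average G C N f \<in> carrier (lp_module G p)"
proof -
  let ?u = "\<lambda>k x. if x \<in> carrier G then \<Sum>g\<in>C k. 1 * f (inv\<^bsub>G\<^esub> g \<otimes>\<^bsub>G\<^esub> x) else 0"
  have "?u k \<in> carrier (lp_module G p)" for k
    using lp_comb_bound(1)[OF assms(1-3) assms(4,5)[of k], of "\<lambda>_. 1"] by (simp add: lp_comb_def[abs_def])
  from lp_lincomb[OF assms(2) this, where J = "{..<N}" and k1 = "\<lambda>k. k" and c = "\<lambda>k. 1 / (of_nat N * of_nat (card (C k)))"]
  show ?thesis
    by (elim back_subst[of "\<lambda>h. h \<in> carrier (lp_module G p)"]) (auto simp: fun_eq_iff lp_average_def)
qed

text \<open>Dividing by \<open>card (C k)\<close> with a minus sign turns z_k - |C_k| into 1 - z_k /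
  |C_k|. The result is a complex combination of actions of integral central elements, to which the
  null-homotopies apply.\<close>

lemma lp_average_defect:
  assumes "Group.group G" "f \<in> carrier (lp_module G p)" "0 < N"
    "\<And>k. finite (C k)" "\<And>k. C k \<subseteq> carrier G" "\<And>k. C k \<noteq> {}"
  shows "f x - lp_average G C N f x = (\<Sum>k<N. - 1 / (of_nat N * of_nat (card (C k))) *
    (conj_defect G (C k) \<odot>\<^bsub>lp_module G p\<^esub> f) x)"
proof (cases "x \<in> carrier G")
  case True
  interpret G: Group.group G by fact
  have "(\<Sum>k<N. - 1 / (of_nat N * of_nat (card (C k))) * (conj_defect G (C k) \<odot>\<^bsub>lp_module G p\<^esub> f) x) =
    (\<Sum>k<N. - 1 / (of_nat N * of_nat (card (C k))) * (\<Sum>g\<in>C k. f (inv\<^bsub>G\<^esub> g \<otimes>\<^bsub>G\<^esub> x)) + f x / of_nat N)"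
    using assms(3-6) True
    by (intro sum.cong) (auto simp: G.lp_smult_conj_defect algebra_simps)
  also have "\<dots> = - lp_average G C N f x + (\<Sum>k<N. f x / of_nat N)"
    using True by (simp add: sum.distrib lp_average_def sum_negf sum_subtractf)
  \<comment> \<open>The \<open>N\<close> equal shares of \<open>f x\<close> recombine; here
    \<open>N\<close> must be positive.\<close>
  also have "(\<Sum>k<N. f x / of_nat N) = f x" using assms(3) by simp
  finally show ?thesis by simp
next
  case False
  then show ?thesis using lp_apply_outside[OF assms(2)] by (simp add: lp_smult_apply lp_average_def)
qed

section \<open>Continuity of evaluations and convergence of the averages\<close>

lemma topspace_lp_topology: "1 \<le> p \<Longrightarrow> topspace (lp_topology G p) = carrier (lp_module G p)"
  unfolding lp_topology_def by (rule Metric_space.topspace_mtopology[OF Metric_space_lp])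

lemma continuous_map_lp_apply:
  assumes p: "1 \<le> p"
  shows "continuous_map (lp_topology G p) euclidean (\<lambda>f. f x)"
proof -
  interpret L: Metric_space "carrier (lp_module G p)" "\<lambda>f g. lp_norm G p (\<lambda>x. f x - g x)"
    by (rule Metric_space_lp[OF p])
  have "\<exists>r>0. L.mball f r \<subseteq> {f \<in> carrier (lp_module G p). f x \<in> U}"
    if U: "open U" "f \<in> carrier (lp_module G p)" "f x \<in> U" for U f
  proof -
    obtain r where r: "r > 0" "ball (f x) r \<subseteq> U"
      using openE[OF U(1,3)] by metis
    have "h x \<in> ball (f x) r" if h: "h \<in> L.mball f r" for h
    proof -
      have fh: "f \<in> carrier (lp_module G p)" "h \<in> carrier (lp_module G p)"
        "lp_norm G p (\<lambda>x. f x - h x) < r"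
        using h by auto
      have "(\<lambda>x. f x - h x) \<in> carrier (lp_module G p)"
        using lp_add[OF p fh(1) lp_scale[OF fh(2), of "-1"]] by simp
      from lp_norm_ge_apply[OF p this, of x] fh(3) show ?thesis
        by (simp add: dist_norm)
    qed
    with r show ?thesis by (intro exI[of _ r]) auto
  qed
  then show ?thesis
    unfolding continuous_map lp_topology_def L.topspace_mtopology L.openin_mtopology
    by (simp add: open_openin[symmetric])
qed

lemma limitin_lp_topology:
  assumes p: "1 \<le> p" and s: "\<And>N. s N \<in> carrier (lp_module G p)" and l: "l \<in> carrier (lp_module G p)"
    and lim: "(\<lambda>N. lp_norm G p (\<lambda>x. s N x - l x)) \<longlonglongrightarrow> 0"
  shows "limitin (lp_topology G p) s l sequentially"
proof -
  interpret L: Metric_space "carrier (lp_module G p)" "\<lambda>f g. lp_norm G p (\<lambda>x. f x - g x)"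
    by (rule Metric_space_lp[OF p])
  show ?thesis
    unfolding lp_topology_def L.limitin_metric_dist_null using s l lim by simp
qed

lemma limitin_lp_average:
  assumes G: "Group.group G" and p: "1 < p" and f: "f \<in> carrier (lp_module G p)"
    and C: "\<And>k. finite (C k)" "\<And>k. C k \<subseteq> carrier G" "\<And>k. C k \<noteq> {}" "disjoint_family C"
  shows "limitin (lp_topology G p) (\<lambda>N x. f x - lp_average G C (Suc N) f x) f sequentially"
proof (rule limitin_lp_topology)
  have p': "1 \<le> p" using p by simp
  then show "1 \<le> p" .
  show "(\<lambda>x. f x - lp_average G C (Suc N) f x) \<in> carrier (lp_module G p)" for N
    using lp_add[OF p' f lp_scale[OF lp_average_closed[OF G p' f C(1,2), where N = "Suc N"], where c = "-1"]] by simp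
  have "(\<lambda>N. lp_norm G p (lp_average G C (Suc N) f)) \<longlonglongrightarrow> 0"
    by (rule LIMSEQ_Suc[OF lp_average_tendsto_0[OF G p f C]])
  moreover have "lp_norm G p (\<lambda>x. f x - lp_average G C (Suc N) f x - f x) = lp_norm G p (lp_average G C (Suc N) f)" for N
    using lp_norm_scale[OF p', of G "-1" "lp_average G C (Suc N) f"] by simp
  ultimately show "(\<lambda>N. lp_norm G p (\<lambda>x. f x - lp_average G C (Suc N) f x - f x)) \<longlonglongrightarrow> 0"
    by simp
qed (rule f)

section \<open>The group of equivariant maps into l^p(G)\<close>

lemma lp_hom_simps:
  "carrier (lp_hom G p M) = mod_hom (group_ring G) M (lp_module G p) \<inter> extensional (carrier M)"
  "\<phi> \<otimes>\<^bsub>lp_hom G p M\<^esub> \<psi> = (\<lambda>x\<in>carrier M. \<lambda>g. \<phi> x g + \<psi> x g)"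
  "\<one>\<^bsub>lp_hom G p M\<^esub> = (\<lambda>x\<in>carrier M. \<lambda>g. 0)"
  by (simp_all add: lp_hom_def)

lemma lp_homI:
  assumes M: "left_module (group_ring G) M"
    and "\<And>x. x \<in> carrier M \<Longrightarrow> \<phi> x \<in> carrier (lp_module G p)"
    and "\<And>x y. x \<in> carrier M \<Longrightarrow> y \<in> carrier M \<Longrightarrow> \<phi> (x \<oplus>\<^bsub>M\<^esub> y) = (\<lambda>g. \<phi> x g + \<phi> y g)"
    and "\<And>r x. r \<in> carrier (group_ring G) \<Longrightarrow> x \<in> carrier M \<Longrightarrow>
      \<phi> (r \<odot>\<^bsub>M\<^esub> x) = r \<odot>\<^bsub>lp_module G p\<^esub> \<phi> x"
  shows "(\<lambda>x\<in>carrier M. \<phi> x) \<in> carrier (lp_hom G p M)"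
proof -
  interpret M: left_module "group_ring G" M by fact
  show ?thesis using assms by (auto simp: lp_hom_simps intro!: mod_homI)
qed

lemma lp_smult_add:
  "a \<odot>\<^bsub>lp_module G p\<^esub> (\<lambda>g. f g + h g) = (\<lambda>g. (a \<odot>\<^bsub>lp_module G p\<^esub> f) g + (a \<odot>\<^bsub>lp_module G p\<^esub> h) g)"
  by (auto simp: fun_eq_iff lp_smult_apply lin_ext_def algebra_simps sum.distrib)

lemma lp_smult_zero: "a \<odot>\<^bsub>lp_module G p\<^esub> (\<lambda>g. 0) = (\<lambda>g. 0)"
  by (auto simp: fun_eq_iff lp_smult_apply lin_ext_def)

lemma group_lp_hom:
  assumes M: "left_module (group_ring G) M" and p: "1 \<le> p"
  shows "Group.group (lp_hom G p M)"
proof (rule groupI)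
  interpret M: left_module "group_ring G" M by fact
  fix \<phi> assume \<phi>: "\<phi> \<in> carrier (lp_hom G p M)"
  then have h: "\<phi> \<in> mod_hom (group_ring G) M (lp_module G p)" by (simp add: lp_hom_simps)
  {
    fix \<psi> assume "\<psi> \<in> carrier (lp_hom G p M)"
    then have k: "\<psi> \<in> mod_hom (group_ring G) M (lp_module G p)" by (simp add: lp_hom_simps)
    show "\<phi> \<otimes>\<^bsub>lp_hom G p M\<^esub> \<psi> \<in> carrier (lp_hom G p M)"
      unfolding lp_hom_simps(2)
      by (rule lp_homI[OF M])
        (auto simp: mod_hom_add[OF h] mod_hom_add[OF k] mod_hom_smult[OF h] mod_hom_smult[OF k] lp_smult_add
          intro!: lp_add[OF p] mod_hom_closed[OF h] mod_hom_closed[OF k])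
  }
  show "\<one>\<^bsub>lp_hom G p M\<^esub> \<otimes>\<^bsub>lp_hom G p M\<^esub> \<phi> = \<phi>"
    using \<phi> by (auto simp: lp_hom_simps fun_eq_iff extensional_def)
  have "(\<lambda>x\<in>carrier M. \<lambda>g. (-1) * \<phi> x g) \<in> carrier (lp_hom G p M)"
    by (rule lp_homI[OF M])
      (auto simp only: mod_hom_add[OF h] mod_hom_smult[OF h] lp_smult_scale lp_module_simps distrib_left
        intro!: lp_scale mod_hom_closed[OF h])
  moreover have "(\<lambda>x\<in>carrier M. \<lambda>g. (-1) * \<phi> x g) \<otimes>\<^bsub>lp_hom G p M\<^esub> \<phi> = \<one>\<^bsub>lp_hom G p M\<^esub>"
    by (auto simp: lp_hom_simps)
  ultimately show "\<exists>\<psi>\<in>carrier (lp_hom G p M). \<psi> \<otimes>\<^bsub>lp_hom G p M\<^esub> \<phi> = \<one>\<^bsub>lp_hom G p M\<^esub>"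
    by blast
next
  show "\<one>\<^bsub>lp_hom G p M\<^esub> \<in> carrier (lp_hom G p M)"
    unfolding lp_hom_simps(3) by (rule lp_homI[OF M]) (auto simp: lp_zero lp_smult_zero)
qed (auto simp: lp_hom_simps fun_eq_iff add.assoc)

section \<open>Reduced cohomology\<close>

text \<open>The sets \<open>C k\<close> stand for distinct finite conjugacy classes, through the
  properties that the averaging and the homotopies consume.\<close>

locale lp_resolution =
  fixes G :: "('g, 'b) monoid_scheme" and p :: real
    and F :: "nat \<Rightarrow> ('g \<Rightarrow>\<^sub>0 int, 'm) module" and d :: "nat \<Rightarrow> 'm \<Rightarrow> 'm" and \<epsilon> :: "'m \<Rightarrow> int"
    and C :: "nat \<Rightarrow> 'g set"
  assumes group_G: "Group.group G" and p: "1 < p"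
    and resol: "projective_resolution (group_ring G) trivial_module F d \<epsilon>"
    and C_finite: "\<And>k. finite (C k)" and C_subset: "\<And>k. C k \<subseteq> carrier G"
    and C_nonempty: "\<And>k. C k \<noteq> {}" and C_disjoint: "disjoint_family C"
    and C_invariant: "\<And>k g h. g \<in> carrier G \<Longrightarrow> h \<in> C k \<Longrightarrow> g \<otimes>\<^bsub>G\<^esub> h \<otimes>\<^bsub>G\<^esub> inv\<^bsub>G\<^esub> g \<in> C k"
begin

sublocale G: Group.group G by (rule group_G)
sublocale R: ring "group_ring G" by (rule ring_group_ring[OF group_G])

lemma p_ge_1: "1 \<le> p" using p by simp

sublocale L: left_module "group_ring G" "lp_module G p"
  by (rule left_module_lp[OF group_G p_ge_1])

lemma F_module: "left_module (group_ring G) (F i)"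
  by (rule resolution_left_module[OF resol])

lemma d_hom: "d (Suc i) \<in> mod_hom (group_ring G) (F (Suc i)) (F i)"
  by (rule resolution_mod_hom[OF resol])

lemma defect_mod_hom:
  assumes "S \<subseteq> carrier G" "\<And>g h. g \<in> carrier G \<Longrightarrow> h \<in> S \<Longrightarrow> g \<otimes>\<^bsub>G\<^esub> h \<otimes>\<^bsub>G\<^esub> inv\<^bsub>G\<^esub> g \<in> S"
  shows "(\<lambda>x. conj_defect G S \<odot>\<^bsub>F i\<^esub> x) \<in> mod_hom (group_ring G) (F i) (F i)"
  by (rule left_module.smult_mod_hom[OF F_module])
    (use assms in \<open>auto intro: G.conj_defect_closed G.conj_defect_central\<close>)

lemma augmentation_defect:
  assumes "S \<subseteq> carrier G" "x \<in> carrier (F 0)"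
  shows "\<epsilon> (conj_defect G S \<odot>\<^bsub>F 0\<^esub> x) = \<zero>\<^bsub>trivial_module\<^esub>"
proof -
  have "\<epsilon> \<in> mod_hom (group_ring G) (F 0) trivial_module"
    using resol by (auto simp: projective_resolution_def partial_projective_resolution_def)
  then have "\<epsilon> (conj_defect G S \<odot>\<^bsub>F 0\<^esub> x) = conj_defect G S \<odot>\<^bsub>trivial_module\<^esub> \<epsilon> x"
    using assms by (intro mod_hom_smult) (auto intro: G.conj_defect_closed)
  also have "\<dots> = \<zero>\<^bsub>trivial_module\<^esub>"
    using G.conj_defect_trivial[of S "\<epsilon> x"] by (simp add: trivial_module_def)
  finally show ?thesis .
qed

lemma defect_homotopy_0:
  assumes "S \<subseteq> carrier G" "\<And>g h. g \<in> carrier G \<Longrightarrow> h \<in> S \<Longrightarrow> g \<otimes>\<^bsub>G\<^esub> h \<otimes>\<^bsub>G\<^esub> inv\<^bsub>G\<^esub> g \<in> S"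
  shows "\<exists>s \<in> mod_hom (group_ring G) (F 0) (F (Suc 0)).
    \<forall>x\<in>carrier (F 0). d (Suc 0) (s x) = conj_defect G S \<odot>\<^bsub>F 0\<^esub> x"
  by (rule null_homotopy_0[OF resol R.ring_axioms defect_mod_hom[OF assms]])
    (use augmentation_defect[OF assms(1)] in auto)

text \<open>Multiplication by the defect commutes with the differentials by linearity and vanishes
  under the augmentation. The set \<open>S\<close> is arbitrary invariant, because homology applies
  this to the inverses of a class.\<close>

lemma defect_homotopy_Suc:
  assumes "S \<subseteq> carrier G" "\<And>g h. g \<in> carrier G \<Longrightarrow> h \<in> S \<Longrightarrow> g \<otimes>\<^bsub>G\<^esub> h \<otimes>\<^bsub>G\<^esub> inv\<^bsub>G\<^esub> g \<in> S"
  shows "\<exists>s \<in> mod_hom (group_ring G) (F (Suc i)) (F (Suc (Suc i))).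
    \<exists>t \<in> mod_hom (group_ring G) (F i) (F (Suc i)). \<forall>x\<in>carrier (F (Suc i)).
      conj_defect G S \<odot>\<^bsub>F (Suc i)\<^esub> x = d (Suc (Suc i)) (s x) \<oplus>\<^bsub>F (Suc i)\<^esub> t (d (Suc i) x)"
proof (rule null_homotopy_Suc[OF resol R.ring_axioms, where \<zeta> = "\<lambda>i x. conj_defect G S \<odot>\<^bsub>F i\<^esub> x" and i = i])
  show "(\<lambda>x. conj_defect G S \<odot>\<^bsub>F j\<^esub> x) \<in> mod_hom (group_ring G) (F j) (F j)" for j
    by (rule defect_mod_hom[OF assms])
  show "d (Suc j) (conj_defect G S \<odot>\<^bsub>F (Suc j)\<^esub> x) = conj_defect G S \<odot>\<^bsub>F j\<^esub> d (Suc j) x"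
    if "x \<in> carrier (F (Suc j))" for j x
    using that assms(1) by (intro mod_hom_smult[OF d_hom] G.conj_defect_closed)
  show "\<epsilon> (conj_defect G S \<odot>\<^bsub>F 0\<^esub> x) = \<zero>\<^bsub>trivial_module\<^esub>" if "x \<in> carrier (F 0)" for x
    by (rule augmentation_defect[OF assms(1) that])
qed blast

lemma lp_coboundary_hom: "lp_coboundary F d (Suc i) \<in> hom (lp_hom G p (F i)) (lp_hom G p (F (Suc i)))"
proof (rule homI)
  interpret M: left_module "group_ring G" "F (Suc i)" by (rule F_module)
  note dc = mod_hom_closed[OF d_hom]
  fix \<phi> assume "\<phi> \<in> carrier (lp_hom G p (F i))"
  then have "\<phi> \<in> mod_hom (group_ring G) (F i) (lp_module G p)" by (simp add: lp_hom_simps)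
  from mod_hom_compose[OF d_hom this]
  have "(\<lambda>x. \<phi> (d (Suc i) x)) \<in> mod_hom (group_ring G) (F (Suc i)) (lp_module G p)" .
  then show "lp_coboundary F d (Suc i) \<phi> \<in> carrier (lp_hom G p (F (Suc i)))"
    unfolding lp_coboundary_def compose_def
    by (intro lp_homI[OF F_module]) (auto simp: mod_hom_def)
next
  fix \<phi> \<psi>
  show "lp_coboundary F d (Suc i) (\<phi> \<otimes>\<^bsub>lp_hom G p (F i)\<^esub> \<psi>) =
      lp_coboundary F d (Suc i) \<phi> \<otimes>\<^bsub>lp_hom G p (F (Suc i))\<^esub> lp_coboundary F d (Suc i) \<psi>"
    using mod_hom_closed[OF d_hom] by (auto simp: lp_coboundary_def compose_def lp_hom_simps fun_eq_iff)
qed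

lemma group_hom_lp_coboundary:
  "group_hom (lp_hom G p (F i)) (lp_hom G p (F (Suc i))) (lp_coboundary F d (Suc i))"
  by (intro group_hom.intro group_hom_axioms.intro lp_coboundary_hom group_lp_hom F_module p_ge_1)

lemma lp_cocycles_iff:
  "\<phi> \<in> lp_cocycles G p F d i \<longleftrightarrow>
    \<phi> \<in> carrier (lp_hom G p (F i)) \<and> (\<forall>x\<in>carrier (F (Suc i)). \<forall>g. \<phi> (d (Suc i) x) g = 0)"
  by (auto simp: lp_cocycles_def kernel_def lp_hom_simps(3) lp_coboundary_def compose_def fun_eq_iff
      restrict_def split: if_splits)

text \<open>In positive degree this is \<open>d \<circ> d = 0\<close>; in degree 0 the only
  coboundary is the zero map.\<close>

lemma lp_coboundaries_subset: "lp_coboundaries G p F d i \<subseteq> lp_cocycles G p F d i"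
proof (cases i)
  case 0
  then show ?thesis
    using subgroup.one_closed[OF group_hom.subgroup_kernel[OF group_hom_lp_coboundary[of 0]]]
    by (simp add: lp_coboundaries_def lp_cocycles_def)
next
  case (Suc j)
  show ?thesis
  proof
    fix \<phi> assume "\<phi> \<in> lp_coboundaries G p F d i"
    then obtain \<psi> where \<psi>: "\<psi> \<in> carrier (lp_hom G p (F j))" "\<phi> = lp_coboundary F d (Suc j) \<psi>"
      by (auto simp: lp_coboundaries_def Suc)
    have "\<phi> (d (Suc i) x) g = 0" if x: "x \<in> carrier (F (Suc i))" for x g
    proof -
      have "\<psi> \<zero>\<^bsub>F j\<^esub> = (\<lambda>g. 0)"
        using \<psi>(1) mod_hom_zero[OF resolution_abelian_group[OF resol, of j] L.M.abelian_group_axioms, where h = \<psi> and R = "group_ring G"]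
        by (simp add: lp_hom_simps)
      then show ?thesis
        using x mod_hom_closed[OF d_hom, of x i] resolution_d_d[OF resol, of x j]
        by (simp add: \<psi>(2) lp_coboundary_def compose_def Suc)
    qed
    moreover have "\<phi> \<in> carrier (lp_hom G p (F i))"
      using lp_coboundary_hom \<psi> by (auto simp: hom_def Suc)
    ultimately show "\<phi> \<in> lp_cocycles G p F d i" by (simp add: lp_cocycles_iff)
  qed
qed

lemma topspace_lp_hom_topology: "topspace (lp_hom_topology G p (F i)) = carrier (lp_hom G p (F i))"
proof -
  have "carrier (lp_hom G p (F i)) \<subseteq> (\<Pi>\<^sub>E x\<in>carrier (F i). carrier (lp_module G p))"
    by (auto simp: lp_hom_simps mod_hom_def PiE_def)
  then show ?thesis
    by (auto simp: lp_hom_topology_def topspace_subtopology topspace_lp_topology[OF p_ge_1])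
qed

text \<open>Each equation \<open>\<phi> (d x) g = 0\<close> involves one argument and one
  coordinate, both continuous projections, so the coboundaries lie in closed sets whose intersection
  is the cocycles.\<close>

lemma closure_lp_coboundaries_subset:
  "lp_hom_topology G p (F i) closure_of lp_coboundaries G p F d i \<subseteq> lp_cocycles G p F d i"
proof
  fix \<phi> assume \<phi>: "\<phi> \<in> lp_hom_topology G p (F i) closure_of lp_coboundaries G p F d i"
  have "\<phi> (d (Suc i) x) g = 0" if x: "x \<in> carrier (F (Suc i))" for x g
  proof -
    have dx: "d (Suc i) x \<in> carrier (F i)" using mod_hom_closed[OF d_hom x] .
    have "continuous_map (product_topology (\<lambda>_. lp_topology G p) (carrier (F i))) euclidean
        ((\<lambda>f. f g) \<circ> (\<lambda>\<phi>. \<phi> (d (Suc i) x)))"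
      by (rule continuous_map_compose[OF continuous_map_product_projection[OF dx] continuous_map_lp_apply[OF p_ge_1]])
    then have "continuous_map (lp_hom_topology G p (F i)) euclidean (\<lambda>\<phi>. \<phi> (d (Suc i) x) g)"
      unfolding lp_hom_topology_def by (intro continuous_map_from_subtopology) (simp add: o_def)
    then have "closedin (lp_hom_topology G p (F i))
        {\<phi> \<in> topspace (lp_hom_topology G p (F i)). \<phi> (d (Suc i) x) g \<in> {0}}"
      by (rule closedin_continuous_map_preimage) simp
    moreover have "lp_coboundaries G p F d i \<subseteq> {\<phi> \<in> topspace (lp_hom_topology G p (F i)). \<phi> (d (Suc i) x) g \<in> {0}}"
      using lp_coboundaries_subset[of i] x by (auto simp: lp_cocycles_iff topspace_lp_hom_topology subset_iff)
    ultimately show ?thesis using closure_of_minimal \<phi> by blast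
  qed
  moreover have "\<phi> \<in> carrier (lp_hom G p (F i))"
    using \<phi> by (metis in_closure_of topspace_lp_hom_topology)
  ultimately show "\<phi> \<in> lp_cocycles G p F d i" by (simp add: lp_cocycles_iff)
qed

section \<open>Cocycles as limits of coboundaries\<close>

definition approx :: "nat \<Rightarrow> ('g \<Rightarrow> complex) \<Rightarrow> 'g \<Rightarrow> complex"
  where "approx N f g = f g - lp_average G C (Suc N) f g"

lemma approx_closed:
  assumes "f \<in> carrier (lp_module G p)"
  shows "approx N f \<in> carrier (lp_module G p)"
  using lp_add[OF p_ge_1 assms lp_scale[OF lp_average_closed[OF group_G p_ge_1 assms C_finite C_subset, where N = "Suc N"], where c = "-1"]]
  by (simp add: approx_def[abs_def])

lemma approx_eq:
  assumes "f \<in> carrier (lp_module G p)"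
  shows "approx N f = (\<lambda>g. \<Sum>k<Suc N. - 1 / (of_nat (Suc N) * of_nat (card (C k))) *
    (conj_defect G (C k) \<odot>\<^bsub>lp_module G p\<^esub> f) g)"
  using lp_average_defect[OF group_G assms zero_less_Suc C_finite C_subset C_nonempty]
  by (simp only: approx_def[abs_def])

lemma approx_limitin:
  assumes "f \<in> carrier (lp_module G p)"
  shows "limitin (lp_topology G p) (\<lambda>N. approx N f) f sequentially"
  using limitin_lp_average[OF group_G p assms C_finite C_subset C_nonempty C_disjoint]
  by (simp add: approx_def[abs_def])

text \<open>Equivariance moves the defect from the values of \<open>\<phi>\<close> to its argument,
  where it is null-homotopic.\<close>

lemma approx_cocycle:
  assumes \<phi>: "\<phi> \<in> lp_cocycles G p F d i"
  shows "(\<lambda>x\<in>carrier (F i). approx N (\<phi> x)) \<in> lp_coboundaries G p F d i"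
proof -
  interpret M: left_module "group_ring G" "F i" by (rule F_module)
  have hom: "\<phi> \<in> mod_hom (group_ring G) (F i) (lp_module G p)"
    and cocycle: "\<And>x. x \<in> carrier (F (Suc i)) \<Longrightarrow> \<phi> (d (Suc i) x) = (\<lambda>g. 0)"
    using \<phi> by (auto simp: lp_cocycles_iff lp_hom_simps)
  have defect: "conj_defect G (C k) \<odot>\<^bsub>lp_module G p\<^esub> \<phi> x = \<phi> (conj_defect G (C k) \<odot>\<^bsub>F i\<^esub> x)"
    if "x \<in> carrier (F i)" for k x
    using mod_hom_smult[OF hom G.conj_defect_closed[OF C_subset] that] by simp
  let ?r = "\<lambda>k. - 1 / (of_nat (Suc N) * of_nat (card (C k))) :: complex"
  have approx: "approx N (\<phi> x) = (\<lambda>g. \<Sum>k<Suc N. ?r k * \<phi> (conj_defect G (C k) \<odot>\<^bsub>F i\<^esub> x) g)"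
    if "x \<in> carrier (F i)" for x
    using approx_eq[OF mod_hom_closed[OF hom that]] defect[OF that] by simp
  show ?thesis
  proof (cases i)
    case 0
    \<comment> \<open>In degree 0 the homotopy consists of \<open>d s\<close> alone, so the cocycle
      kills the defect and the approximant is the zero map, as the degree 0 coboundaries
      require.\<close>
    have "\<phi> (conj_defect G (C k) \<odot>\<^bsub>F 0\<^esub> x) = (\<lambda>g. 0)" if x: "x \<in> carrier (F 0)" for k x
    proof -
      obtain s where s: "s \<in> mod_hom (group_ring G) (F 0) (F (Suc 0))"
        "\<And>x. x \<in> carrier (F 0) \<Longrightarrow> d (Suc 0) (s x) = conj_defect G (C k) \<odot>\<^bsub>F 0\<^esub> x"
        using defect_homotopy_0[OF C_subset C_invariant] by metis
      show ?thesis
        using cocycle[of "s x"] mod_hom_closed[OF s(1) x] s(2)[OF x] by (simp add: 0)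
    qed
    then have "(\<lambda>x\<in>carrier (F i). approx N (\<phi> x)) = \<one>\<^bsub>lp_hom G p (F 0)\<^esub>"
      by (auto simp: approx 0 lp_hom_simps)
    then show ?thesis by (simp add: lp_coboundaries_def 0)
  next
    case (Suc j)
    \<comment> \<open>The cocycle annihilates the half \<open>d s\<close>, leaving
      \<open>\<phi> \<circ> t\<close> evaluated at \<open>d x\<close>, which is visibly a
      coboundary.\<close>
    have "\<exists>t. t \<in> mod_hom (group_ring G) (F j) (F (Suc j)) \<and>
      (\<forall>x\<in>carrier (F (Suc j)). \<phi> (conj_defect G (C k) \<odot>\<^bsub>F (Suc j)\<^esub> x) = \<phi> (t (d (Suc j) x)))" for k
    proof -
      obtain s t where st: "s \<in> mod_hom (group_ring G) (F (Suc j)) (F (Suc (Suc j)))"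
        "t \<in> mod_hom (group_ring G) (F j) (F (Suc j))"
        "\<And>x. x \<in> carrier (F (Suc j)) \<Longrightarrow>
          conj_defect G (C k) \<odot>\<^bsub>F (Suc j)\<^esub> x = d (Suc (Suc j)) (s x) \<oplus>\<^bsub>F (Suc j)\<^esub> t (d (Suc j) x)"
        using defect_homotopy_Suc[OF C_subset C_invariant] by metis
      have "\<phi> (conj_defect G (C k) \<odot>\<^bsub>F (Suc j)\<^esub> x) = \<phi> (t (d (Suc j) x))" if x: "x \<in> carrier (F (Suc j))" for x
      proof -
        have sx: "s x \<in> carrier (F (Suc i))" using mod_hom_closed[OF st(1) x] by (simp add: Suc)
        have "d (Suc i) (s x) \<in> carrier (F i)" "t (d (Suc j) x) \<in> carrier (F i)"
          using mod_hom_closed[OF d_hom sx] mod_hom_closed[OF st(2) mod_hom_closed[OF d_hom x]] by (simp_all add: Suc)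
        then show ?thesis
          using mod_hom_add[OF hom, of "d (Suc i) (s x)" "t (d (Suc j) x)"] cocycle[OF sx]
          by (simp add: st(3)[OF x] Suc)
      qed
      with st(2) show ?thesis by blast
    qed
    then obtain t where t: "\<And>k. t k \<in> mod_hom (group_ring G) (F j) (F (Suc j))"
      and \<phi>t: "\<And>k x. x \<in> carrier (F (Suc j)) \<Longrightarrow>
        \<phi> (conj_defect G (C k) \<odot>\<^bsub>F (Suc j)\<^esub> x) = \<phi> (t k (d (Suc j) x))"
      by metis
    \<comment> \<open>The explicit primitive. Complex weights are harmless because they act on the
      values of \<open>\<phi>\<close>, where they commute with the group ring.\<close>
    define \<psi> where "\<psi> y = (\<lambda>g. \<Sum>k<Suc N. ?r k * \<phi> (t k y) g)" for y
    have hom': "\<phi> \<in> mod_hom (group_ring G) (F (Suc j)) (lp_module G p)" using hom by (simp add: Suc)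
    note \<phi>t_hom = mod_hom_compose[OF t hom']
    have "(\<lambda>y\<in>carrier (F j). \<psi> y) \<in> carrier (lp_hom G p (F j))"
    proof (rule lp_homI[OF F_module])
      fix x y assume "x \<in> carrier (F j)" "y \<in> carrier (F j)"
      then show "\<psi> (x \<oplus>\<^bsub>F j\<^esub> y) = (\<lambda>g. \<psi> x g + \<psi> y g)"
        by (simp only: \<psi>_def mod_hom_add[OF \<phi>t_hom] lp_module_simps distrib_left sum.distrib)
    next
      fix r x assume "r \<in> carrier (group_ring G)" "x \<in> carrier (F j)"
      then show "\<psi> (r \<odot>\<^bsub>F j\<^esub> x) = r \<odot>\<^bsub>lp_module G p\<^esub> \<psi> x"
        by (simp only: \<psi>_def mod_hom_smult[OF \<phi>t_hom] lp_smult_lincomb)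
    qed (unfold \<psi>_def, intro lp_lincomb p_ge_1 mod_hom_closed[OF \<phi>t_hom])
    moreover have "(\<lambda>x\<in>carrier (F i). approx N (\<phi> x)) = lp_coboundary F d (Suc j) (\<lambda>y\<in>carrier (F j). \<psi> y)"
      using mod_hom_closed[OF d_hom, of _ j]
      by (auto simp: approx Suc \<phi>t \<psi>_def lp_coboundary_def compose_def fun_eq_iff simp del: sum.lessThan_Suc)
    ultimately show ?thesis by (simp add: lp_coboundaries_def Suc)
  qed
qed

lemma lp_cocycles_subset_closure:
  "lp_cocycles G p F d i \<subseteq> lp_hom_topology G p (F i) closure_of lp_coboundaries G p F d i"
proof
  fix \<phi> assume \<phi>: "\<phi> \<in> lp_cocycles G p F d i"
  then have carr: "\<phi> \<in> carrier (lp_hom G p (F i))" by (simp add: lp_cocycles_iff)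
  let ?s = "\<lambda>N. \<lambda>x\<in>carrier (F i). approx N (\<phi> x)"
  have s: "?s N \<in> lp_coboundaries G p F d i" for N by (rule approx_cocycle[OF \<phi>])
  have \<phi>x: "\<phi> x \<in> carrier (lp_module G p)" if "x \<in> carrier (F i)" for x
    using carr that by (auto simp: lp_hom_simps mod_hom_def)
  \<comment> \<open>The topology on Hom is that of pointwise convergence, so strong convergence of
    the averages at each value \<open>\<phi> x\<close> suffices.\<close>
  have "limitin (product_topology (\<lambda>_. lp_topology G p) (carrier (F i))) ?s \<phi> sequentially"
    unfolding limitin_componentwise
  proof (intro conjI ballI)
    show "\<phi> \<in> extensional (carrier (F i))" using carr by (simp add: lp_hom_simps)
    show "\<forall>\<^sub>F N in sequentially. ?s N \<in> topspace (product_topology (\<lambda>_. lp_topology G p) (carrier (F i)))"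
      by (auto simp: topspace_lp_topology[OF p_ge_1] approx_closed \<phi>x)
    show "limitin (lp_topology G p) (\<lambda>N. ?s N x) (\<phi> x) sequentially" if "x \<in> carrier (F i)" for x
      using approx_limitin[OF \<phi>x[OF that]] that by simp
  qed
  then have "limitin (lp_hom_topology G p (F i)) ?s \<phi> sequentially"
    using carr s lp_coboundaries_subset[of i]
    by (auto simp: lp_hom_topology_def limitin_subtopology lp_cocycles_iff subset_iff)
  then show "\<phi> \<in> lp_hom_topology G p (F i) closure_of lp_coboundaries G p F d i"
    unfolding in_closure_of limitin_sequentially using s by (meson order_refl)
qed

lemma trivial_reduced_lp_cohomology: "trivial_group (reduced_lp_cohomology G p F d i)"
proof -
  have "lp_hom_topology G p (F i) closure_of lp_coboundaries G p F d i = lp_cocycles G p F d i"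
    using closure_lp_coboundaries_subset lp_cocycles_subset_closure by blast
  moreover have "subgroup (lp_cocycles G p F d i) (lp_hom G p (F i))"
    unfolding lp_cocycles_def by (rule group_hom.subgroup_kernel[OF group_hom_lp_coboundary])
  ultimately show ?thesis
    using trivial_group_subgroup_Mod_self[OF group_lp_hom[OF F_module p_ge_1]]
    by (simp add: reduced_lp_cohomology_def)
qed

end

section \<open>The topology of the tensor product\<close>

text \<open>Formally \<xi> \<otimes> 1 from P \<otimes> l^p(G) to Z[G] \<otimes> l^p(G), followed by
  the identification of the latter with l^p(G) via a \<otimes> f -> a^* f and by evaluation at
  \<open>g\<close>.\<close>

definition lp_functional ::
    "('g, 'b) monoid_scheme \<Rightarrow> real \<Rightarrow> ('m \<Rightarrow> 'g \<Rightarrow>\<^sub>0 int) \<Rightarrow> 'g \<Rightarrow> 'm \<times> ('g \<Rightarrow> complex) \<Rightarrow> complex"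
  where "lp_functional G p \<xi> g = (\<lambda>(x, f). (group_ring_star G (\<xi> x) \<odot>\<^bsub>lp_module G p\<^esub> f) g)"

lemma group_ring_add [simp]: "a \<oplus>\<^bsub>group_ring G\<^esub> b = a + b"
  by (simp add: group_ring_def)

lemma group_ring_zero [simp]: "\<zero>\<^bsub>group_ring G\<^esub> = 0"
  by (simp add: group_ring_def)

text \<open>Balancedness is the only point: since the involution reverses products, applying it to
  \<open>\<xi> (a^* x) = a^* \<xi> x\<close> gives the involute of \<open>\<xi> x\<close> times
  \<open>a\<close>, whose last factor then acts on \<open>f\<close>.\<close>

lemma lp_functional_T:
  assumes "tensor_modules G M (lp_module G p)"
    and \<xi>: "\<xi> \<in> mod_hom (group_ring G) M (regular_module (group_ring G))"
    and c: "c \<in> tensor_subgroup G M (lp_module G p)"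
  shows "lin_ext (lp_functional G p \<xi> g) c = 0"
proof -
  interpret tensor_modules G M "lp_module G p" by fact
  have star: "group_ring_star G (\<xi> x) \<in> carrier (group_ring G)" if "x \<in> carrier M" for x
    using mod_hom_closed[OF \<xi> that] by (simp add: G.group_ring_star_closed)
  show ?thesis
  proof (rule lin_ext_T[OF c])
    fix x x' and f :: "'a \<Rightarrow> complex" assume "x \<in> carrier M" "x' \<in> carrier M" "f \<in> carrier (lp_module G p)"
    then show "lp_functional G p \<xi> g (x \<oplus>\<^bsub>M\<^esub> x', f) = lp_functional G p \<xi> g (x, f) + lp_functional G p \<xi> g (x', f)"
      using N.smult_l_distr[OF star star, of x x' f]
      by (simp add: lp_functional_def mod_hom_add[OF \<xi>] G.group_ring_star_add)
  next
    fix x and f h :: "'a \<Rightarrow> complex"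
    assume "x \<in> carrier M" "f \<in> carrier (lp_module G p)" "h \<in> carrier (lp_module G p)"
    then show "lp_functional G p \<xi> g (x, f \<oplus>\<^bsub>lp_module G p\<^esub> h) = lp_functional G p \<xi> g (x, f) + lp_functional G p \<xi> g (x, h)"
      using N.smult_r_distr[OF star, of x f h] by (simp add: lp_functional_def)
  next
    fix a x and f :: "'a \<Rightarrow> complex"
    assume a: "a \<in> carrier (group_ring G)" and x: "x \<in> carrier M" and f: "f \<in> carrier (lp_module G p)"
    have "\<xi> (group_ring_star G a \<odot>\<^bsub>M\<^esub> x) = group_ring_star G a \<otimes>\<^bsub>group_ring G\<^esub> \<xi> x"
      using mod_hom_smult[OF \<xi> G.group_ring_star_closed[OF a] x] by simp
    then have "group_ring_star G (\<xi> (group_ring_star G a \<odot>\<^bsub>M\<^esub> x)) = group_ring_star G (\<xi> x) \<otimes>\<^bsub>group_ring G\<^esub> a"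
      using mod_hom_closed[OF \<xi> x] a
      by (simp add: G.group_ring_star_mult G.group_ring_star_closed G.group_ring_star_star)
    then show "lp_functional G p \<xi> g (group_ring_star G a \<odot>\<^bsub>M\<^esub> x, f) = lp_functional G p \<xi> g (x, a \<odot>\<^bsub>lp_module G p\<^esub> f)"
      by (simp add: lp_functional_def N.smult_assoc1[OF star[OF x] a f])
  qed
qed

text \<open>In a dual basis \<open>(e\<^sub>k, \<xi>\<^sub>k)\<close> of \<open>P\<close>, a tensor \<open>\<Sum>\<^sub>j x\<^sub>j \<otimes> f\<^sub>j\<close> becomes
  \<open>\<Sum>\<^sub>k e\<^sub>k \<otimes> (\<Sum>\<^sub>j \<xi>\<^sub>k(x\<^sub>j)\<^sup>* f\<^sub>j)\<close>, whose coefficients are given by the functionals.\<close>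

lemma tensor_zero_criterion:
  fixes P :: "('g \<Rightarrow>\<^sub>0 int, 'm, 'x) module_scheme"
  assumes "tensor_modules G P (lp_module G p)" "1 \<le> p" and P: "projective_module (group_ring G) P"
    and c: "Poly_Mapping.keys c \<subseteq> carrier P \<times> carrier (lp_module G p)"
    and zero: "\<And>\<xi> g. \<xi> \<in> mod_hom (group_ring G) P (regular_module (group_ring G)) \<Longrightarrow>
      lin_ext (lp_functional G p \<xi> g) c = 0"
  shows "c \<in> tensor_subgroup G P (lp_module G p)"
proof -
  interpret tensor_modules G P "lp_module G p" by fact
  obtain m :: nat and x f where x: "x \<in> {..<m} \<rightarrow> carrier P" and f: "f \<in> {..<m} \<rightarrow> carrier (lp_module G p)"
    and cT: "c - (\<Sum>j<m. frag_of (x j, f j)) \<in> T"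
    using tensor_representation[OF c] by blast
  obtain X :: "'m set" and \<xi> e
    where \<xi>: "\<And>k. k \<in> X \<Longrightarrow> \<xi> k \<in> mod_hom (group_ring G) P (regular_module (group_ring G))"
    and e: "\<And>k. k \<in> X \<Longrightarrow> e k \<in> carrier P"
    and fin: "\<And>y. y \<in> carrier P \<Longrightarrow> finite {k \<in> X. \<xi> k y \<noteq> \<zero>\<^bsub>group_ring G\<^esub>}"
    and expand: "\<And>y Y. y \<in> carrier P \<Longrightarrow> finite Y \<Longrightarrow> Y \<subseteq> X \<Longrightarrow>
      {k \<in> X. \<xi> k y \<noteq> \<zero>\<^bsub>group_ring G\<^esub>} \<subseteq> Y \<Longrightarrow> (\<Oplus>\<^bsub>P\<^esub>k\<in>Y. \<xi> k y \<odot>\<^bsub>P\<^esub> e k) = y"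
    by (rule projective_dual_basis[OF M.R.ring_axioms P], rule that)
  \<comment> \<open>One finite index set for all \<open>x j\<close>, so that the double sum over
    \<open>j\<close> and \<open>k\<close> can be interchanged.\<close>
  define Y where "Y = (\<Union>j<m. {k \<in> X. \<xi> k (x j) \<noteq> \<zero>\<^bsub>group_ring G\<^esub>})"
  have Y: "finite Y" "Y \<subseteq> X" using fin x by (auto simp: Y_def)
  have xj: "x j \<in> carrier P" and fj: "f j \<in> carrier (lp_module G p)" if "j < m" for j
    using x f that by auto
  have \<xi>c: "\<xi> k y \<in> carrier (group_ring G)" if "k \<in> Y" "y \<in> carrier P" for k y
    using mod_hom_closed[OF \<xi>] that Y by fastforce
  let ?a = "\<lambda>j k. group_ring_star G (\<xi> k (x j))"
  have ac: "?a j k \<in> carrier (group_ring G)" if "j < m" "k \<in> Y" for j k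
    using \<xi>c[OF that(2) xj[OF that(1)]] by (rule G.group_ring_star_closed)
  have 1: "frag_of (x j, f j) - (\<Sum>k\<in>Y. frag_of (\<xi> k (x j) \<odot>\<^bsub>P\<^esub> e k, f j)) \<in> T" if j: "j < m" for j
  proof -
    have "(\<Oplus>\<^bsub>P\<^esub>k\<in>Y. \<xi> k (x j) \<odot>\<^bsub>P\<^esub> e k) = x j"
      using xj[OF j] Y j by (intro expand) (auto simp: Y_def)
    then show ?thesis
      using T_finsum_left[OF Y(1), of "\<lambda>k. \<xi> k (x j) \<odot>\<^bsub>P\<^esub> e k" "f j"] \<xi>c xj[OF j] fj[OF j] e Y(2)
      by (auto simp: subset_iff)
  qed
  have 2: "frag_of (\<xi> k (x j) \<odot>\<^bsub>P\<^esub> e k, f j) - frag_of (e k, ?a j k \<odot>\<^bsub>lp_module G p\<^esub> f j) \<in> T"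
    if "j < m" "k \<in> Y" for j k
    using T_balanced[OF ac[OF that], of "e k" "f j"] e Y(2) that(2) fj[OF that(1)]
      G.group_ring_star_star[OF \<xi>c[OF that(2) xj[OF that(1)]]]
    by (auto simp: subset_iff)
  \<comment> \<open>The functional of \<open>\<xi> k\<close> has the same value on \<open>c\<close>
    and on its representative, so the hypothesis says that the total coefficient of
    \<open>e k\<close> vanishes at every \<open>g\<close>; a pure tensor with second factor 0 is a
    relation.\<close>
  have 3: "(\<Sum>j<m. frag_of (e k, ?a j k \<odot>\<^bsub>lp_module G p\<^esub> f j)) \<in> T" if k: "k \<in> Y" for k
  proof -
    have afc: "?a j k \<odot>\<^bsub>lp_module G p\<^esub> f j \<in> carrier (lp_module G p)" if "j < m" for j
      using ac[OF that k] fj[OF that] by simp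
    have "(\<Sum>j<m. (?a j k \<odot>\<^bsub>lp_module G p\<^esub> f j) g) = 0" for g
    proof -
      have \<xi>k: "\<xi> k \<in> mod_hom (group_ring G) P (regular_module (group_ring G))" using \<xi> k Y by blast
      have "lin_ext (lp_functional G p (\<xi> k) g) (c - (\<Sum>j<m. frag_of (x j, f j))) = 0"
        by (rule lp_functional_T[OF tensor_modules_axioms \<xi>k cT])
      then show ?thesis using zero[OF \<xi>k, of g] by (simp add: lp_functional_def)
    qed
    then have "(\<Oplus>\<^bsub>lp_module G p\<^esub>j\<in>{..<m}. ?a j k \<odot>\<^bsub>lp_module G p\<^esub> f j) = \<zero>\<^bsub>lp_module G p\<^esub>"
      using afc by (subst lp_finsum[OF group_G assms(2)]) auto
    moreover have ek: "e k \<in> carrier P" using e k Y by blast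
    ultimately show ?thesis
      using T_finsum_right[of "{..<m}" "\<lambda>j. ?a j k \<odot>\<^bsub>lp_module G p\<^esub> f j" "e k"] afc
        T_diff[OF T_zero_right[OF ek]] by fastforce
  qed
  have "(\<Sum>j<m. frag_of (x j, f j)) - (\<Sum>j<m. \<Sum>k\<in>Y. frag_of (e k, ?a j k \<odot>\<^bsub>lp_module G p\<^esub> f j)) \<in> T"
    using 1 2 by (intro T_sum_diff T_trans[OF 1 T_sum_diff]) auto
  moreover have "(\<Sum>j<m. \<Sum>k\<in>Y. frag_of (e k, ?a j k \<odot>\<^bsub>lp_module G p\<^esub> f j)) \<in> T"
    by (subst sum.swap) (intro T_sum 3)
  ultimately have "(\<Sum>j<m. frag_of (x j, f j)) \<in> T"
    using T_add by fastforce
  with cT show ?thesis using T_add by fastforce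
qed

lemma openin_lp_tensor_topology: "openin (lp_tensor_topology G p M) U \<longleftrightarrow> lp_tensor_open G p M U"
  unfolding lp_tensor_topology_def using topology_inverse'[OF istopology_lp_tensor_open] by metis

lemma (in tensor_modules) finprod_elem_tensor:
  assumes "x \<in> {..<m::nat} \<rightarrow> carrier M" "f \<in> {..<m} \<rightarrow> carrier N"
  shows "(\<Otimes>\<^bsub>tensor_product G M N\<^esub>j\<in>{..<m}. elem_tensor G M N (x j) (f j)) =
    tensor_class G M N (\<Sum>j<m. frag_of (x j, f j))"
  unfolding elem_tensor_eq using assms by (intro tensor_class_sum) auto

lemma (in tensor_modules) keys_sum_tensor:
  assumes "x \<in> {..<m::nat} \<rightarrow> carrier M" "f \<in> {..<m} \<rightarrow> carrier N"
  shows "Poly_Mapping.keys (\<Sum>j<m. frag_of (x j, f j)) \<subseteq> carrier M \<times> carrier N"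
  using assms by (intro order_trans[OF Poly_Mapping.keys_sum]) auto

lemma topspace_lp_tensor_topology:
  assumes "tensor_modules G M (lp_module G p)" "1 \<le> p"
  shows "topspace (lp_tensor_topology G p M) = carrier (lp_tensor G p M)"
proof (rule antisym)
  interpret tensor_modules G M "lp_module G p" by fact
  have "lp_tensor_open G p M (carrier (lp_tensor G p M))"
    unfolding lp_tensor_open_def
  proof (intro conjI allI impI order_refl)
    fix m :: nat and x assume x: "x \<in> {..<m} \<rightarrow> carrier M"
    have "(\<Otimes>\<^bsub>lp_tensor G p M\<^esub>j\<in>{..<m}. elem_tensor G M (lp_module G p) (x j) (f j)) \<in> carrier (lp_tensor G p M)"
      if "f \<in> {..<m} \<rightarrow>\<^sub>E carrier (lp_module G p)" for f
    proof -
      have f: "f \<in> {..<m} \<rightarrow> carrier (lp_module G p)" using that by (simp add: PiE_def)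
      show ?thesis
        unfolding finprod_elem_tensor[OF x f] by (rule tensor_class_closed[OF keys_sum_tensor[OF x f]])
    qed
    then have "{f \<in> {..<m} \<rightarrow>\<^sub>E carrier (lp_module G p).
        (\<Otimes>\<^bsub>lp_tensor G p M\<^esub>j\<in>{..<m}. elem_tensor G M (lp_module G p) (x j) (f j)) \<in> carrier (lp_tensor G p M)}
      = topspace (product_topology (\<lambda>_. lp_topology G p) {..<m})"
      by (simp add: topspace_lp_topology[OF assms(2)] cong: conj_cong)
    then show "openin (product_topology (\<lambda>_. lp_topology G p) {..<m}) {f \<in> {..<m} \<rightarrow>\<^sub>E carrier (lp_module G p).
        (\<Otimes>\<^bsub>lp_tensor G p M\<^esub>j\<in>{..<m}. elem_tensor G M (lp_module G p) (x j) (f j)) \<in> carrier (lp_tensor G p M)}"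
      by (simp only: openin_topspace)
  qed
  then show "carrier (lp_tensor G p M) \<subseteq> topspace (lp_tensor_topology G p M)"
    by (intro openin_subset) (simp add: openin_lp_tensor_topology)
  show "topspace (lp_tensor_topology G p M) \<subseteq> carrier (lp_tensor G p M)"
    using openin_topspace[of "lp_tensor_topology G p M"]
    unfolding openin_lp_tensor_topology lp_tensor_open_def by blast
qed

text \<open>Group ring elements have finite support, so the functional is a finite combination of
  point evaluations of \<open>f\<close>.\<close>

lemma continuous_map_lp_functional:
  assumes p: "1 \<le> p"
  shows "continuous_map (lp_topology G p) euclidean (\<lambda>f. lp_functional G p \<xi> g (x, f))"
proof (cases "g \<in> carrier G")
  case True
  have "continuous_map (lp_topology G p) euclidean ((\<lambda>z. c * z) \<circ> (\<lambda>f. f y))" for c and y :: 'a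
    by (rule continuous_map_compose[OF continuous_map_lp_apply[OF p]])
      (auto intro!: continuous_intros simp: continuous_map_iff_continuous2)
  then show ?thesis
    using True unfolding lp_functional_def
    by (simp add: lp_smult_apply lin_ext_def o_def continuous_map_sum)
qed (simp add: lp_functional_def lp_smult_apply)

text \<open>Openness is tested along families \<open>x\<close>. Along each of them the functional
  becomes a finite sum of continuous functions of the coordinates \<open>f j\<close>, and
  nonvanishing is an open condition.\<close>

lemma closedin_lp_functional_kernel:
  assumes "tensor_modules G M (lp_module G p)" and p: "1 \<le> p"
    and \<xi>: "\<xi> \<in> mod_hom (group_ring G) M (regular_module (group_ring G))"
  shows "closedin (lp_tensor_topology G p M) (tensor_class G M (lp_module G p) `
    {c. Poly_Mapping.keys c \<subseteq> carrier M \<times> carrier (lp_module G p) \<and> lin_ext (lp_functional G p \<xi> g) c = 0})"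
    (is "closedin _ ?K")
proof -
  interpret tensor_modules G M "lp_module G p" by fact
  let ?\<phi> = "lp_functional G p \<xi> g"
  \<comment> \<open>The functional vanishes on relations, so membership in \<open>?K\<close> can be
    read off from any representative of the class.\<close>
  have mem: "tensor_class G M (lp_module G p) c \<in> ?K \<longleftrightarrow> lin_ext ?\<phi> c = 0"
    if c: "Poly_Mapping.keys c \<subseteq> carrier M \<times> carrier (lp_module G p)" for c
  proof
    assume "tensor_class G M (lp_module G p) c \<in> ?K"
    then obtain c' where c': "Poly_Mapping.keys c' \<subseteq> carrier M \<times> carrier (lp_module G p)"
      "lin_ext ?\<phi> c' = 0" "tensor_class G M (lp_module G p) c = tensor_class G M (lp_module G p) c'"
      by auto
    then have "c - c' \<in> T" using tensor_class_eq_iff[OF c c'(1)] by blast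
    from lp_functional_T[OF tensor_modules_axioms \<xi> this, of g] c'(2) show "lin_ext ?\<phi> c = 0"
      by simp
  qed (use c in auto)
  have "lp_tensor_open G p M (carrier (lp_tensor G p M) - ?K)"
    unfolding lp_tensor_open_def
  proof (intro conjI allI impI)
    fix m :: nat and x assume x: "x \<in> {..<m} \<rightarrow> carrier M"
    let ?X = "product_topology (\<lambda>_. lp_topology G p) {..<m}"
    have "continuous_map ?X euclidean (\<lambda>f. \<Sum>j<m. ?\<phi> (x j, f j))"
    proof (intro continuous_map_sum)
      fix j assume "j \<in> {..<m}"
      then have "continuous_map ?X (lp_topology G p) (\<lambda>f. f j)"
        by (rule continuous_map_product_projection)
      from continuous_map_compose[OF this continuous_map_lp_functional[OF p]]
      have "continuous_map ?X euclidean ((\<lambda>h. ?\<phi> (x j, h)) \<circ> (\<lambda>f. f j))" .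
      then show "continuous_map ?X euclidean (\<lambda>f. ?\<phi> (x j, f j))" by (simp add: o_def)
    qed simp
    then have "openin ?X {f \<in> topspace ?X. (\<Sum>j<m. ?\<phi> (x j, f j)) \<in> - {0}}"
      by (rule openin_continuous_map_preimage) (simp add: open_openin[symmetric] open_Compl)
    also have "{f \<in> topspace ?X. (\<Sum>j<m. ?\<phi> (x j, f j)) \<in> - {0}} =
      {f \<in> {..<m} \<rightarrow>\<^sub>E carrier (lp_module G p).
        (\<Otimes>\<^bsub>lp_tensor G p M\<^esub>j\<in>{..<m}. elem_tensor G M (lp_module G p) (x j) (f j)) \<in> carrier (lp_tensor G p M) - ?K}"
    proof (rule Collect_cong)
      fix f
      show "(f \<in> topspace ?X \<and> (\<Sum>j<m. ?\<phi> (x j, f j)) \<in> - {0}) \<longleftrightarrow>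
        (f \<in> {..<m} \<rightarrow>\<^sub>E carrier (lp_module G p) \<and>
          (\<Otimes>\<^bsub>lp_tensor G p M\<^esub>j\<in>{..<m}. elem_tensor G M (lp_module G p) (x j) (f j)) \<in> carrier (lp_tensor G p M) - ?K)"
      proof (cases "f \<in> {..<m} \<rightarrow>\<^sub>E carrier (lp_module G p)")
        case True
        then have f: "f \<in> {..<m} \<rightarrow> carrier (lp_module G p)" by (auto simp: PiE_def)
        note k = keys_sum_tensor[OF x f]
        have "f \<in> topspace ?X" using True by (simp add: topspace_lp_topology[OF p])
        with True show ?thesis
          unfolding finprod_elem_tensor[OF x f] Diff_iff mem[OF k] using tensor_class_closed[OF k] by simp
      qed (simp add: topspace_lp_topology[OF p])
    qed
    finally show "openin ?X {f \<in> {..<m} \<rightarrow>\<^sub>E carrier (lp_module G p).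
        (\<Otimes>\<^bsub>lp_tensor G p M\<^esub>j\<in>{..<m}. elem_tensor G M (lp_module G p) (x j) (f j)) \<in> carrier (lp_tensor G p M) - ?K}" .
  qed simp
  moreover have "?K \<subseteq> carrier (lp_tensor G p M)" by (auto intro: tensor_class_closed)
  ultimately show ?thesis
    by (simp add: closedin_def topspace_lp_tensor_topology[OF assms(1,2)] openin_lp_tensor_topology)
qed

section \<open>Reduced homology\<close>

context lp_resolution
begin

abbreviation TF :: "nat \<Rightarrow> ('m \<times> ('g \<Rightarrow> complex) \<Rightarrow>\<^sub>0 int) set"
  where "TF i \<equiv> tensor_subgroup G (F i) (lp_module G p)"

abbreviation cls :: "nat \<Rightarrow> ('m \<times> ('g \<Rightarrow> complex) \<Rightarrow>\<^sub>0 int) \<Rightarrow> ('m \<times> ('g \<Rightarrow> complex) \<Rightarrow>\<^sub>0 int) set"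
  where "cls i \<equiv> tensor_class G (F i) (lp_module G p)"

abbreviation chains :: "nat \<Rightarrow> ('m \<times> ('g \<Rightarrow> complex) \<Rightarrow>\<^sub>0 int) set"
  where "chains i \<equiv> {c. Poly_Mapping.keys c \<subseteq> carrier (F i) \<times> carrier (lp_module G p)}"

lemma tensor_F: "tensor_modules G (F i) (lp_module G p)"
  by (intro tensor_modules.intro group_G F_module L.left_module_axioms)

lemma tensor_hom_F: "h \<in> mod_hom (group_ring G) (F i) (F j) \<Longrightarrow> tensor_hom G (F i) (F j) (lp_module G p) h"
  by (intro tensor_hom.intro tensor_hom_axioms.intro tensor_F)

lemma group_tensor_F: "Group.group (lp_tensor G p (F i))"
  using tensor_modules.comm_group_tensor[OF tensor_F] by (simp add: comm_group_def)

lemma group_hom_lp_boundary: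
  "group_hom (lp_tensor G p (F (Suc i))) (lp_tensor G p (F i)) (lp_boundary G p F d (Suc i))"
  using tensor_hom.tensor_map_hom[OF tensor_hom_F[OF d_hom]]
  by (intro group_hom.intro group_hom_axioms.intro group_tensor_F) (simp add: lp_boundary_def)

lemma lp_boundary_class: "c \<in> chains (Suc i) \<Longrightarrow> lp_boundary G p F d (Suc i) (cls (Suc i) c) = cls i (push (d (Suc i)) c)"
  using tensor_hom.tensor_map_class[OF tensor_hom_F[OF d_hom]] by (simp add: lp_boundary_def)

lemma lp_boundaries_eq: "lp_boundaries G p F d i = cls i ` push (d (Suc i)) ` chains (Suc i)"
  unfolding lp_boundaries_def tensor_modules.carrier_tensor[OF tensor_F] image_image
  by (intro image_cong refl lp_boundary_class)

lemma push_d_chains: "c \<in> chains (Suc i) \<Longrightarrow> push (d (Suc i)) c \<in> chains i"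
  using tensor_hom.push_keys[OF tensor_hom_F[OF d_hom]] by simp

text \<open>The cycle condition on representatives. It is vacuous in degree 0, in accordance with
  \<open>lp_cycles\<close>.\<close>

definition cycle_rep :: "nat \<Rightarrow> ('m \<times> ('g \<Rightarrow> complex) \<Rightarrow>\<^sub>0 int) \<Rightarrow> bool"
  where "cycle_rep i c \<longleftrightarrow> (\<forall>j. i = Suc j \<longrightarrow> push (d (Suc j)) c \<in> TF j)"

lemma cls_in_cycles_iff:
  assumes "c \<in> chains i"
  shows "cls i c \<in> lp_cycles G p F d i \<longleftrightarrow> cycle_rep i c"
proof (cases i)
  case 0
  then show ?thesis
    using assms tensor_modules.tensor_class_closed[OF tensor_F] by (simp add: lp_cycles_def cycle_rep_def)
next
  case (Suc j)
  interpret Tj: tensor_modules G "F j" "lp_module G p" by (rule tensor_F)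
  have "push (d (Suc j)) c \<in> chains j" using assms push_d_chains by (simp add: Suc)
  then have "cls j (push (d (Suc j)) c) = cls j 0 \<longleftrightarrow> push (d (Suc j)) c \<in> TF j"
    by (subst Tj.tensor_class_eq_iff) auto
  then show ?thesis
    using assms tensor_modules.tensor_class_closed[OF tensor_F, of c "Suc j"]
    by (simp add: Suc lp_cycles_def kernel_def cycle_rep_def lp_boundary_class Tj.tensor_class_zero)
qed

text \<open>The functionals separate points of the tensor product with the projective module
  \<open>F j\<close>; pulled back along \<open>d\<close> they cut out the cycles. Both closedness of
  cycles and their invariance under complex weights are read off from this form.\<close>

lemma cycle_rep_iff:
  assumes "c \<in> chains i"
  shows "cycle_rep i c \<longleftrightarrow> (\<forall>j \<xi> g. i = Suc j \<longrightarrow> \<xi> \<in> mod_hom (group_ring G) (F j) (regular_module (group_ring G)) \<longrightarrow>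
    lin_ext (lp_functional G p (\<lambda>x. \<xi> (d (Suc j) x)) g) c = 0)"
proof -
  have push: "lin_ext (lp_functional G p \<xi> g) (push (d (Suc j)) c) =
      lin_ext (lp_functional G p (\<lambda>x. \<xi> (d (Suc j) x)) g) c" for \<xi> j g
    unfolding lin_ext_push by (simp add: lp_functional_def)
  have "push (d (Suc j)) c \<in> TF j \<longleftrightarrow> (\<forall>\<xi> g. \<xi> \<in> mod_hom (group_ring G) (F j) (regular_module (group_ring G)) \<longrightarrow>
      lin_ext (lp_functional G p \<xi> g) (push (d (Suc j)) c) = 0)" if "i = Suc j" for j
  proof
    assume "push (d (Suc j)) c \<in> TF j"
    then show "\<forall>\<xi> g. \<xi> \<in> mod_hom (group_ring G) (F j) (regular_module (group_ring G)) \<longrightarrow>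
      lin_ext (lp_functional G p \<xi> g) (push (d (Suc j)) c) = 0"
      using lp_functional_T[OF tensor_F] by blast
  next
    assume "\<forall>\<xi> g. \<xi> \<in> mod_hom (group_ring G) (F j) (regular_module (group_ring G)) \<longrightarrow>
      lin_ext (lp_functional G p \<xi> g) (push (d (Suc j)) c) = 0"
    then show "push (d (Suc j)) c \<in> TF j"
      using push_d_chains[of c j] assms that
      by (intro tensor_zero_criterion[OF tensor_F p_ge_1 resolution_projective[OF resol]]) auto
  qed
  then show ?thesis unfolding cycle_rep_def push by blast
qed

lemma lp_cycles_carrier: "lp_cycles G p F d i \<subseteq> carrier (lp_tensor G p (F i))"
  by (auto simp: lp_cycles_def kernel_def)

text \<open>On a generator \<open>d \<circ> d\<close> produces a pair with first entry 0, which is a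
  relation but not the zero formal sum; hence the induction over formal sums.\<close>

lemma lp_boundaries_subset: "lp_boundaries G p F d i \<subseteq> lp_cycles G p F d i"
proof
  fix b assume "b \<in> lp_boundaries G p F d i"
  then obtain c where c: "c \<in> chains (Suc i)" "b = cls i (push (d (Suc i)) c)"
    by (auto simp: lp_boundaries_eq)
  have "cycle_rep i (push (d (Suc i)) c)"
    unfolding cycle_rep_def
  proof (intro allI impI)
    fix j assume i: "i = Suc j"
    interpret Tj: tensor_modules G "F j" "lp_module G p" by (rule tensor_F)
    have "Poly_Mapping.keys c \<subseteq> carrier (F (Suc (Suc j))) \<times> carrier (lp_module G p)"
      using c(1) by (simp add: i)
    then show "push (d (Suc j)) (push (d (Suc i)) c) \<in> TF j"
      unfolding i
    proof (induction c rule: frag_induction)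
      case (one z)
      then show ?case
        by (auto simp: resolution_d_d[OF resol] intro: Tj.T_zero_left)
    qed (auto intro: Tj.T_zero Tj.T_diff)
  qed
  then show "b \<in> lp_cycles G p F d i"
    using cls_in_cycles_iff[OF push_d_chains[OF c(1)]] c(2) by simp
qed

lemma closure_lp_boundaries_subset:
  "lp_tensor_topology G p (F i) closure_of lp_boundaries G p F d i \<subseteq> lp_cycles G p F d i"
proof
  fix b assume b: "b \<in> lp_tensor_topology G p (F i) closure_of lp_boundaries G p F d i"
  interpret Ti: tensor_modules G "F i" "lp_module G p" by (rule tensor_F)
  have "b \<in> carrier (lp_tensor G p (F i))"
    using b by (metis in_closure_of topspace_lp_tensor_topology[OF tensor_F p_ge_1])
  then obtain c where c: "c \<in> chains i" "b = cls i c" by (auto simp: Ti.carrier_tensor)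
  have "lin_ext (lp_functional G p (\<lambda>x. \<xi> (d (Suc j) x)) g) c = 0"
    if i: "i = Suc j" and \<xi>: "\<xi> \<in> mod_hom (group_ring G) (F j) (regular_module (group_ring G))" for j \<xi> g
  proof -
    let ?\<phi> = "lp_functional G p (\<lambda>x. \<xi> (d (Suc j) x)) g"
    \<comment> \<open>Composed with the differential, \<open>\<xi>\<close> becomes a functional on
      \<open>F i\<close> itself, so the kernel \<open>?K\<close> is closed in the topology in which
      the closure is taken.\<close>
    have \<xi>d: "(\<lambda>x. \<xi> (d (Suc j) x)) \<in> mod_hom (group_ring G) (F i) (regular_module (group_ring G))"
      unfolding i by (rule mod_hom_compose[OF d_hom \<xi>])
    let ?K = "cls i ` {c. Poly_Mapping.keys c \<subseteq> carrier (F i) \<times> carrier (lp_module G p) \<and> lin_ext ?\<phi> c = 0}"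
    have "lp_boundaries G p F d i \<subseteq> ?K"
    proof
      fix b' assume b': "b' \<in> lp_boundaries G p F d i"
      then obtain c' where c': "c' \<in> chains (Suc i)" "b' = cls i (push (d (Suc i)) c')"
        by (auto simp: lp_boundaries_eq)
      have "cycle_rep i (push (d (Suc i)) c')"
        using b' lp_boundaries_subset cls_in_cycles_iff[OF push_d_chains[OF c'(1)]] c'(2) by blast
      then have "lin_ext ?\<phi> (push (d (Suc i)) c') = 0"
        using cycle_rep_iff[OF push_d_chains[OF c'(1)]] i \<xi> by blast
      then show "b' \<in> ?K" using push_d_chains[OF c'(1)] c'(2) by blast
    qed
    then have "b \<in> ?K"
      using closure_of_minimal[OF _ closedin_lp_functional_kernel[OF tensor_F p_ge_1 \<xi>d]] b by blast
    then obtain c' where c': "c' \<in> chains i" "lin_ext ?\<phi> c' = 0" "cls i c = cls i c'"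
      using c(2) by auto
    then have "c - c' \<in> TF i" using c(1) Ti.tensor_class_eq_iff[of c c'] by simp
    from lp_functional_T[OF tensor_F \<xi>d this, of g] c'(2) show ?thesis by simp
  qed
  then have "cycle_rep i c" using cycle_rep_iff[OF c(1)] by blast
  then show "b \<in> lp_cycles G p F d i" using cls_in_cycles_iff[OF c(1)] c(2) by simp
qed

lemma subgroup_lp_cycles: "subgroup (lp_cycles G p F d i) (lp_tensor G p (F i))"
proof (cases i)
  case 0
  then show ?thesis using Group.group.subgroup_self[OF group_tensor_F] by (simp add: lp_cycles_def)
next
  case (Suc j)
  then show ?thesis using group_hom.subgroup_kernel[OF group_hom_lp_boundary] by (simp add: lp_cycles_def)
qed

lemma subgroup_lp_boundaries: "subgroup (lp_boundaries G p F d i) (lp_tensor G p (F i))"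
  unfolding lp_boundaries_def by (rule group_hom.img_is_subgroup[OF group_hom_lp_boundary])

lemma sum_in_boundaries:
  assumes "finite K" "\<And>k. k \<in> K \<Longrightarrow> c k \<in> chains i" "\<And>k. k \<in> K \<Longrightarrow> cls i (c k) \<in> lp_boundaries G p F d i"
  shows "cls i (\<Sum>k\<in>K. c k) \<in> lp_boundaries G p F d i"
proof -
  interpret Ti: tensor_modules G "F i" "lp_module G p" by (rule tensor_F)
  show ?thesis
    using assms
  proof (induction K rule: finite_induct)
    case empty
    then show ?case
      using subgroup.one_closed[OF subgroup_lp_boundaries, of i] by (simp add: Ti.tensor_class_zero)
  next
    case (insert k K)
    have "Poly_Mapping.keys (\<Sum>k\<in>K. c k) \<subseteq> carrier (F i) \<times> carrier (lp_module G p)"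
      using insert.prems by (intro order_trans[OF Poly_Mapping.keys_sum]) auto
    then have "cls i (\<Sum>k\<in>insert k K. c k) = cls i (c k) \<otimes>\<^bsub>lp_tensor G p (F i)\<^esub> cls i (\<Sum>k\<in>K. c k)"
      using insert.prems insert.hyps by (simp add: Ti.tensor_class_mult)
    then show ?case
      using subgroup.m_closed[OF subgroup_lp_boundaries] insert by simp
  qed
qed

text \<open>The relation \<open>x a = a\<^sup>* x\<close> turns the action of \<^term>\<open>conj_defect G (C k)\<close> on \<open>l\<^sup>p(G)\<close> into that of
  the defect of the inverse class on \<open>F\<^sub>i\<close>, which is null-homotopic.\<close>

lemma defect_boundary:
  assumes x: "x \<in> {..<m::nat} \<rightarrow> carrier (F i)" and v: "v \<in> {..<m} \<rightarrow> carrier (lp_module G p)"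
    and cycle: "cycle_rep i (\<Sum>j<m. frag_of (x j, v j))"
  shows "cls i (\<Sum>j<m. frag_of (x j, conj_defect G (C k) \<odot>\<^bsub>lp_module G p\<^esub> v j)) \<in> lp_boundaries G p F d i"
proof -
  interpret Ti: tensor_modules G "F i" "lp_module G p" by (rule tensor_F)
  let ?S = "(\<lambda>g. inv\<^bsub>G\<^esub> g) ` C k"
  let ?w = "conj_defect G (C k)" and ?w' = "conj_defect G ?S"
  have S: "?S \<subseteq> carrier G" using C_subset by auto
  have S_inv: "g \<otimes>\<^bsub>G\<^esub> h \<otimes>\<^bsub>G\<^esub> inv\<^bsub>G\<^esub> g \<in> ?S" if "g \<in> carrier G" "h \<in> ?S" for g h
  proof -
    from that obtain h' where h': "h' \<in> C k" "h = inv\<^bsub>G\<^esub> h'" by blast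
    then have "h' \<in> carrier G" using C_subset by blast
    then have "g \<otimes>\<^bsub>G\<^esub> h \<otimes>\<^bsub>G\<^esub> inv\<^bsub>G\<^esub> g = inv\<^bsub>G\<^esub> (g \<otimes>\<^bsub>G\<^esub> h' \<otimes>\<^bsub>G\<^esub> inv\<^bsub>G\<^esub> g)"
      using that(1) h'(2) by (simp add: G.inv_mult_group G.m_assoc)
    then show ?thesis using C_invariant[OF that(1) h'(1)] by blast
  qed
  have w: "?w \<in> carrier (group_ring G)" by (rule G.conj_defect_closed[OF C_subset])
  have star: "group_ring_star G ?w = ?w'" by (rule G.group_ring_star_conj_defect[OF C_subset])
  have xj: "x j \<in> carrier (F i)" and vj: "v j \<in> carrier (lp_module G p)" if "j < m" for j
    using x v that by auto
  have wv: "frag_of (x j, ?w \<odot>\<^bsub>lp_module G p\<^esub> v j) - frag_of (?w' \<odot>\<^bsub>F i\<^esub> x j, v j) \<in> TF i" if "j < m" for j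
    using Ti.T_sym[OF Ti.T_balanced[OF w xj[OF that] vj[OF that]]] by (simp add: star)
  \<comment> \<open>The homotopy acts on the left factors with the coefficients \<open>v j\<close>
    fixed; the claim is that modulo relations only its half \<open>d s\<close> survives.\<close>
  have "\<exists>s \<in> mod_hom (group_ring G) (F i) (F (Suc i)).
    (\<Sum>j<m. frag_of (?w' \<odot>\<^bsub>F i\<^esub> x j, v j)) - push (d (Suc i)) (\<Sum>j<m. frag_of (s (x j), v j)) \<in> TF i"
  proof (cases i)
    case 0
    from defect_homotopy_0[OF S S_inv] obtain s where s: "s \<in> mod_hom (group_ring G) (F 0) (F (Suc 0))"
      "\<And>x. x \<in> carrier (F 0) \<Longrightarrow> d (Suc 0) (s x) = ?w' \<odot>\<^bsub>F 0\<^esub> x" by blast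
    have eq: "(\<Sum>j<m. frag_of (?w' \<odot>\<^bsub>F i\<^esub> x j, v j)) = push (d (Suc i)) (\<Sum>j<m. frag_of (s (x j), v j))"
      using xj s(2) by (simp add: 0)
    show ?thesis
    proof (rule bexI[of _ s])
      show "s \<in> mod_hom (group_ring G) (F i) (F (Suc i))" using s(1) by (simp add: 0)
    qed (simp only: eq diff_self Ti.T_zero)
  next
    case (Suc n)
    interpret Tn: tensor_modules G "F n" "lp_module G p" by (rule tensor_F)
    from defect_homotopy_Suc[OF S S_inv, of n] obtain s t
      where s: "s \<in> mod_hom (group_ring G) (F (Suc n)) (F (Suc (Suc n)))"
      and t: "t \<in> mod_hom (group_ring G) (F n) (F (Suc n))"
      and st: "\<And>x. x \<in> carrier (F (Suc n)) \<Longrightarrow> ?w' \<odot>\<^bsub>F (Suc n)\<^esub> x = d (Suc (Suc n)) (s x) \<oplus>\<^bsub>F (Suc n)\<^esub> t (d (Suc n) x)"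
      by blast
    have "frag_of (?w' \<odot>\<^bsub>F i\<^esub> x j, v j) - (frag_of (d (Suc i) (s (x j)), v j) + frag_of (t (d i (x j)), v j)) \<in> TF i"
      if "j < m" for j
      using Ti.T_add_left[of "d (Suc i) (s (x j))" "t (d i (x j))" "v j"] vj[OF that] xj[OF that] st[of "x j"]
        mod_hom_closed[OF d_hom mod_hom_closed[OF s, of "x j"]] mod_hom_closed[OF t mod_hom_closed[OF d_hom, of "x j"]]
      by (simp add: Suc)
    then have "(\<Sum>j<m. frag_of (?w' \<odot>\<^bsub>F i\<^esub> x j, v j)) -
        (\<Sum>j<m. frag_of (d (Suc i) (s (x j)), v j) + frag_of (t (d i (x j)), v j)) \<in> TF i"
      by (intro Ti.T_sum_diff) auto
    \<comment> \<open>The half \<open>t d\<close> equals \<open>push t\<close> of the boundary of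
      the cycle. That boundary is a relation, and \<open>push t\<close> preserves relations because
      \<open>t\<close> is linear.\<close>
    moreover have "push (d i) (\<Sum>j<m. frag_of (x j, v j)) \<in> TF n"
      using cycle unfolding cycle_rep_def Suc by blast
    then have "push t (push (d i) (\<Sum>j<m. frag_of (x j, v j))) \<in> TF i"
      unfolding Suc by (rule tensor_hom.push_T[OF tensor_hom_F[OF t]])
    ultimately have "((\<Sum>j<m. frag_of (?w' \<odot>\<^bsub>F i\<^esub> x j, v j)) -
        (\<Sum>j<m. frag_of (d (Suc i) (s (x j)), v j) + frag_of (t (d i (x j)), v j))) +
        push t (push (d i) (\<Sum>j<m. frag_of (x j, v j))) \<in> TF i"
      by (rule Ti.T_add)
    then have "(\<Sum>j<m. frag_of (?w' \<odot>\<^bsub>F i\<^esub> x j, v j)) - push (d (Suc i)) (\<Sum>j<m. frag_of (s (x j), v j)) \<in> TF i"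
      by (simp add: sum.distrib)
    with s show ?thesis by (auto simp: Suc)
  qed
  then obtain s where s: "s \<in> mod_hom (group_ring G) (F i) (F (Suc i))"
    "(\<Sum>j<m. frag_of (?w' \<odot>\<^bsub>F i\<^esub> x j, v j)) - push (d (Suc i)) (\<Sum>j<m. frag_of (s (x j), v j)) \<in> TF i" by blast
  have "(\<Sum>j<m. frag_of (x j, ?w \<odot>\<^bsub>lp_module G p\<^esub> v j)) - (\<Sum>j<m. frag_of (?w' \<odot>\<^bsub>F i\<^esub> x j, v j)) \<in> TF i"
    using wv by (intro Ti.T_sum_diff) auto
  from Ti.T_trans[OF this s(2)]
  have diff: "(\<Sum>j<m. frag_of (x j, ?w \<odot>\<^bsub>lp_module G p\<^esub> v j)) - push (d (Suc i)) (\<Sum>j<m. frag_of (s (x j), v j)) \<in> TF i" .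
  have b: "(\<Sum>j<m. frag_of (s (x j), v j)) \<in> chains (Suc i)"
    using tensor_modules.keys_sum_tensor[OF tensor_F, of "\<lambda>j. s (x j)" m "Suc i" v] v xj mod_hom_closed[OF s(1)] by auto
  have "(\<Sum>j<m. frag_of (x j, ?w \<odot>\<^bsub>lp_module G p\<^esub> v j)) \<in> chains i"
    using Ti.keys_sum_tensor[OF x, of "\<lambda>j. ?w \<odot>\<^bsub>lp_module G p\<^esub> v j"] w vj by auto
  then have "cls i (\<Sum>j<m. frag_of (x j, ?w \<odot>\<^bsub>lp_module G p\<^esub> v j)) = cls i (push (d (Suc i)) (\<Sum>j<m. frag_of (s (x j), v j)))"
    using Ti.tensor_class_eq_iff push_d_chains[OF b] diff by simp
  then show ?thesis unfolding lp_boundaries_eq using b by blast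
qed

text \<open>The tensor product carries no complex scalars, so the weights of the average are moved
  into the coefficients \<open>f j\<close> before the defects act.\<close>

lemma approx_boundary:
  assumes x: "x \<in> {..<m::nat} \<rightarrow> carrier (F i)" and f: "f \<in> {..<m} \<rightarrow> carrier (lp_module G p)"
    and cycle: "cycle_rep i (\<Sum>j<m. frag_of (x j, f j))"
  shows "cls i (\<Sum>j<m. frag_of (x j, approx N (f j))) \<in> lp_boundaries G p F d i"
proof -
  interpret Ti: tensor_modules G "F i" "lp_module G p" by (rule tensor_F)
  let ?r = "\<lambda>k. - 1 / (of_nat (Suc N) * of_nat (card (C k))) :: complex"
  define v where "v k j = (\<lambda>g. ?r k * f j g)" for k j
  define u where "u k j = conj_defect G (C k) \<odot>\<^bsub>lp_module G p\<^esub> v k j" for k j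
  have xj: "x j \<in> carrier (F i)" and fj: "f j \<in> carrier (lp_module G p)" if "j < m" for j
    using x f that by auto
  have v: "v k \<in> {..<m} \<rightarrow> carrier (lp_module G p)" for k
    unfolding v_def using fj by (intro Pi_I lp_scale) simp
  have w: "conj_defect G (C k) \<in> carrier (group_ring G)" for k by (rule G.conj_defect_closed[OF C_subset])
  have u: "u k \<in> {..<m} \<rightarrow> carrier (lp_module G p)" for k
    using v w unfolding u_def by auto
  \<comment> \<open>Rescaling the right factors preserves cycles because the functionals in
    \<open>cycle_rep_iff\<close> are complex linear in \<open>f\<close>; the relations themselves
    have only integer coefficients.\<close>
  have "cycle_rep i (\<Sum>j<m. frag_of (x j, v k j))" for k
  proof -
    have scale: "lp_functional G p \<xi> g (x j, v k j) = ?r k * lp_functional G p \<xi> g (x j, f j)" for \<xi> g j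
      unfolding v_def lp_functional_def by (simp only: prod.case lp_smult_scale)
    have "lin_ext (lp_functional G p \<xi> g) (\<Sum>j<m. frag_of (x j, v k j)) =
        ?r k * lin_ext (lp_functional G p \<xi> g) (\<Sum>j<m. frag_of (x j, f j))" for \<xi> g
      by (simp only: lin_ext_sum lin_ext_simps scale sum_distrib_left)
    with cycle show ?thesis
      using cycle_rep_iff[of "\<Sum>j<m. frag_of (x j, v k j)" i] cycle_rep_iff[of "\<Sum>j<m. frag_of (x j, f j)" i]
        Ti.keys_sum_tensor[OF x v] Ti.keys_sum_tensor[OF x f] by simp
  qed
  then have bd: "cls i (\<Sum>j<m. frag_of (x j, u k j)) \<in> lp_boundaries G p F d i" for k
    unfolding u_def by (intro defect_boundary x v)
  have ch: "(\<Sum>j<m. frag_of (x j, u k j)) \<in> chains i" for k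
    using Ti.keys_sum_tensor[OF x u] by simp
  have B: "cls i (\<Sum>k<Suc N. \<Sum>j<m. frag_of (x j, u k j)) \<in> lp_boundaries G p F d i"
    by (rule sum_in_boundaries[OF finite_lessThan ch bd])
  have "frag_of (x j, approx N (f j)) - (\<Sum>k<Suc N. frag_of (x j, u k j)) \<in> TF i" if j: "j < m" for j
  proof -
    have uj: "u k j \<in> carrier (lp_module G p)" for k using u j by auto
    have "(\<Oplus>\<^bsub>lp_module G p\<^esub>k\<in>{..<Suc N}. u k j) = approx N (f j)"
      unfolding approx_eq[OF fj[OF j]]
      by (subst lp_finsum[OF group_G p_ge_1 finite_lessThan uj]) (simp only: u_def v_def lp_smult_scale)
    then show ?thesis
      using Ti.T_finsum_right[of "{..<Suc N}" "\<lambda>k. u k j" "x j"] uj xj[OF j] by simp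
  qed
  then have "(\<Sum>j<m. frag_of (x j, approx N (f j))) - (\<Sum>j<m. \<Sum>k<Suc N. frag_of (x j, u k j)) \<in> TF i"
    by (intro Ti.T_sum_diff) auto
  also have "(\<Sum>j<m. \<Sum>k<Suc N. frag_of (x j, u k j)) = (\<Sum>k<Suc N. \<Sum>j<m. frag_of (x j, u k j))"
    by (rule sum.swap)
  finally have diff: "(\<Sum>j<m. frag_of (x j, approx N (f j))) - (\<Sum>k<Suc N. \<Sum>j<m. frag_of (x j, u k j)) \<in> TF i" .
  have k1: "Poly_Mapping.keys (\<Sum>k<Suc N. \<Sum>j<m. frag_of (x j, u k j)) \<subseteq> carrier (F i) \<times> carrier (lp_module G p)"
    by (rule order_trans[OF Poly_Mapping.keys_sum], rule UN_least) (use ch in simp)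
  have k2: "Poly_Mapping.keys (\<Sum>j<m. frag_of (x j, approx N (f j))) \<subseteq> carrier (F i) \<times> carrier (lp_module G p)"
    using x fj by (intro Ti.keys_sum_tensor) (auto intro: approx_closed)
  have "cls i (\<Sum>j<m. frag_of (x j, approx N (f j))) = cls i (\<Sum>k<Suc N. \<Sum>j<m. frag_of (x j, u k j))"
    using Ti.tensor_class_eq_iff[OF k2 k1] diff by (rule iffD2)
  then show ?thesis using B by (rule ssubst)
qed

text \<open>For one fixed family \<open>x\<close> representing the class, a neighbourhood pulls back
  by definition to an open set of a finite power of l^p(G), where coordinatewise convergence is
  available.\<close>

lemma lp_cycles_subset_closure:
  "lp_cycles G p F d i \<subseteq> lp_tensor_topology G p (F i) closure_of lp_boundaries G p F d i"
proof
  fix b assume b: "b \<in> lp_cycles G p F d i"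
  interpret Ti: tensor_modules G "F i" "lp_module G p" by (rule tensor_F)
  have bc: "b \<in> carrier (lp_tensor G p (F i))" using b lp_cycles_carrier by blast
  then obtain c where c: "c \<in> chains i" "b = cls i c" by (auto simp: Ti.carrier_tensor)
  obtain m :: nat and x f where x: "x \<in> {..<m} \<rightarrow> carrier (F i)" and f: "f \<in> {..<m} \<rightarrow> carrier (lp_module G p)"
    and cT: "c - (\<Sum>j<m. frag_of (x j, f j)) \<in> TF i"
    using Ti.tensor_representation[of c] c(1) by blast
  let ?X = "product_topology (\<lambda>_. lp_topology G p) {..<m}"
  have fj: "f j \<in> carrier (lp_module G p)" if "j < m" for j using f that by auto
  have b_eq: "b = cls i (\<Sum>j<m. frag_of (x j, f j))"
    using c cT Ti.tensor_class_eq_iff Ti.keys_sum_tensor[OF x f] by simp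
  then have cycle: "cycle_rep i (\<Sum>j<m. frag_of (x j, f j))"
    using b cls_in_cycles_iff Ti.keys_sum_tensor[OF x f] by simp
  \<comment> \<open>Points of the product topology are extensional functions, hence the restrictions
    to the index set.\<close>
  let ?f = "restrict f {..<m}" and ?s = "\<lambda>N. \<lambda>j\<in>{..<m}. approx N (f j)"
  have f': "?f \<in> {..<m} \<rightarrow> carrier (lp_module G p)" using fj by auto
  have s': "?s N \<in> {..<m} \<rightarrow> carrier (lp_module G p)" for N using fj by (auto intro: approx_closed)
  have lim: "limitin ?X ?s ?f sequentially"
    unfolding limitin_componentwise
  proof (intro conjI ballI)
    show "\<forall>\<^sub>F N in sequentially. ?s N \<in> topspace ?X"
      by (auto simp: topspace_lp_topology[OF p_ge_1] approx_closed fj)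
    show "limitin (lp_topology G p) (\<lambda>N. ?s N j) (?f j) sequentially" if "j \<in> {..<m}" for j
      using approx_limitin[OF fj, of j] that by simp
  qed simp
  show "b \<in> lp_tensor_topology G p (F i) closure_of lp_boundaries G p F d i"
    unfolding in_closure_of
  proof (intro conjI allI impI)
    show "b \<in> topspace (lp_tensor_topology G p (F i))"
      using bc by (simp add: topspace_lp_tensor_topology[OF tensor_F p_ge_1])
    fix U assume "b \<in> U \<and> openin (lp_tensor_topology G p (F i)) U"
    then have bU: "b \<in> U" and U: "lp_tensor_open G p (F i) U" by (simp_all add: openin_lp_tensor_topology)
    let ?V = "{f \<in> {..<m} \<rightarrow>\<^sub>E carrier (lp_module G p).
      (\<Otimes>\<^bsub>lp_tensor G p (F i)\<^esub>j\<in>{..<m}. elem_tensor G (F i) (lp_module G p) (x j) (f j)) \<in> U}"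
    have "openin ?X ?V" using U x by (simp add: lp_tensor_open_def)
    moreover have eq: "(\<Sum>j<m. frag_of (x j, ?f j)) = (\<Sum>j<m. frag_of (x j, f j))"
      "(\<Sum>j<m. frag_of (x j, ?s N j)) = (\<Sum>j<m. frag_of (x j, approx N (f j)))" for N
      by (auto intro!: sum.cong)
    have "(\<Otimes>\<^bsub>lp_tensor G p (F i)\<^esub>j\<in>{..<m}. elem_tensor G (F i) (lp_module G p) (x j) (?f j)) \<in> U"
      using bU unfolding Ti.finprod_elem_tensor[OF x f'] eq b_eq .
    then have "?f \<in> ?V" using f' by (simp add: PiE_def)
    ultimately obtain N where "?s N \<in> ?V"
      using lim unfolding limitin_sequentially by (meson order_refl)
    then have "(\<Otimes>\<^bsub>lp_tensor G p (F i)\<^esub>j\<in>{..<m}. elem_tensor G (F i) (lp_module G p) (x j) (?s N j)) \<in> U"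
      by blast
    then have "cls i (\<Sum>j<m. frag_of (x j, approx N (f j))) \<in> U"
      unfolding Ti.finprod_elem_tensor[OF x s'] eq .
    with approx_boundary[OF x f cycle, of N]
    show "\<exists>y. y \<in> lp_boundaries G p F d i \<and> y \<in> U" by blast
  qed
qed

lemma trivial_reduced_lp_homology: "trivial_group (reduced_lp_homology G p F d i)"
proof -
  have "lp_tensor_topology G p (F i) closure_of lp_boundaries G p F d i = lp_cycles G p F d i"
    using closure_lp_boundaries_subset lp_cycles_subset_closure by blast
  then show ?thesis
    using trivial_group_subgroup_Mod_self[OF group_tensor_F subgroup_lp_cycles]
    by (simp add: reduced_lp_homology_def)
qed

end

theorem theorem6p4:
  fixes G :: "('g, 'b) monoid_scheme"
    and p :: real
    and n :: nat
    and F :: "nat \<Rightarrow> ('g \<Rightarrow>\<^sub>0 int, 'm) module"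
    and d :: "nat \<Rightarrow> 'm \<Rightarrow> 'm"
    and \<epsilon> :: "'m \<Rightarrow> int"
  assumes "1 < p"
    and "group G"
    and "type_FP n G"
    and "infinite {C \<in> conjugacy_classes G. finite C}"
    and "projective_resolution (group_ring G) trivial_module F d \<epsilon>"
    and "\<And>i. i \<le> n \<Longrightarrow> fin_generated (group_ring G) (F i)"
  shows "\<forall>i\<le>n. trivial_group (reduced_lp_homology G p F d i) \<and>
                trivial_group (reduced_lp_cohomology G p F d i)"
proof -
  interpret G: Group.group G by fact
  \<comment> \<open>An injective enumeration is what is wanted: distinct classes are disjoint, which
    gives the disjoint family required for averaging.\<close>
  obtain C :: "nat \<Rightarrow> 'g set" where C: "inj C" "range C \<subseteq> {C \<in> conjugacy_classes G. finite C}"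
    using infinite_countable_subset[OF assms(4)] by blast
  then have Cc: "C k \<in> conjugacy_classes G" "finite (C k)" for k by auto
  interpret lp_resolution G p F d \<epsilon> C
  proof (rule lp_resolution.intro)
    show "Group.group G" "1 < p" "projective_resolution (group_ring G) trivial_module F d \<epsilon>"
      by fact+
    show "disjoint_family C"
      using C(1) G.conjugacy_classes_disjoint[OF Cc(1) Cc(1)] by (auto simp: disjoint_family_on_def inj_eq)
    show "finite (C k)" "C k \<subseteq> carrier G" "C k \<noteq> {}" for k
      using Cc G.conjugacy_class_subset G.conjugacy_class_nonempty by blast+
    show "g \<otimes>\<^bsub>G\<^esub> h \<otimes>\<^bsub>G\<^esub> inv\<^bsub>G\<^esub> g \<in> C k" if "g \<in> carrier G" "h \<in> C k" for k g h
      by (rule G.conjugacy_class_invariant[OF Cc(1) that])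
  qed
  show ?thesis
    using trivial_reduced_lp_homology trivial_reduced_lp_cohomology by blast
qed

end
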